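(* Let $H$ be an inner-abelian metacyclic $3$-group and let $\Gamma$ be a finite, connected, simple, undirected cubic edge-transitive graph which is a bi-Cayley graph over $H$. Then $\Gamma$ is isomorphic to $\Gamma_t$ or to $\Sigma_t$ for some positive integer $t$, where $\Gamma_t=\mathrm{BiCay}(\mathcal{G},\emptyset,\emptyset,\{1,a,a^{-1}b\})$ with $\mathcal{G}=\langle a,b\mid a^{3^{t+1}}=b^{3^t}=1,\ b^{-1}ab=a^{1+3^t}\rangle$, and $\Sigma_t=\mathrm{BiCay}(\mathcal{H},\emptyset,\emptyset,\{1,b,b^{-1}a\})$ with $\mathcal{H}=\langle a,b\mid a^{3^{t+1}}=b^{3^{t+1}}=1,\ b^{-1}ab=a^{1+3^t}\rangle$.
   Context: A non-abelian group is inner-abelian if all its proper subgroups are abelian. A group is metacyclic if it has a cyclic normal subgroup with cyclic quotient. A graph $\Gamma$ is a bi-Cayley graph over $H$ if $\mathrm{Aut}(\Gamma)$ contains a subgroup isomorphic to $H$ acting semiregularly on $V(\Gamma)$ with exactly two orbits. For a group $H$ and subsets $R=R^{-1}$, $L=L^{-1}$, $S$ of $H$ with $1\notin R\cup L$, $\mathrm{BiCay}(H,R,L,S)$ is the graph with vertex set $H_0\cup H_1$, $H_i=\{h_i:h\in H\}$, and edges $\{h_0,g_0\}$ for $gh^{-1}\in R$, $\{h_1,g_1\}$ for $gh^{-1}\in L$, and $\{h_0,g_1\}$ for $gh^{-1}\in S$. Edge-transitive means $\mathrm{Aut}(\Gamma)$ is transitive on edges. *)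

theory Defs
  imports
    "HOL-Algebra.Elementary_Groups"
    "HOL-Algebra.Multiplicative_Group"
    "HOL-Algebra.Group_Action"
    "Graph_Theory.Graph_Theory"
begin

section \<open>Groups\<close>

definition inner_abelian :: "('a, 'b) monoid_scheme \<Rightarrow> bool" where
  "inner_abelian G \<longleftrightarrow> group G \<and> \<not> comm_group G \<and>
     (\<forall>K. subgroup K G \<and> K \<noteq> carrier G \<longrightarrow> comm_group (G\<lparr>carrier := K\<rparr>))"

definition metacyclic :: "('a, 'b) monoid_scheme \<Rightarrow> bool" where
  "metacyclic G \<longleftrightarrow> group G \<and>
     (\<exists>N. N \<lhd> G \<and> cyclic_group (G\<lparr>carrier := N\<rparr>) \<and> cyclic_group (G Mod N))"

text \<open>Finiteness is not required here; \<open>ord\<close> is \<open>0\<close> on elements of infinite order.\<close>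

definition p_group :: "nat \<Rightarrow> ('a, 'b) monoid_scheme \<Rightarrow> bool" where
  "p_group p G \<longleftrightarrow> group G \<and> (\<forall>x\<in>carrier G. \<exists>n. group.ord G x = p ^ n)"

section \<open>Groups given by generators and relations\<close>

text \<open>
  A word is a list of letters \<open>(g, s)\<close>, standing for the generator \<open>g\<close> if \<open>s\<close> holds and for
  its formal inverse otherwise. A pair \<open>(u, v)\<close> in \<open>R\<close> is the relation \<open>u = v\<close>. The presented
  group consists of the classes of words modulo the congruence generated by \<open>R\<close> and free
  cancellation; all elements of the type \<open>'g\<close> are generators.
\<close>

type_synonym 'g word = "('g \<times> bool) list"

inductive pres_eq :: "('g word \<times> 'g word) set \<Rightarrow> 'g word \<Rightarrow> 'g word \<Rightarrow> bool"
  for R where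
  refl: "pres_eq R w w"
| sym: "pres_eq R u v \<Longrightarrow> pres_eq R v u"
| trans: "pres_eq R u v \<Longrightarrow> pres_eq R v w \<Longrightarrow> pres_eq R u w"
| cancel: "pres_eq R (x @ [(g, s), (g, \<not> s)] @ y) (x @ y)"
| relation: "(u, v) \<in> R \<Longrightarrow> pres_eq R (x @ u @ y) (x @ v @ y)"

definition pres_class :: "('g word \<times> 'g word) set \<Rightarrow> 'g word \<Rightarrow> 'g word set" where
  "pres_class R w = {v. pres_eq R w v}"

definition presented_group :: "('g word \<times> 'g word) set \<Rightarrow> 'g word set monoid" where
  "presented_group R =
     \<lparr>carrier = range (pres_class R),
      monoid.mult = \<lambda>A B. \<Union>u\<in>A. \<Union>v\<in>B. pres_class R (u @ v),
      one = pres_class R []\<rparr>"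

definition pres_gen :: "('g word \<times> 'g word) set \<Rightarrow> 'g \<Rightarrow> 'g word set" where
  "pres_gen R g = pres_class R [(g, True)]"

lemma pres_class_eq_iff: "pres_class R u = pres_class R v \<longleftrightarrow> pres_eq R u v"
  unfolding pres_class_def set_eq_iff mem_Collect_eq
  by (meson pres_eq.refl pres_eq.sym pres_eq.trans)

lemma pres_eq_context: "pres_eq R u v \<Longrightarrow> pres_eq R (x @ u @ y) (x @ v @ y)"
proof (induction rule: pres_eq.induct)
  case (cancel x' g s y')
  show ?case using pres_eq.cancel[of R "x @ x'" g s "y' @ y"] by simp
next
  case (relation u v x' y')
  show ?case using pres_eq.relation[OF relation, of "x @ x'" "y' @ y"] by simp
qed (blast intro: pres_eq.refl pres_eq.sym, blast intro: pres_eq.sym, blast intro: pres_eq.trans)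

lemma pres_eq_append:
  assumes "pres_eq R u u'" and "pres_eq R v v'"
  shows "pres_eq R (u @ v) (u' @ v')"
proof (rule pres_eq.trans)
  show "pres_eq R (u @ v) (u' @ v)"
    using pres_eq_context[OF assms(1), of "[]" v] by simp
  show "pres_eq R (u' @ v) (u' @ v')"
    using pres_eq_context[OF assms(2), of u' "[]"] by simp
qed

lemma presented_group_mult:
  "pres_class R u \<otimes>\<^bsub>presented_group R\<^esub> pres_class R v = pres_class R (u @ v)"
proof -
  have eq: "pres_class R (u' @ v') = pres_class R (u @ v)"
    if "u' \<in> pres_class R u" "v' \<in> pres_class R v" for u' v'
    unfolding pres_class_eq_iff
    using that by (intro pres_eq.sym[OF pres_eq_append]) (simp_all add: pres_class_def)
  have "u \<in> pres_class R u" "v \<in> pres_class R v"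
    by (simp_all add: pres_class_def pres_eq.refl)
  with eq have "(\<Union>u'\<in>pres_class R u. \<Union>v'\<in>pres_class R v. pres_class R (u' @ v'))
      = pres_class R (u @ v)"
    by blast
  then show ?thesis by (simp add: presented_group_def)
qed

lemma pres_eq_inverse: "pres_eq R (map (\<lambda>(g, s). (g, \<not> s)) (rev w) @ w) []"
proof (induction w)
  case (Cons p w)
  obtain g s where p: "p = (g, s)" by force
  let ?w = "map (\<lambda>(g, s). (g, \<not> s)) (rev w)"
  have "pres_eq R (?w @ [(g, \<not> s), (g, \<not> \<not> s)] @ w) (?w @ w)"
    by (rule pres_eq.cancel)
  from pres_eq.trans[OF this Cons] show ?case by (simp add: p)
qed (simp add: pres_eq.refl)

lemma group_presented_group: "group (presented_group R)"
proof (rule groupI)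
  fix x assume "x \<in> carrier (presented_group R)"
  then obtain w where w: "x = pres_class R w" by (auto simp: presented_group_def)
  show "\<exists>y\<in>carrier (presented_group R). y \<otimes>\<^bsub>presented_group R\<^esub> x = \<one>\<^bsub>presented_group R\<^esub>"
  proof
    show "pres_class R (map (\<lambda>(g, s). (g, \<not> s)) (rev w)) \<otimes>\<^bsub>presented_group R\<^esub> x
        = \<one>\<^bsub>presented_group R\<^esub>"
      unfolding w presented_group_mult
      by (simp add: presented_group_def pres_class_eq_iff pres_eq_inverse)
  qed (simp add: presented_group_def)
next
  show "\<one>\<^bsub>presented_group R\<^esub> \<in> carrier (presented_group R)"
    by (simp add: presented_group_def)
next
  fix x assume "x \<in> carrier (presented_group R)"
  then obtain w where w: "x = pres_class R w" by (auto simp: presented_group_def)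
  show "\<one>\<^bsub>presented_group R\<^esub> \<otimes>\<^bsub>presented_group R\<^esub> x = x"
    using presented_group_mult[of R "[]" w] by (simp add: presented_group_def w)
next
  fix x y assume "x \<in> carrier (presented_group R)" "y \<in> carrier (presented_group R)"
  then obtain u v where uv: "x = pres_class R u" "y = pres_class R v"
    by (auto simp: presented_group_def)
  show "x \<otimes>\<^bsub>presented_group R\<^esub> y \<in> carrier (presented_group R)"
    unfolding uv presented_group_mult by (simp add: presented_group_def)
next
  fix x y z
  assume "x \<in> carrier (presented_group R)" "y \<in> carrier (presented_group R)"
    "z \<in> carrier (presented_group R)"
  then obtain u v w where "x = pres_class R u" "y = pres_class R v" "z = pres_class R w"
    by (auto simp: presented_group_def)
  then show "x \<otimes>\<^bsub>presented_group R\<^esub> y \<otimes>\<^bsub>presented_group R\<^esub> z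
      = x \<otimes>\<^bsub>presented_group R\<^esub> (y \<otimes>\<^bsub>presented_group R\<^esub> z)"
    by (simp add: presented_group_mult)
qed

fun word_eval :: "('a, 'b) monoid_scheme \<Rightarrow> ('g \<Rightarrow> 'a) \<Rightarrow> 'g word \<Rightarrow> 'a" where
  "word_eval K f [] = \<one>\<^bsub>K\<^esub>"
| "word_eval K f ((g, s) # w) = (if s then f g else inv\<^bsub>K\<^esub> f g) \<otimes>\<^bsub>K\<^esub> word_eval K f w"

text \<open>The universal property of the presentation (von Dyck).\<close>

lemma presented_group_universal:
  assumes "group K" and f: "\<And>g. f g \<in> carrier K"
    and rels: "\<And>u v. (u, v) \<in> R \<Longrightarrow> word_eval K f u = word_eval K f v"
  shows "\<exists>h \<in> hom (presented_group R) K. \<forall>g. h (pres_gen R g) = f g"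
proof -
  interpret group K by fact
  have cl: "word_eval K f w \<in> carrier K" for w
    by (induction w) (auto simp: f)
  have app: "word_eval K f (u @ v) = word_eval K f u \<otimes>\<^bsub>K\<^esub> word_eval K f v" for u v
    by (induction u) (auto simp: f cl m_assoc)
  have eq: "pres_eq R u v \<Longrightarrow> word_eval K f u = word_eval K f v" for u v
  proof (induction rule: pres_eq.induct)
    case (cancel x g s y)
    have "word_eval K f [(g, s), (g, \<not> s)] = \<one>\<^bsub>K\<^esub>" by (simp add: f)
    then show ?case using cl[of x] cl[of y] by (simp only: app) simp
  next
    case (relation u v x y)
    show ?case by (simp only: app rels[OF relation])
  qed simp_all
  define h where "h A = word_eval K f (SOME w. A = pres_class R w)" for A
  have h: "h (pres_class R w) = word_eval K f w" for w
  proof -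
    have "pres_class R w = pres_class R (SOME v. pres_class R w = pres_class R v)"
      by (rule someI) (rule HOL.refl)
    then have "pres_eq R w (SOME v. pres_class R w = pres_class R v)"
      by (simp only: pres_class_eq_iff)
    from eq[OF this] show ?thesis by (simp only: h_def)
  qed
  have "h \<in> hom (presented_group R) K"
  proof (rule homI)
    fix x y assume "x \<in> carrier (presented_group R)" "y \<in> carrier (presented_group R)"
    then obtain u v where "x = pres_class R u" "y = pres_class R v"
      by (auto simp: presented_group_def)
    then show "h (x \<otimes>\<^bsub>presented_group R\<^esub> y) = h x \<otimes>\<^bsub>K\<^esub> h y"
      by (simp add: presented_group_mult h app)
  qed (auto simp: presented_group_def h cl)
  moreover have "\<forall>g. h (pres_gen R g) = f g"
    by (simp add: pres_gen_def h f)
  ultimately show ?thesis by blast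
qed

section \<open>Graphs\<close>

text \<open>
  A finite simple undirected graph is a \<^locale>\<open>pair_graph\<close>: a finite vertex set with a
  symmetric irreflexive set of ordered pairs, so that an edge \<open>{u, v}\<close> is represented by its
  two arcs \<open>(u, v)\<close> and \<open>(v, u)\<close>.
\<close>

definition cubic :: "'v pair_pre_digraph \<Rightarrow> bool" where
  "cubic \<Gamma> \<longleftrightarrow> (\<forall>v\<in>pverts \<Gamma>. out_degree (with_proj \<Gamma>) v = 3)"

definition graph_auto :: "'v pair_pre_digraph \<Rightarrow> ('v \<Rightarrow> 'v) set" where
  "graph_auto \<Gamma> = {f \<in> Bij (pverts \<Gamma>).
     \<forall>u\<in>pverts \<Gamma>. \<forall>v\<in>pverts \<Gamma>. (f u, f v) \<in> parcs \<Gamma> \<longleftrightarrow> (u, v) \<in> parcs \<Gamma>}"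

definition graph_AutoGroup :: "'v pair_pre_digraph \<Rightarrow> ('v \<Rightarrow> 'v) monoid" where
  "graph_AutoGroup \<Gamma> = BijGroup (pverts \<Gamma>) \<lparr>carrier := graph_auto \<Gamma>\<rparr>"

lemma group_graph_AutoGroup: "group (graph_AutoGroup \<Gamma>)"
proof -
  let ?V = "pverts \<Gamma>"
  have "subgroup (graph_auto \<Gamma>) (BijGroup ?V)"
  proof (rule subgroup.intro)
    show "graph_auto \<Gamma> \<subseteq> carrier (BijGroup ?V)"
      by (auto simp: graph_auto_def BijGroup_def)
  next
    fix f g assume fg: "f \<in> graph_auto \<Gamma>" "g \<in> graph_auto \<Gamma>"
    then have "g u \<in> ?V" if "u \<in> ?V" for u
      using that by (auto simp: graph_auto_def dest: Bij_imp_funcset[THEN funcset_mem])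
    with fg show "f \<otimes>\<^bsub>BijGroup ?V\<^esub> g \<in> graph_auto \<Gamma>"
      by (simp add: graph_auto_def BijGroup_def compose_Bij compose_eq)
  next
    show "\<one>\<^bsub>BijGroup ?V\<^esub> \<in> graph_auto \<Gamma>"
      by (simp add: graph_auto_def BijGroup_def id_Bij)
  next
    fix f assume f: "f \<in> graph_auto \<Gamma>"
    then have B: "f \<in> Bij ?V" by (simp add: graph_auto_def)
    then have inv: "f (inv_into ?V f u) = u" "inv_into ?V f u \<in> ?V" if "u \<in> ?V" for u
      using that by (auto simp: Bij_def bij_betw_def f_inv_into_f inv_into_into)
    have "(inv_into ?V f u, inv_into ?V f v) \<in> parcs \<Gamma> \<longleftrightarrow> (u, v) \<in> parcs \<Gamma>"
      if "u \<in> ?V" "v \<in> ?V" for u v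
    proof -
      have "(f (inv_into ?V f u), f (inv_into ?V f v)) \<in> parcs \<Gamma> \<longleftrightarrow>
          (inv_into ?V f u, inv_into ?V f v) \<in> parcs \<Gamma>"
        using f inv(2)[OF that(1)] inv(2)[OF that(2)] unfolding graph_auto_def by blast
      then show ?thesis by (simp only: inv(1)[OF that(1)] inv(1)[OF that(2)])
    qed
    then show "inv\<^bsub>BijGroup ?V\<^esub> f \<in> graph_auto \<Gamma>"
      unfolding inv_BijGroup[OF B] graph_auto_def
      using restrict_inv_into_Bij[OF B] by simp
  qed
  then show ?thesis
    unfolding graph_AutoGroup_def
    by (rule subgroup.subgroup_is_group) (rule group_BijGroup)
qed

definition edge_transitive :: "'v pair_pre_digraph \<Rightarrow> bool" where
  "edge_transitive \<Gamma> \<longleftrightarrow>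
     (\<forall>(u, v)\<in>parcs \<Gamma>. \<forall>(x, y)\<in>parcs \<Gamma>. \<exists>f\<in>graph_auto \<Gamma>. f ` {u, v} = {x, y})"

definition semiregular :: "('g, 'b) monoid_scheme \<Rightarrow> 'v set \<Rightarrow> ('g \<Rightarrow> 'v \<Rightarrow> 'v) \<Rightarrow> bool" where
  "semiregular G E \<phi> \<longleftrightarrow> (\<forall>x\<in>E. stabilizer G \<phi> x = {\<one>\<^bsub>G\<^esub>})"

definition bi_Cayley_over :: "'v pair_pre_digraph \<Rightarrow> ('h, 'b) monoid_scheme \<Rightarrow> bool" where
  "bi_Cayley_over \<Gamma> H \<longleftrightarrow>
     (\<exists>K. subgroup K (graph_AutoGroup \<Gamma>) \<and>
          (let A = graph_AutoGroup \<Gamma> \<lparr>carrier := K\<rparr> in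
             A \<cong> H \<and> semiregular A (pverts \<Gamma>) (\<lambda>f. f) \<and> card (orbits A (pverts \<Gamma>) (\<lambda>f. f)) = 2))"

text \<open>\<open>Inl h\<close> and \<open>Inr h\<close> are the vertices \<open>h\<^sub>0\<close> and \<open>h\<^sub>1\<close>.\<close>

definition BiCay ::
  "('h, 'b) monoid_scheme \<Rightarrow> 'h set \<Rightarrow> 'h set \<Rightarrow> 'h set \<Rightarrow> ('h + 'h) pair_pre_digraph" where
  "BiCay H R L S =
     \<lparr>pverts = carrier H <+> carrier H,
      parcs = {(Inl h, Inl g) | h g. h \<in> carrier H \<and> g \<in> carrier H \<and> g \<otimes>\<^bsub>H\<^esub> inv\<^bsub>H\<^esub> h \<in> R}
            \<union> {(Inr h, Inr g) | h g. h \<in> carrier H \<and> g \<in> carrier H \<and> g \<otimes>\<^bsub>H\<^esub> inv\<^bsub>H\<^esub> h \<in> L}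
            \<union> {(Inl h, Inr g) | h g. h \<in> carrier H \<and> g \<in> carrier H \<and> g \<otimes>\<^bsub>H\<^esub> inv\<^bsub>H\<^esub> h \<in> S}
            \<union> {(Inr g, Inl h) | h g. h \<in> carrier H \<and> g \<in> carrier H \<and> g \<otimes>\<^bsub>H\<^esub> inv\<^bsub>H\<^esub> h \<in> S}\<rparr>"

section \<open>The two families\<close>

datatype gen = gen_a | gen_b

text \<open>The relations \<open>a\<^sup>m = 1\<close>, \<open>b\<^sup>n = 1\<close>, \<open>b\<^sup>-\<^sup>1ab = a\<^sup>k\<close>.\<close>

definition metacyclic_rels :: "nat \<Rightarrow> nat \<Rightarrow> nat \<Rightarrow> (gen word \<times> gen word) set" where
  "metacyclic_rels m n k =
     {(replicate m (gen_a, True), []),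
      (replicate n (gen_b, True), []),
      ([(gen_b, False), (gen_a, True), (gen_b, True)], replicate k (gen_a, True))}"

definition rels_G :: "nat \<Rightarrow> (gen word \<times> gen word) set" where
  "rels_G t = metacyclic_rels (3 ^ (t + 1)) (3 ^ t) (1 + 3 ^ t)"

definition rels_H :: "nat \<Rightarrow> (gen word \<times> gen word) set" where
  "rels_H t = metacyclic_rels (3 ^ (t + 1)) (3 ^ (t + 1)) (1 + 3 ^ t)"

definition Gamma_graph :: "nat \<Rightarrow> (gen word set + gen word set) pair_pre_digraph" where
  "Gamma_graph t =
     (let G = presented_group (rels_G t); a = pres_gen (rels_G t) gen_a; b = pres_gen (rels_G t) gen_b
      in BiCay G {} {} {\<one>\<^bsub>G\<^esub>, a, inv\<^bsub>G\<^esub> a \<otimes>\<^bsub>G\<^esub> b})"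

definition Sigma_graph :: "nat \<Rightarrow> (gen word set + gen word set) pair_pre_digraph" where
  "Sigma_graph t =
     (let G = presented_group (rels_H t); a = pres_gen (rels_H t) gen_a; b = pres_gen (rels_H t) gen_b
      in BiCay G {} {} {\<one>\<^bsub>G\<^esub>, b, inv\<^bsub>G\<^esub> b \<otimes>\<^bsub>G\<^esub> a})"

end

theory Submission
  imports Defs "HOL-Algebra.Sylow"
begin

text \<open>
  Let \<open>K \<cong> H\<close> be the semiregular group with two orbits. Edge-transitivity forces \<open>3|K|\<close> to divide
  \<open>|Aut \<Gamma>|\<close>, so the 3-group \<open>K\<close> is properly contained in its normalizer, and after adjusting by \<open>K\<close>
  every vertex is fixed by some \<open>\<sigma>\<close> of order 3 normalizing \<open>K\<close>. As \<open>\<Gamma>\<close> is connected and cubic, \<open>\<sigma>\<close>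
  fixes no edge; it therefore rotates the three neighbours, which makes \<open>\<Gamma>\<close> bipartite between the two
  orbits, and \<open>\<Gamma> = BiCay(K, \<emptyset>, \<emptyset>, {1, x, y})\<close> where conjugation by \<open>\<sigma>\<close> maps
  \<open>x \<mapsto> y x\<^sup>-\<^sup>1 \<mapsto> y\<^sup>-\<^sup>1 \<mapsto> x\<close>.

  In an inner-abelian metacyclic 3-group all commutators are central cubes of order dividing 3, so
  cubing is an endomorphism with central image. The image is a cyclic torsion module over
  \<open>\<int>[\<omega>]\<close>, hence \<open>\<int>[\<omega>]/(1 - \<omega>)\<^sup>k\<close>, and the commutator of \<open>x\<close> and \<open>y\<close> generates its socle. This
  determines the triple \<open>(K, x, y)\<close> up to a sign, which changes when \<open>(x, y)\<close> is replaced by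
  \<open>(x\<^sup>-\<^sup>1, y\<^sup>-\<^sup>1)\<close>, that is, when the two orbits are exchanged. Odd \<open>k = 2t - 1\<close> gives \<open>\<Gamma>\<^sub>t\<close>, even
  \<open>k = 2t\<close> gives \<open>\<Sigma>\<^sub>t\<close>.
\<close>

section \<open>Ideals of the Eisenstein integers\<close>

text \<open>Write \<lambda> = 1 - \<omega>, so that 3 is \<lambda>^2 up to a unit. In the module
  \<int>[\<omega>]/(\<lambda>^k) the cube of \<open>x\<close> is 1 and the cube of
  \<open>x y\<close> is 2 + \<omega>, an associate of \<lambda>. This gives the orders 3^(t+1) for
  \<open>x\<close> and 3^t (odd k) or 3^(t+1) (even k) for \<open>x y\<close>. The socle, spanned by
  \<lambda>^(k-1), is generated by x^(3^t) for k = 2t - 1 and by (x y)^(3^t) for k = 2t. In both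
  presentations the commutator is a power of \<open>a\<close>, so \<open>a\<close> has to be
  \<open>x\<close> in the odd and \<open>x y\<close> in the even case, the other one being
  \<open>b\<close>; this is why the connection set {1, x, y} takes two different shapes. The sign:
  the commutator is one of the two generators of a socle of order 3, and inverting both
  \<open>x\<close> and \<open>y\<close> inverts the powers above but fixes the commutator, which is
  bilinear. The presentation is recognised without comparing orders of groups: \<open>x\<close> and
  \<open>x y\<close> do not commute while cubes are central, so in a relation x^i (x y)^j = 1 both
  exponents are divisible by 3 and the relation can be read off in the module.\<close>

text \<open>Reading the pair \<open>(i, j)\<close> as \<open>i + j\<omega>\<close> with \<open>\<omega>\<^sup>2 + \<omega> + 1 = 0\<close>, the map \<open>rot\<close> is multiplication
  by \<open>\<omega>\<close>, so \<open>L\<close> is an ideal of the Eisenstein integers containing a power of 3, that is, a power of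
  \<open>(1 - \<omega>)\<close>. The two alternatives are the odd and the even powers.\<close>

lemma eisenstein_sublattice:
  fixes L :: "int \<Rightarrow> int \<Rightarrow> bool"
  assumes add: "\<And>i j k l. L i j \<Longrightarrow> L k l \<Longrightarrow> L (i + k) (j + l)"
    and neg: "\<And>i j. L i j \<Longrightarrow> L (- i) (- j)"
    and rot: "\<And>i j. L i j \<Longrightarrow> L (- j) (i - j)"
    and torsion: "L (3 ^ N) 0" and proper: "\<not> L 1 0"
  shows "\<exists>t>0. (\<forall>i j. L i j \<longleftrightarrow> 3 ^ (t - 1) dvd i \<and> 3 ^ t dvd i + j)
             \<or> (\<forall>i j. L i j \<longleftrightarrow> 3 ^ t dvd i \<and> 3 ^ t dvd j)"
proof -
  have zero: "L 0 0" using add[OF torsion neg[OF torsion]] by simp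
  have scale_nat: "L (int n * i) (int n * j)" if "L i j" for n i j
    by (induction n) (use zero add[OF that] in \<open>auto simp: distrib_right\<close>)
  have scale: "L (m * i) (m * j)" if "L i j" for m i j
  proof (cases "m \<ge> 0")
    case True
    then show ?thesis using scale_nat[OF that, of "nat m"] by simp
  next
    case False
    then show ?thesis using scale_nat[OF neg[OF that], of "nat (- m)"] by simp
  qed
  \<comment> \<open>\<open>3 ^ t\<close> is the least power of 3 in the ideal, which will be the
    power 2t - 1 or 2t of \<open>(1 - \<omega>)\<close>; \<open>s\<close> below is the power of 3
    that just misses it.\<close>
  define t where "t = (LEAST n. L (3 ^ n) 0)"
  have Lt: "L (3 ^ t) 0" unfolding t_def by (rule LeastI) (rule torsion)
  have "t \<noteq> 0" using Lt proper by (metis power_0)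
  then have t0: "t > 0" by simp
  define s :: int where "s = 3 ^ (t - 1)"
  have s3: "3 ^ t = 3 * s" unfolding s_def using t0 by (metis power_eq_if \<open>t \<noteq> 0\<close>)
  have Ls: "\<not> L s 0"
    unfolding s_def using not_less_Least[of "t - 1" "\<lambda>n. L (3 ^ n) 0"] t0 by (simp add: t_def)
  have full: "L (3 * s * i) (3 * s * j)" for i j
  proof -
    have "L 0 (3 * s)" using rot[OF Lt] s3 by simp
    from add[OF scale[OF Lt, of i] scale[OF this, of j]] show ?thesis
      by (simp add: s3 algebra_simps)
  qed
  \<comment> \<open>Multiplying by the conjugate turns an element prime to 3 into its norm.\<close>
  have sum3: "3 dvd i + j" if "L (s * i) (s * j)" for i j
  proof (rule ccontr)
    assume ndvd: "\<not> 3 dvd i + j"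
    define n where "n = i * i - i * j + j * j"
    have "(i + j) mod 3 = 1 \<or> (i + j) mod 3 = 2" using ndvd by presburger
    then have "((i + j) * (i + j)) mod 3 = 1" by (auto simp: mod_mult_eq[of "i + j", symmetric])
    moreover have "n = (i + j) * (i + j) - 3 * (i * j)" by (simp add: n_def algebra_simps)
    ultimately have "n mod 3 = 1" by presburger
    then obtain k where k: "n = 3 * k + 1" by (metis mult_div_mod_eq)
    have "L (s * n) 0"
      using add[OF scale[OF that, of "i - j"] scale[OF rot[OF that], of "- j"]]
      by (simp add: n_def algebra_simps)
    from add[OF this full[of "- k" 0]] have "L s 0" by (simp add: k algebra_simps)
    with Ls show False by simp
  qed
  \<comment> \<open>Each step gains a factor 3 by using \<open>sum3\<close> twice: on the element
    scaled up to level \<open>s\<close>, which gives divisibility by 1 - \<omega>, and again after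
    multiplication by 1 - \<omega>, which gives divisibility by its square, an associate of
    3.\<close>
  have div: "3 ^ n dvd i \<and> 3 ^ n dvd j" if "L i j" "n \<le> t - 1" for n i j
    using that(2)
  proof (induction n)
    case (Suc n)
    then obtain i' j' where ij: "i = 3 ^ n * i'" "j = 3 ^ n * j'" by (auto elim!: dvdE)
    define m where "m = t - 2 - n"
    have s: "s = 3 * (3 ^ m * 3 ^ n)"
      unfolding s_def m_def using Suc.prems by (simp flip: power_add power_Suc)
    have L1: "L (3 ^ m * i) (3 ^ m * j)" by (rule scale) fact
    have "L (s * i') (s * j')" using scale[OF L1, of 3] by (simp add: s ij ac_simps)
    then have "3 dvd i' + j'" by (rule sum3)
    then obtain k where k: "j' = 3 * k - i'" by (metis add_diff_cancel_left' dvdE)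
    have "L (s * k) (s * (2 * k - i'))"
      using add[OF L1 neg[OF rot[OF L1]]] by (simp add: s ij k algebra_simps)
    then have "3 dvd k + (2 * k - i')" by (rule sum3)
    then have "3 dvd i'" by presburger
    moreover from this have "3 dvd j'" unfolding k by simp
    ultimately show ?case using ij by auto
  qed simp
  have L_D: "\<exists>i' j'. i = s * i' \<and> j = s * j' \<and> 3 dvd i' + j'" if "L i j" for i j
    using div[OF that, of "t - 1"] sum3 that by (auto simp: s_def elim!: dvdE)
  show ?thesis
  \<comment> \<open>An element of the ideal that is \<open>s\<close> times something prime to 3 in
    its coordinates exists exactly for the odd powers of 1 - \<omega>.\<close>
  proof (cases "\<exists>i j. L (s * i) (s * j) \<and> \<not> 3 dvd i")
    case True
    then obtain i j where ij: "L (s * i) (s * j)" "\<not> 3 dvd i" by blast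
    have "3 dvd i + j" using ij sum3 by simp
    then obtain k where k: "j = 3 * k - i" by (metis add_diff_cancel_left' dvdE)
    have Li: "L (s * i) (s * - i)"
      using add[OF ij(1) full[of 0 "- k"]] by (simp add: k algebra_simps)
    \<comment> \<open>The sign \<open>e\<close> inverts \<open>i\<close> modulo 3, so
      \<open>e\<close> times the element of \<open>Li\<close> is \<open>s\<close> times 1 -
      \<omega>, up to the multiples of \<open>3 * s\<close> supplied by \<open>full\<close>.\<close>
    have "(\<exists>m. 1 * i = 3 * m + 1) \<or> (\<exists>m. - 1 * i = 3 * m + 1)" using ij(2) by presburger
    then obtain e m where e: "e * i = 3 * m + 1" by blast
    have "L (s * (e * i)) (s * - (e * i))" using scale[OF Li, of e] by (simp add: algebra_simps)
    from add[OF this full[of "-m" m]] have Ls1: "L s (- s)" by (simp add: e algebra_simps)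
    have "L (s * i) (s * j)" if "3 dvd i + j" for i j
    proof -
      from that obtain k where k: "j = 3 * k - i" by (metis add_diff_cancel_left' dvdE)
      show ?thesis using add[OF scale[OF Ls1, of i] full[of 0 k]] by (simp add: k algebra_simps)
    qed
    then have "L i j" if "3 ^ (t - 1) dvd i" "3 ^ t dvd i + j" for i j
    proof -
      from that obtain i' k where k: "i = s * i'" "i + j = 3 * s * k"
        unfolding s_def[symmetric] s3 by (auto elim!: dvdE)
      then have j: "j = s * (3 * k - i')" by (simp add: algebra_simps)
      have "3 dvd i' + (3 * k - i')" by simp
      from \<open>\<And>i j. 3 dvd i + j \<Longrightarrow> L (s * i) (s * j)\<close>[OF this] show ?thesis by (simp add: k j)
    qed
    moreover have "3 ^ (t - 1) dvd i \<and> 3 ^ t dvd i + j" if "L i j" for i j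
      using L_D[OF that] unfolding s3 s_def[symmetric] by (auto simp flip: distrib_left)
    ultimately show ?thesis using t0 by blast
  next
    case False
    have "3 ^ t dvd i \<and> 3 ^ t dvd j" if L: "L i j" for i j
    proof -
      obtain i' j' where ij: "i = s * i'" "j = s * j'" "3 dvd i' + j'" using L_D[OF L] by blast
      with False L have "3 dvd i'" by blast
      moreover from this have "3 dvd j'" using ij(3) by presburger
      ultimately show ?thesis by (simp add: ij s3)
    qed
    moreover have "L i j" if "3 ^ t dvd i" "3 ^ t dvd j" for i j
      using that full by (auto simp: s3 elim!: dvdE)
    ultimately show ?thesis using t0 by blast
  qed
qed

section \<open>Groups whose commutators are central cubes\<close>

lemma (in group) inv_cancel:
  assumes "g \<in> carrier G" and "k \<in> carrier G"
  shows "g \<otimes> (inv g \<otimes> k) = k" and "inv g \<otimes> (g \<otimes> k) = k"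
  using assms by (simp_all flip: m_assoc)

lemma (in group) inv_intertwine:
  assumes "a \<otimes> b = b \<otimes> d" and "a \<in> carrier G" "b \<in> carrier G" "d \<in> carrier G"
  shows "inv a \<otimes> b = b \<otimes> inv d"
proof -
  have "inv a \<otimes> (a \<otimes> b) \<otimes> inv d = inv a \<otimes> (b \<otimes> d) \<otimes> inv d"
    by (simp only: assms(1))
  then show ?thesis using assms(2-) by (simp add: m_assoc inv_cancel)
qed

lemma (in group) int_pow_intertwine:
  assumes ab: "a \<otimes> b = b \<otimes> d" and cl: "a \<in> carrier G" "b \<in> carrier G" "d \<in> carrier G"
  shows "a [^] (i::int) \<otimes> b = b \<otimes> d [^] i"
proof -
  have nat: "a [^] n \<otimes> b = b \<otimes> d [^] n" for n :: nat
  proof (induction n)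
    case (Suc n)
    have "a [^] Suc n \<otimes> b = (a [^] n \<otimes> b) \<otimes> d" using cl by (simp add: m_assoc ab)
    then show ?case using cl by (simp add: Suc.IH m_assoc)
  qed (use cl in simp)
  show ?thesis
    using cl inv_intertwine[OF nat]
    by (cases i rule: int_cases2) (simp_all add: int_pow_int int_pow_neg_int nat)
qed

lemmas (in group) int_pow_commutes = int_pow_intertwine[of x y x for x y]

lemma (in group) generate_commutes:
  assumes "A \<subseteq> carrier G" and "g \<in> carrier G" and "\<And>a. a \<in> A \<Longrightarrow> a \<otimes> g = g \<otimes> a"
    and "h \<in> generate G A"
  shows "h \<otimes> g = g \<otimes> h"
  using assms(4)
proof (induction rule: generate.induct)
  case (inv h)
  then have "h \<in> carrier G" using assms(1) by blast
  then show ?case using assms inv by (intro inv_intertwine) auto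
next
  case (eng h k)
  then have "h \<in> carrier G" "k \<in> carrier G" using generate_incl[OF assms(1)] by auto
  then show ?case using eng.IH \<open>g \<in> carrier G\<close> by (metis m_assoc)
qed (use assms in auto)

text \<open>What the structure of \<open>H\<close> contributes beyond being a non-abelian 3-group.
  Phrased with elements instead of the derived subgroup, it transfers along an isomorphism to the
  semiregular group.\<close>

locale cubic_commutators = group +
  assumes commutator: "\<And>g h. g \<in> carrier G \<Longrightarrow> h \<in> carrier G \<Longrightarrow>
    \<exists>u\<in>carrier G. h \<otimes> g = g \<otimes> h \<otimes> u [^] (3::nat) \<and> (u [^] (3::nat)) [^] (3::nat) = \<one> \<and>
      (\<forall>k\<in>carrier G. u [^] (3::nat) \<otimes> k = k \<otimes> u [^] (3::nat))"
begin

lemma pow3: "g \<in> carrier G \<Longrightarrow> g [^] (3::nat) = g \<otimes> (g \<otimes> g)"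
  by (simp add: numeral_3_eq_3 m_assoc)

text \<open>Collecting the factors \<open>g\<close> on the left takes three exchanges with an
  \<open>h\<close>, each leaving one copy of the central commutator \<open>d\<close>, and
  \<open>d\<close> has order dividing 3.\<close>

lemma cube_mult:
  assumes g: "g \<in> carrier G" and h: "h \<in> carrier G"
  shows "(g \<otimes> h) [^] (3::nat) = g [^] (3::nat) \<otimes> h [^] (3::nat)"
proof -
  obtain u where u: "u \<in> carrier G" and hg: "h \<otimes> g = g \<otimes> h \<otimes> u [^] (3::nat)"
    and d3: "(u [^] (3::nat)) [^] (3::nat) = \<one>"
    and cen: "\<And>k. k \<in> carrier G \<Longrightarrow> u [^] (3::nat) \<otimes> k = k \<otimes> u [^] (3::nat)"
    using commutator[OF g h] by blast
  define d where "d = u [^] (3::nat)"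
  have cen: "k \<in> carrier G \<Longrightarrow> d \<otimes> k = k \<otimes> d" for k
    unfolding d_def by (rule cen)
  have d: "d \<in> carrier G" unfolding d_def using u by simp
  have ddd: "d \<otimes> (d \<otimes> d) = \<one>" using d3 pow3[OF d] by (simp add: d_def)
  have hg: "h \<otimes> g = g \<otimes> (h \<otimes> d)" using hg d g h by (simp add: d_def m_assoc)
  have hgk: "h \<otimes> (g \<otimes> k) = g \<otimes> (h \<otimes> (d \<otimes> k))" if "k \<in> carrier G" for k
    using arg_cong[OF hg, of "\<lambda>r. r \<otimes> k"] that d g h by (simp add: m_assoc)
  have dk: "d \<otimes> (g \<otimes> k) = g \<otimes> (d \<otimes> k)" "d \<otimes> (h \<otimes> k) = h \<otimes> (d \<otimes> k)"
    if "k \<in> carrier G" for k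
    using arg_cong[OF cen[OF g], of "\<lambda>r. r \<otimes> k"] arg_cong[OF cen[OF h], of "\<lambda>r. r \<otimes> k"] that d g h
    by (simp_all add: m_assoc)
  have "(g \<otimes> h) [^] (3::nat) = g \<otimes> (h \<otimes> (g \<otimes> (h \<otimes> (g \<otimes> h))))"
    using g h by (simp add: pow3 m_assoc)
  also have "\<dots> = g \<otimes> (g \<otimes> (g \<otimes> (h \<otimes> (h \<otimes> (h \<otimes> (d \<otimes> (d \<otimes> d)))))))"
    using g h d by (simp add: hgk hg dk cen[OF g] cen[OF h])
  finally show ?thesis using g h by (simp add: pow3 m_assoc ddd)
qed

text \<open>Conjugation by \<open>h\<close> changes \<open>g\<close> by a factor of order dividing
  3, which disappears under the endomorphism of cubing.\<close>

lemma cube_central: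
  assumes g: "g \<in> carrier G" and h: "h \<in> carrier G"
  shows "g [^] (3::nat) \<otimes> h = h \<otimes> g [^] (3::nat)"
proof -
  obtain u where u: "u \<in> carrier G" and hg: "h \<otimes> g = g \<otimes> h \<otimes> u [^] (3::nat)"
    and d3: "(u [^] (3::nat)) [^] (3::nat) = \<one>"
    and cen: "\<And>k. k \<in> carrier G \<Longrightarrow> u [^] (3::nat) \<otimes> k = k \<otimes> u [^] (3::nat)"
    using commutator[OF g h] by blast
  have "h \<otimes> g \<otimes> inv h = g \<otimes> u [^] (3::nat)"
    using u g h cen[of "inv h"] by (simp add: hg m_assoc inv_cancel)
  then have "(h \<otimes> g \<otimes> inv h) [^] (3::nat) = g [^] (3::nat)"
    using u g d3 by (simp add: cube_mult)
  moreover have "(h \<otimes> g \<otimes> inv h) [^] (3::nat) = h \<otimes> g [^] (3::nat) \<otimes> inv h"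
    using g h by (simp add: pow3 m_assoc inv_cancel)
  ultimately show ?thesis using g h
    by (simp add: inv_solve_right'[of "g [^] (3::nat)"])
qed

lemma cube_inv: "g \<in> carrier G \<Longrightarrow> (inv g) [^] (3::nat) = inv (g [^] (3::nat))"
  by (rule nat_pow_inv)

lemma int_pow_cube_central:
  assumes g: "g \<in> carrier G" and h: "h \<in> carrier G"
  shows "(g [^] (3::nat)) [^] (i::int) \<otimes> h = h \<otimes> (g [^] (3::nat)) [^] i"
  using g h cube_central by (intro int_pow_commutes) auto

lemma int_pow_3_mult: "g \<in> carrier G \<Longrightarrow> g [^] (3 * i) = (g [^] (3::nat)) [^] (i::int)"
  by (simp add: int_pow_pow flip: int_pow_int)

text \<open>Up to a sign \<open>i\<close> is 1 modulo 3, so a power of \<open>g [^] i\<close>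
  differs from \<open>g\<close> by a power of the central element \<open>g^3\<close>.\<close>

lemma power_commutes_imp:
  fixes i :: int
  assumes g: "g \<in> carrier G" and h: "h \<in> carrier G"
    and comm: "g [^] i \<otimes> h = h \<otimes> g [^] i" and i: "\<not> 3 dvd i"
  shows "g \<otimes> h = h \<otimes> g"
proof -
  have "(\<exists>m. 1 * i = 3 * m + 1) \<or> (\<exists>m. - 1 * i = 3 * m + 1)" using i by presburger
  then obtain e m where e: "e * i = 3 * m + 1" by blast
  have "(g [^] i) [^] e \<otimes> h = h \<otimes> (g [^] i) [^] e"
    by (rule int_pow_commutes) (use comm g h in auto)
  then have "g [^] (3 * m + 1) \<otimes> h = h \<otimes> g [^] (3 * m + 1)"
    unfolding int_pow_pow[OF g] mult.commute[of i e] e .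
  moreover have "g [^] (3 * m + 1) = (g [^] (3::nat)) [^] m \<otimes> g"
    using g by (simp add: int_pow_mult int_pow_3_mult)
  moreover have "h \<otimes> ((g [^] (3::nat)) [^] m \<otimes> g) = (g [^] (3::nat)) [^] m \<otimes> (h \<otimes> g)"
    using g h int_pow_cube_central[OF g h, of m] by (simp flip: m_assoc)
  ultimately show ?thesis using g h by (simp add: m_assoc)
qed

text \<open>The relation turns \<open>u [^] i\<close> into a power of \<open>v\<close>, which
  commutes with \<open>v\<close>. By \<open>power_commutes_imp\<close> an exponent prime to 3 would
  make \<open>u\<close> and \<open>v\<close> commute.\<close>

lemma independent_mod_3:
  fixes i j :: int
  assumes u: "u \<in> carrier G" and v: "v \<in> carrier G" and uv: "u \<otimes> v \<noteq> v \<otimes> u"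
    and rel: "u [^] i \<otimes> v [^] j = \<one>"
  shows "3 dvd i \<and> 3 dvd j"
proof -
  have ui: "u [^] i = v [^] (- j)"
    using rel u v inv_equality[OF rel] by (simp add: int_pow_neg)
  have vj: "v [^] j = u [^] (- i)"
    using u v by (simp add: int_pow_neg ui)
  have "u [^] i \<otimes> v = v \<otimes> u [^] i" unfolding ui by (rule int_pow_commutes) (use v in auto)
  moreover have "v [^] j \<otimes> u = u \<otimes> v [^] j" unfolding vj by (rule int_pow_commutes) (use u in auto)
  ultimately show ?thesis using power_commutes_imp[OF u v] power_commutes_imp[OF v u] uv by metis
qed

end

text \<open>Since \<open>\<alpha>\<close> permutes \<open>x\<close>, \<open>y x\<^sup>-\<^sup>1\<close>, \<open>y\<^sup>-\<^sup>1\<close> cyclically, the cubes form a cyclic module over the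
  Eisenstein integers.\<close>

locale eisenstein_pair = cubic_commutators +
  fixes x y \<alpha>
  assumes x[simp]: "x \<in> carrier G" and y[simp]: "y \<in> carrier G"
    and generated: "generate G {x, y} = carrier G"
    and hom: "\<alpha> \<in> hom G G"
    and \<alpha>_x: "\<alpha> x = y \<otimes> inv x" and \<alpha>_y: "\<alpha> y = inv x"
    and torsion: "\<exists>N. x [^] (3 ^ N :: nat) = \<one>"
    and noncomm: "\<not> comm_group G"
begin

sublocale \<alpha>: group_hom G G \<alpha>
  by unfold_locales (rule hom)

definition c where "c = inv x \<otimes> inv y \<otimes> x \<otimes> y"

text \<open>The image of i + j\<omega> under the module map sending 1 to the cube of
  \<open>x\<close>; the second base is the cube of \<open>\<alpha> x\<close>.\<close>

definition w :: "int \<Rightarrow> int \<Rightarrow> 'a" where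
  "w i j = (x [^] (3::nat)) [^] i \<otimes> ((y \<otimes> inv x) [^] (3::nat)) [^] j"

lemma c_closed [simp]: "c \<in> carrier G" and w_closed [simp]: "w i j \<in> carrier G"
  by (simp_all add: c_def w_def)

lemma xy: "x \<otimes> y = y \<otimes> x \<otimes> c"
  by (simp add: c_def m_assoc inv_cancel)

lemma xy_noncomm: "x \<otimes> y \<noteq> y \<otimes> x"
proof
  assume eq: "x \<otimes> y = y \<otimes> x"
  have "h \<otimes> g = g \<otimes> h" if "g \<in> {x, y}" "h \<in> carrier G" for g h
    by (rule generate_commutes[of "{x, y}"]) (use that eq in \<open>auto simp: generated\<close>)
  note gens = this
  have "h \<otimes> g = g \<otimes> h" if "g \<in> carrier G" "h \<in> carrier G" for g h
    by (rule generate_commutes[of "{x, y}"]) (use that gens[symmetric] in \<open>auto simp: generated\<close>)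
  then have "comm_group G" by (intro group_comm_groupI) auto
  with noncomm show False ..
qed

lemma c_nontrivial: "c \<noteq> \<one>"
  using xy_noncomm xy by auto

lemma c_central: "g \<in> carrier G \<Longrightarrow> c \<otimes> g = g \<otimes> c"
  and c_cube: "c [^] (3::nat) = \<one>"
  and c_is_cube: "\<exists>u\<in>carrier G. c = u [^] (3::nat)"
proof -
  obtain u where u: "u \<in> carrier G" "x \<otimes> y = y \<otimes> x \<otimes> u [^] (3::nat)"
      "(u [^] (3::nat)) [^] (3::nat) = \<one>"
      "\<And>k. k \<in> carrier G \<Longrightarrow> u [^] (3::nat) \<otimes> k = k \<otimes> u [^] (3::nat)"
    using commutator[OF y x] by blast
  then have "y \<otimes> x \<otimes> c = y \<otimes> x \<otimes> u [^] (3::nat)" by (simp flip: xy)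
  then have "c = u [^] (3::nat)" using u(1) by simp
  with u show "g \<in> carrier G \<Longrightarrow> c \<otimes> g = g \<otimes> c" "c [^] (3::nat) = \<one>"
    "\<exists>u\<in>carrier G. c = u [^] (3::nat)" by auto
qed

text \<open>On the abelianisation \<alpha> sends x to y - x and y to -x, a map of determinant 1; as
  commutators are central, the commutator of the two generators is raised to that
  determinant.\<close>

lemma c_fixed: "\<alpha> c = c"
proof -
  have "\<alpha> c = x \<otimes> (inv y \<otimes> x \<otimes> y \<otimes> inv x) \<otimes> inv x"
    by (simp add: c_def \<alpha>_x \<alpha>_y inv_mult_group m_assoc)
  also have "inv y \<otimes> x \<otimes> y \<otimes> inv x = x \<otimes> c \<otimes> inv x"
    by (simp add: c_def m_assoc inv_cancel)
  also have "\<dots> = c" using c_central[of x, symmetric] by (simp add: m_assoc)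
  finally show ?thesis using c_central[of x, symmetric] by (simp add: m_assoc)
qed

lemma w_add: "w i j \<otimes> w k l = w (i + k) (j + l)"
proof -
  let ?X = "x [^] (3::nat)" and ?Z = "(y \<otimes> inv x) [^] (3::nat)"
  have "?Z [^] j \<otimes> (?X [^] k \<otimes> ?Z [^] l) = ?X [^] k \<otimes> (?Z [^] j \<otimes> ?Z [^] l)"
    using int_pow_cube_central[of x "?Z [^] j" k] by (simp flip: m_assoc)
  then show ?thesis by (simp add: w_def m_assoc int_pow_mult)
qed

lemma w_0 [simp]: "w 0 0 = \<one>"
  by (simp add: w_def)

lemma w_neg: "w (- i) (- j) = inv (w i j)"
  using w_add[of "- i" "- j" i j] by (intro inv_equality[symmetric]) auto

lemma w_pow: "w i j [^] (n::nat) = w (int n * i) (int n * j)"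
  by (induction n) (simp_all add: w_add algebra_simps)

lemma w_int_pow: "w i j [^] (n::int) = w (n * i) (n * j)"
  by (cases n rule: int_cases2) (simp_all add: int_pow_int int_pow_neg_int w_pow flip: w_neg)

lemma cube_x: "x [^] (3::nat) = w 1 0" and cube_y: "y [^] (3::nat) = w 1 1"
proof -
  have "y [^] (3::nat) = ((y \<otimes> inv x) \<otimes> x) [^] (3::nat)" by (simp add: m_assoc)
  also have "\<dots> = w 0 1 \<otimes> w 1 0" by (subst cube_mult) (simp_all add: w_def)
  finally show "y [^] (3::nat) = w 1 1" by (simp add: w_add)
qed (simp add: w_def)

lemma cube_in_w: "g \<in> carrier G \<Longrightarrow> \<exists>i j. g [^] (3::nat) = w i j"
  unfolding generated[symmetric]
proof (induction rule: generate.induct)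
  case (incl h)
  then show ?case using cube_x cube_y by auto
next
  case (inv h)
  then have "inv h [^] (3::nat) = w (- 1) 0 \<or> inv h [^] (3::nat) = w (- 1) (- 1)"
    using w_neg[of 1 0] w_neg[of 1 1] by (auto simp: cube_inv cube_x cube_y)
  then show ?case by blast
next
  case (eng g h)
  then have "g \<in> carrier G" "h \<in> carrier G" by (simp_all add: generated)
  with eng.IH show ?case by (metis cube_mult w_add)
next
  case one
  have "\<one> [^] (3::nat) = w 0 0" by simp
  then show ?case by blast
qed

text \<open>The elements \<open>x\<close>, \<open>\<alpha> x\<close> and
  \<open>\<alpha> (\<alpha> x)\<close> have cubes 1, \<omega> and -1 - \<omega> = \<omega>^2, so
  \<alpha> acts on cubes as multiplication by \<omega>.\<close>

lemma \<alpha>_w: "\<alpha> (w i j) = w (- j) (i - j)"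
proof -
  have X: "\<alpha> (x [^] (3::nat)) = w 0 1"
    by (simp add: \<alpha>.hom_nat_pow \<alpha>_x w_def)
  have "\<alpha> (y \<otimes> inv x) = inv x \<otimes> (x \<otimes> inv y)"
    by (simp add: \<alpha>_x \<alpha>_y inv_mult_group)
  also have "\<dots> = inv y" by (simp add: inv_cancel)
  finally have Z: "\<alpha> ((y \<otimes> inv x) [^] (3::nat)) = w (- 1) (- 1)"
    by (simp add: \<alpha>.hom_nat_pow cube_inv cube_y w_neg)
  have "\<alpha> (w i j) = w 0 1 [^] i \<otimes> w (- 1) (- 1) [^] j"
    unfolding w_def[of i j] by (simp add: \<alpha>.hom_int_pow X Z)
  then show ?thesis by (simp add: w_int_pow w_add)
qed

text \<open>The annihilator of the module generator is an ideal containing a power of 3. It is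
  proper: otherwise every cube would be trivial, and with them \<open>c\<close>, which is a
  cube.\<close>

lemma relation_lattice:
  obtains t where "t > 0"
    and "(\<forall>i j. w i j = \<one> \<longleftrightarrow> 3 ^ (t - 1) dvd i \<and> 3 ^ t dvd i + j)
       \<or> (\<forall>i j. w i j = \<one> \<longleftrightarrow> 3 ^ t dvd i \<and> 3 ^ t dvd j)"
proof -
  define L where "L i j \<longleftrightarrow> w i j = \<one>" for i j
  obtain N where N: "x [^] (3 ^ N :: nat) = \<one>" using torsion by blast
  have "w 1 0 [^] (3 ^ N :: nat) = (x [^] (3 ^ N :: nat)) [^] (3 :: nat)"
    by (simp flip: cube_x add: nat_pow_pow mult.commute[of 3])
  then have L_torsion: "L (3 ^ N) 0" by (simp add: N L_def w_pow)
  have L_proper: "\<not> L 1 0"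
  proof
    assume L: "L 1 0"
    have w01: "w 0 1 = \<one>" using \<alpha>_w[of 1 0] L by (simp add: L_def)
    have "w i j = \<one>" for i j
    proof -
      have "w i j = w 1 0 [^] i \<otimes> w 0 1 [^] j" by (simp add: w_int_pow w_add)
      also have "\<dots> = \<one>" using L by (simp only: L_def w01 int_pow_one l_one one_closed)
      finally show ?thesis .
    qed
    then have "c = \<one>" using cube_in_w c_is_cube by fastforce
    then show False using c_nontrivial by simp
  qed
  have L_add: "L (i + k) (j + l)" if "L i j" "L k l" for i j k l
    using that w_add[of i j k l] by (simp add: L_def)
  have L_neg: "L (- i) (- j)" if "L i j" for i j
    using that by (simp add: L_def w_neg)
  have L_rot: "L (- j) (i - j)" if "L i j" for i j
    using that \<alpha>_w[of i j] by (simp add: L_def)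
  have "\<exists>t>0. (\<forall>i j. L i j \<longleftrightarrow> 3 ^ (t - 1) dvd i \<and> 3 ^ t dvd i + j)
      \<or> (\<forall>i j. L i j \<longleftrightarrow> 3 ^ t dvd i \<and> 3 ^ t dvd j)"
    by (rule eisenstein_sublattice[of L N]) (fact L_add L_neg L_rot L_torsion L_proper)+
  then show thesis using that unfolding L_def by blast
qed

lemma w_eq_iff: "w i j = w k l \<longleftrightarrow> w (i - k) (j - l) = \<one>"
proof -
  have "w i j = w (i - k) (j - l) \<otimes> w k l" by (simp add: w_add)
  then show ?thesis by simp
qed

lemma x_pow: "x [^] (3 ^ Suc n :: nat) = w (3 ^ n) 0"
proof -
  have "x [^] (3 ^ Suc n :: nat) = w 1 0 [^] (3 ^ n :: nat)"
    by (simp flip: cube_x add: nat_pow_pow)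
  then show ?thesis by (simp add: w_pow)
qed

lemma cube_xy: "(x \<otimes> y) [^] (3::nat) = w 2 1"
  by (simp add: cube_mult cube_x cube_y w_add)

lemma xy_pow: "(x \<otimes> y) [^] (3 ^ Suc n :: nat) = w (2 * 3 ^ n) (3 ^ n)"
proof -
  have "(x \<otimes> y) [^] (3 ^ Suc n :: nat) = w 2 1 [^] (3 ^ n :: nat)"
    by (simp flip: cube_xy add: nat_pow_pow)
  then show ?thesis by (simp add: w_pow mult.commute)
qed

lemma x_xy_noncomm: "x \<otimes> (x \<otimes> y) \<noteq> (x \<otimes> y) \<otimes> x"
  using xy_noncomm by (simp add: m_assoc)

text \<open>Non-commutation of \<open>x\<close> and \<open>x \<otimes> y\<close> reduces the
  relation to one between cubes; \<open>w (k + 2 * l) l\<close> is k + l(2 + \<omega>), the cube of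
  \<open>x \<otimes> y\<close> being 2 + \<omega>.\<close>

lemma x_xy_relation:
  fixes i j :: int
  assumes "x [^] i \<otimes> (x \<otimes> y) [^] j = \<one>"
  obtains k l where "i = 3 * k" "j = 3 * l" "w (k + 2 * l) l = \<one>"
proof -
  from independent_mod_3[OF _ _ x_xy_noncomm assms] obtain k l where kl: "i = 3 * k" "j = 3 * l"
    by (auto elim!: dvdE)
  have "w (k + 2 * l) l = \<one>"
    using assms by (simp add: kl int_pow_3_mult cube_x cube_xy w_int_pow w_add mult.commute[of l 2])
  with kl show thesis by (rule that)
qed

text \<open>The conditions say that \<open>c\<close> is nonzero and killed by 3 and by 1 - \<omega>,
  hence a nonzero element of the socle. The last one is invariance under \<alpha>, expanded.\<close>

lemma c_pow_exponents:
  obtains p q where "c = w p q" "w p q \<noteq> \<one>" "w (3 * p) (3 * q) = \<one>" "w (p + q) (2 * q - p) = \<one>"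
proof -
  obtain p q where c: "c = w p q" using c_is_cube cube_in_w by fastforce
  have "w (- q) (p - q) = w p q" using c_fixed by (simp add: c \<alpha>_w)
  then have "w (p - - q) (q - (p - q)) = \<one>" using w_eq_iff[of p q "- q" "p - q"] by simp
  then have "w (p + q) (2 * q - p) = \<one>" by (simp add: algebra_simps)
  moreover have "w (3 * p) (3 * q) = \<one>" using c_cube by (simp add: c w_pow)
  moreover have "w p q \<noteq> \<one>" using c_nontrivial by (simp add: c)
  ultimately show thesis using c that by blast
qed

text \<open>The lattice determines the orders and the socle; since the socle has order 3,
  \<open>c\<close> is its standard generator or the inverse of it. The condition on the exponents
  says that the cyclic groups of \<open>x\<close> and \<open>x \<otimes> y\<close> meet trivially
  and have the full orders.\<close>

lemma relations:
  "\<exists>t>0.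
        x [^] (3 ^ (t + 1) :: nat) = \<one> \<and> (x \<otimes> y) [^] (3 ^ t :: nat) = \<one> \<and>
        (x [^] (3 ^ t :: nat) = c \<or> x [^] (3 ^ t :: nat) = inv c) \<and>
        (\<forall>(i::int) (j::int). x [^] i \<otimes> (x \<otimes> y) [^] j = \<one> \<longrightarrow> 3 ^ (t + 1) dvd i \<and> 3 ^ t dvd j)
      \<or> x [^] (3 ^ (t + 1) :: nat) = \<one> \<and> (x \<otimes> y) [^] (3 ^ (t + 1) :: nat) = \<one> \<and>
        ((x \<otimes> y) [^] (3 ^ t :: nat) = c \<or> (x \<otimes> y) [^] (3 ^ t :: nat) = inv c) \<and>
        (\<forall>(i::int) (j::int). x [^] i \<otimes> (x \<otimes> y) [^] j = \<one> \<longrightarrow> 3 ^ (t + 1) dvd i \<and> 3 ^ (t + 1) dvd j)"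
  (is "\<exists>t>0. ?A t \<or> ?B t")
proof -
  obtain t where "t > 0"
    and alt: "(\<forall>i j. w i j = \<one> \<longleftrightarrow> 3 ^ (t - 1) dvd i \<and> 3 ^ t dvd i + j)
       \<or> (\<forall>i j. w i j = \<one> \<longleftrightarrow> 3 ^ t dvd i \<and> 3 ^ t dvd j)"
    by (rule relation_lattice)
  then obtain r where r: "t = Suc r" by (cases t) auto
  define s :: int where "s = 3 ^ r"
  have "s \<noteq> 0" by (simp add: s_def)
  have cancel: "s * 3 dvd s * k \<longleftrightarrow> 3 dvd k" for k using \<open>s \<noteq> 0\<close> by simp
  obtain p q where c: "c = w p q" and pq: "w p q \<noteq> \<one>" "w (3 * p) (3 * q) = \<one>"
      "w (p + q) (2 * q - p) = \<one>"
    by (rule c_pow_exponents)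
  from alt show ?thesis
  proof
    assume "\<forall>i j. w i j = \<one> \<longleftrightarrow> 3 ^ (t - 1) dvd i \<and> 3 ^ t dvd i + j"
    then have L: "w i j = \<one> \<longleftrightarrow> s dvd i \<and> s * 3 dvd i + j" for i j
      by (simp add: r s_def mult.commute)
    have "s * 3 dvd (p + q) + (2 * q - p)" using pq(3) unfolding L by simp
    then have "3 * s dvd 3 * q" by (simp add: algebra_simps)
    then have "s dvd q" by simp
    moreover have "s dvd p + q" using pq(3) unfolding L by simp
    ultimately have "s dvd p" by (simp only: dvd_add_left_iff)
    with \<open>s dvd q\<close> obtain p' q' where p': "p = s * p'" and q': "q = s * q'" by (auto elim!: dvdE)
    have "\<not> s * 3 dvd s * (p' + q')" using pq(1) by (simp add: L p' q' distrib_left)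
    \<comment> \<open>Nontriviality of \<open>c\<close> means that \<open>p' + q'\<close> is prime
      to 3, so up to sign \<open>c\<close> is the class of \<open>s\<close>, which is
      x^(3^t).\<close>
    then have "3 dvd 1 - p' - q' \<or> 3 dvd 1 + p' + q'" unfolding cancel by presburger
    then have "s * 3 dvd s * (1 - p' - q') \<or> s * 3 dvd s * (1 + p' + q')" unfolding cancel .
    then have "w (s - p) (- q) = \<one> \<or> w (s + p) q = \<one>"
      unfolding L p' q' by (simp add: algebra_simps)
    then have "w s 0 = w p q \<or> w s 0 = w (- p) (- q)"
      by (simp add: w_eq_iff[of s])
    then have "x [^] (3 ^ t :: nat) = c \<or> x [^] (3 ^ t :: nat) = inv c"
      unfolding r x_pow s_def[symmetric] c w_neg .
    moreover have "x [^] (3 ^ (t + 1) :: nat) = \<one>"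
      unfolding add.commute[of t 1] plus_1_eq_Suc x_pow L by (simp add: r s_def)
    moreover have "(x \<otimes> y) [^] (3 ^ t :: nat) = \<one>"
      unfolding r xy_pow L by (simp add: s_def)
    moreover have "3 ^ (t + 1) dvd i \<and> 3 ^ t dvd j" if "x [^] i \<otimes> (x \<otimes> y) [^] j = \<one>" for i j :: int
    proof -
      from that obtain k l where kl: "i = 3 * k" "j = 3 * l" and w: "w (k + 2 * l) l = \<one>"
        by (rule x_xy_relation)
      have s1: "s dvd k + 2 * l" and s2: "s * 3 dvd k + 3 * l"
        using w unfolding L by (simp_all add: algebra_simps)
      then have "s dvd (k + 3 * l) - (k + 2 * l)" by (meson dvd_diff dvd_mult_left)
      then have "s dvd l" by simp
      then have "s * 3 dvd 3 * l" by (simp add: mult.commute)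
      with s2 have "s * 3 dvd k" by (simp only: dvd_add_left_iff)
      then have "3 * (s * 3) dvd 3 * k" "3 * s dvd 3 * l"
        using \<open>s dvd l\<close> by (auto intro: mult_dvd_mono)
      then show ?thesis by (simp add: kl r s_def)
    qed
    ultimately have "?A t" by (intro conjI allI impI) auto
    with \<open>t > 0\<close> show ?thesis by blast
  next
    assume "\<forall>i j. w i j = \<one> \<longleftrightarrow> 3 ^ t dvd i \<and> 3 ^ t dvd j"
    then have L: "w i j = \<one> \<longleftrightarrow> s * 3 dvd i \<and> s * 3 dvd j" for i j
      by (simp add: r s_def mult.commute)
    have "s dvd p" "s dvd q" using pq(2) unfolding L by (simp_all add: mult.commute)
    then obtain p' q' where p': "p = s * p'" and q': "q = s * q'" by (auto elim!: dvdE)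
    have "\<not> (s * 3 dvd s * p' \<and> s * 3 dvd s * q')" "s * 3 dvd s * (p' + q')"
      using pq(1,3) by (auto simp: L p' q' distrib_left)
    \<comment> \<open>The socle is now spanned by s(2 + \<omega>), the class of (x y)^(3^t): modulo
      3 the pair \<open>(p', q')\<close> can only be (2, 1) or its negative.\<close>
    then have "3 dvd 2 - p' \<and> 3 dvd 1 - q' \<or> 3 dvd 2 + p' \<and> 3 dvd 1 + q'"
      unfolding cancel by presburger
    then have "s * 3 dvd s * (2 - p') \<and> s * 3 dvd s * (1 - q')
        \<or> s * 3 dvd s * (2 + p') \<and> s * 3 dvd s * (1 + q')" unfolding cancel .
    then have "w (2 * s) s = w p q \<or> w (2 * s) s = w (- p) (- q)"
      unfolding w_eq_iff[of "2 * s"] L p' q' by (simp add: algebra_simps)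
    then have "(x \<otimes> y) [^] (3 ^ t :: nat) = c \<or> (x \<otimes> y) [^] (3 ^ t :: nat) = inv c"
      unfolding r xy_pow s_def[symmetric] c w_neg .
    moreover have "x [^] (3 ^ (t + 1) :: nat) = \<one>" "(x \<otimes> y) [^] (3 ^ (t + 1) :: nat) = \<one>"
      unfolding add.commute[of t 1] plus_1_eq_Suc x_pow xy_pow L by (simp_all add: r s_def)
    moreover have "3 ^ (t + 1) dvd i \<and> 3 ^ (t + 1) dvd j"
      if "x [^] i \<otimes> (x \<otimes> y) [^] j = \<one>" for i j :: int
    proof -
      from that obtain k l where kl: "i = 3 * k" "j = 3 * l" and w: "w (k + 2 * l) l = \<one>"
        by (rule x_xy_relation)
      have kl': "s * 3 dvd k + 2 * l" "s * 3 dvd l" using w unfolding L by simp_all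
      then have "s * 3 dvd 2 * l" by simp
      with kl'(1) have "s * 3 dvd k" by (simp only: dvd_add_left_iff)
      with kl'(2) have "3 * (s * 3) dvd 3 * k" "3 * (s * 3) dvd 3 * l"
        by (auto intro: mult_dvd_mono)
      then show ?thesis by (simp add: kl r s_def)
    qed
    ultimately have "?B t" by (intro conjI allI impI) auto
    with \<open>t > 0\<close> show ?thesis by blast
  qed
qed

end

section \<open>Metacyclic presentations\<close>

lemma pres_gen_carrier [simp]: "pres_gen R g \<in> carrier (presented_group R)"
  by (simp add: pres_gen_def presented_group_def)

lemma word_eval_pres_gen: "word_eval (presented_group R) (pres_gen R) w = pres_class R w"
proof (induction w)
  case Nil
  show ?case by (simp add: presented_group_def)
next
  case (Cons p w)
  interpret group "presented_group R" by (rule group_presented_group)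
  obtain g s where p: "p = (g, s)" by force
  have "pres_class R [(g, s)] = (if s then pres_gen R g else inv\<^bsub>presented_group R\<^esub> pres_gen R g)"
  proof (cases s)
    case False
    have "pres_class R [(g, False)] \<otimes>\<^bsub>presented_group R\<^esub> pres_gen R g = pres_class R []"
      using pres_eq.cancel[of R "[]" g False "[]"]
      by (simp add: pres_gen_def presented_group_mult pres_class_eq_iff)
    then have "inv\<^bsub>presented_group R\<^esub> pres_gen R g = pres_class R [(g, False)]"
      by (intro inv_equality) (simp_all add: presented_group_def pres_gen_def)
    with False show ?thesis by simp
  qed (simp add: pres_gen_def)
  with presented_group_mult[of R "[(g, s)]" w] show ?case by (simp add: p Cons.IH)
qed

lemma word_eval_relation:
  "(u, v) \<in> R \<Longrightarrow> word_eval (presented_group R) (pres_gen R) u = word_eval (presented_group R) (pres_gen R) v"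
  using pres_eq.relation[of u v R "[]" "[]"] by (simp add: word_eval_pres_gen pres_class_eq_iff)

lemma (in group) word_eval_replicate:
  "f g \<in> carrier G \<Longrightarrow> word_eval G f (replicate n (g, True)) = f g [^] n"
proof (induction n)
  case (Suc n)
  then show ?case using nat_pow_Suc2[of "f g" n] by simp
qed simp

lemma metacyclic_relsI:
  "(replicate m (gen_a, True), []) \<in> metacyclic_rels m n k"
  "(replicate n (gen_b, True), []) \<in> metacyclic_rels m n k"
  "([(gen_b, False), (gen_a, True), (gen_b, True)], replicate k (gen_a, True)) \<in> metacyclic_rels m n k"
  by (simp_all add: metacyclic_rels_def)

text \<open>Letters are absorbed from the left. The relation carries powers of \<open>a\<close> past
  positive powers of \<open>b\<close> only, so the inverse of \<open>b\<close> is rewritten as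
  \<open>b\<close> to the power \<open>n - 1\<close>; hence natural exponents for \<open>b\<close>
  and integer ones for \<open>a\<close>.\<close>

lemma metacyclic_normal_form:
  assumes "n > 0" and "g \<in> carrier (presented_group (metacyclic_rels m n k))"
  defines "P \<equiv> presented_group (metacyclic_rels m n k)"
    and "a \<equiv> pres_gen (metacyclic_rels m n k) gen_a" and "b \<equiv> pres_gen (metacyclic_rels m n k) gen_b"
  shows "a [^]\<^bsub>P\<^esub> m = \<one>\<^bsub>P\<^esub>" and "b [^]\<^bsub>P\<^esub> n = \<one>\<^bsub>P\<^esub>"
    and "\<exists>(i::int) (j::nat). g = b [^]\<^bsub>P\<^esub> j \<otimes>\<^bsub>P\<^esub> a [^]\<^bsub>P\<^esub> i"
proof -
  let ?R = "metacyclic_rels m n k"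
  interpret group P unfolding P_def by (rule group_presented_group)
  have cl [simp]: "a \<in> carrier P" "b \<in> carrier P" "pres_gen ?R x \<in> carrier P" for x
    by (simp_all add: a_def b_def P_def)
  note rel = word_eval_relation[of _ _ ?R, folded P_def]
  show am: "a [^]\<^bsub>P\<^esub> m = \<one>\<^bsub>P\<^esub>"
    using rel[OF metacyclic_relsI(1)] by (simp add: word_eval_replicate a_def)
  show bn: "b [^]\<^bsub>P\<^esub> n = \<one>\<^bsub>P\<^esub>"
    using rel[OF metacyclic_relsI(2)] by (simp add: word_eval_replicate b_def)
  have "inv\<^bsub>P\<^esub> b \<otimes>\<^bsub>P\<^esub> a \<otimes>\<^bsub>P\<^esub> b = a [^]\<^bsub>P\<^esub> k"
    using rel[OF metacyclic_relsI(3)] by (simp add: word_eval_replicate a_def b_def m_assoc)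
  then have "b \<otimes>\<^bsub>P\<^esub> (inv\<^bsub>P\<^esub> b \<otimes>\<^bsub>P\<^esub> a \<otimes>\<^bsub>P\<^esub> b) = b \<otimes>\<^bsub>P\<^esub> a [^]\<^bsub>P\<^esub> k" by simp
  then have ab: "a \<otimes>\<^bsub>P\<^esub> b = b \<otimes>\<^bsub>P\<^esub> a [^]\<^bsub>P\<^esub> int k"
    by (simp add: m_assoc inv_cancel int_pow_int)
  have aib: "a [^]\<^bsub>P\<^esub> i \<otimes>\<^bsub>P\<^esub> b = b \<otimes>\<^bsub>P\<^esub> a [^]\<^bsub>P\<^esub> (int k * i)" for i :: int
    using int_pow_intertwine[OF ab] by (simp add: int_pow_pow)
  have aibj: "a [^]\<^bsub>P\<^esub> i \<otimes>\<^bsub>P\<^esub> b [^]\<^bsub>P\<^esub> j = b [^]\<^bsub>P\<^esub> j \<otimes>\<^bsub>P\<^esub> a [^]\<^bsub>P\<^esub> (int k ^ j * i)"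
    for i :: int and j :: nat
  proof (induction j arbitrary: i)
    case (Suc j)
    have "a [^]\<^bsub>P\<^esub> i \<otimes>\<^bsub>P\<^esub> b [^]\<^bsub>P\<^esub> Suc j = (a [^]\<^bsub>P\<^esub> i \<otimes>\<^bsub>P\<^esub> b [^]\<^bsub>P\<^esub> j) \<otimes>\<^bsub>P\<^esub> b"
      by (simp add: m_assoc)
    also have "\<dots> = b [^]\<^bsub>P\<^esub> j \<otimes>\<^bsub>P\<^esub> (a [^]\<^bsub>P\<^esub> (int k ^ j * i) \<otimes>\<^bsub>P\<^esub> b)"
      by (simp add: Suc.IH m_assoc)
    also have "\<dots> = b [^]\<^bsub>P\<^esub> Suc j \<otimes>\<^bsub>P\<^esub> a [^]\<^bsub>P\<^esub> (int k ^ Suc j * i)"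
      by (simp add: aib m_assoc mult.assoc)
    finally show ?case .
  qed simp
  have "\<exists>(i::int) (j::nat). word_eval P (pres_gen ?R) w = b [^]\<^bsub>P\<^esub> j \<otimes>\<^bsub>P\<^esub> a [^]\<^bsub>P\<^esub> i" for w
  proof (induction w)
    case Nil
    have "word_eval P (pres_gen ?R) [] = b [^]\<^bsub>P\<^esub> (0::nat) \<otimes>\<^bsub>P\<^esub> a [^]\<^bsub>P\<^esub> (0::int)" by simp
    then show ?case by blast
  next
    case (Cons p w)
    then obtain i :: int and j :: nat where w: "word_eval P (pres_gen ?R) w = b [^]\<^bsub>P\<^esub> j \<otimes>\<^bsub>P\<^esub> a [^]\<^bsub>P\<^esub> i"
      by blast
    obtain g s where p: "p = (g, s)" by force
    show ?case
    proof (cases g)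
      case gen_a
      define e :: int where "e = (if s then 1 else - 1)"
      have "word_eval P (pres_gen ?R) (p # w) = a [^]\<^bsub>P\<^esub> e \<otimes>\<^bsub>P\<^esub> (b [^]\<^bsub>P\<^esub> j \<otimes>\<^bsub>P\<^esub> a [^]\<^bsub>P\<^esub> i)"
        by (simp add: p gen_a w e_def a_def[symmetric] int_pow_neg)
      also have "\<dots> = (a [^]\<^bsub>P\<^esub> e \<otimes>\<^bsub>P\<^esub> b [^]\<^bsub>P\<^esub> j) \<otimes>\<^bsub>P\<^esub> a [^]\<^bsub>P\<^esub> i" by (simp add: m_assoc)
      also have "\<dots> = b [^]\<^bsub>P\<^esub> j \<otimes>\<^bsub>P\<^esub> a [^]\<^bsub>P\<^esub> (int k ^ j * e + i)"
        unfolding aibj by (simp add: int_pow_mult m_assoc)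
      finally show ?thesis by blast
    next
      case gen_b
      define e :: nat where "e = (if s then 1 else n - 1)"
      have "inv\<^bsub>P\<^esub> b = b [^]\<^bsub>P\<^esub> (n - 1)"
        using bn \<open>n > 0\<close> nat_pow_Suc[of b "n - 1"] by (intro inv_equality) simp_all
      then have "word_eval P (pres_gen ?R) (p # w) = b [^]\<^bsub>P\<^esub> e \<otimes>\<^bsub>P\<^esub> (b [^]\<^bsub>P\<^esub> j \<otimes>\<^bsub>P\<^esub> a [^]\<^bsub>P\<^esub> i)"
        by (simp add: p gen_b w e_def b_def[symmetric])
      also have "\<dots> = b [^]\<^bsub>P\<^esub> (e + j) \<otimes>\<^bsub>P\<^esub> a [^]\<^bsub>P\<^esub> i"
        by (simp add: nat_pow_mult flip: m_assoc)
      finally show ?thesis by blast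
    qed
  qed
  moreover obtain w where "g = pres_class ?R w" using assms(2) by (auto simp: presented_group_def)
  ultimately show "\<exists>(i::int) (j::nat). g = b [^]\<^bsub>P\<^esub> j \<otimes>\<^bsub>P\<^esub> a [^]\<^bsub>P\<^esub> i"
    unfolding P_def word_eval_pres_gen by blast
qed

text \<open>The universal property gives a surjection onto \<open>K\<close>. By
  \<open>indep\<close>, the exponents of a normal form in its kernel are multiples of
  \<open>m\<close> and \<open>n\<close>, so the normal form is trivial already in the presented
  group.\<close>

lemma metacyclic_presentation:
  assumes "group K" and n: "n > 0" and a: "a \<in> carrier K" and b: "b \<in> carrier K"
    and gen: "generate K {a, b} = carrier K"
    and am: "a [^]\<^bsub>K\<^esub> m = \<one>\<^bsub>K\<^esub>" and bn: "b [^]\<^bsub>K\<^esub> n = \<one>\<^bsub>K\<^esub>"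
    and conj: "inv\<^bsub>K\<^esub> b \<otimes>\<^bsub>K\<^esub> a \<otimes>\<^bsub>K\<^esub> b = a [^]\<^bsub>K\<^esub> k"
    and indep: "\<And>i j :: int. a [^]\<^bsub>K\<^esub> i \<otimes>\<^bsub>K\<^esub> b [^]\<^bsub>K\<^esub> j = \<one>\<^bsub>K\<^esub> \<Longrightarrow> int m dvd i \<and> int n dvd j"
  defines "R \<equiv> metacyclic_rels m n k"
  shows "\<exists>h\<in>iso (presented_group R) K. h (pres_gen R gen_a) = a \<and> h (pres_gen R gen_b) = b"
proof -
  interpret K: group K by fact
  interpret P: group "presented_group R" by (rule group_presented_group)
  define f where "f g = (case g of gen_a \<Rightarrow> a | gen_b \<Rightarrow> b)" for g
  have f: "f g \<in> carrier K" for g using a b by (simp add: f_def split: gen.split)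
  have fab: "f gen_a = a" "f gen_b = b" by (simp_all add: f_def)
  have "word_eval K f u = word_eval K f v" if "(u, v) \<in> R" for u v
    using that f am bn conj b
    by (auto simp: R_def metacyclic_rels_def K.word_eval_replicate fab K.m_assoc a)
  from presented_group_universal[OF \<open>group K\<close> f this]
  obtain h where h: "h \<in> hom (presented_group R) K" and hf: "\<And>g. h (pres_gen R g) = f g" by blast
  interpret h: group_hom "presented_group R" K h by unfold_locales (rule h)
  have "{a, b} \<subseteq> h ` carrier (presented_group R)"
    using imageI[OF pres_gen_carrier[of R gen_a], of h] imageI[OF pres_gen_carrier[of R gen_b], of h]
    by (simp add: hf fab)
  then have "carrier K \<subseteq> h ` carrier (presented_group R)"
    using K.generate_subgroup_incl[OF _ h.img_is_subgroup] unfolding gen[symmetric] by blast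
  then have surj: "h ` carrier (presented_group R) = carrier K"
    using h.hom_closed by blast
  have "g = \<one>\<^bsub>presented_group R\<^esub>" if g: "g \<in> carrier (presented_group R)" and hg: "h g = \<one>\<^bsub>K\<^esub>" for g
  proof -
    let ?a = "pres_gen R gen_a" and ?b = "pres_gen R gen_b"
    note nf = metacyclic_normal_form[OF n g[unfolded R_def], folded R_def]
    obtain i :: int and j :: nat where
      g: "g = ?b [^]\<^bsub>presented_group R\<^esub> j \<otimes>\<^bsub>presented_group R\<^esub> ?a [^]\<^bsub>presented_group R\<^esub> i"
      using nf(3) by blast
    have "b [^]\<^bsub>K\<^esub> int j \<otimes>\<^bsub>K\<^esub> a [^]\<^bsub>K\<^esub> i = \<one>\<^bsub>K\<^esub>"
      using hg by (simp add: g h.hom_nat_pow h.hom_int_pow hf fab int_pow_int)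
    then have "a [^]\<^bsub>K\<^esub> i \<otimes>\<^bsub>K\<^esub> b [^]\<^bsub>K\<^esub> int j = \<one>\<^bsub>K\<^esub>" by (rule K.inv_comm) (use a b in auto)
    then have "int m dvd i" "int n dvd int j" using indep[of i "int j"] by blast+
    then obtain i' j' where ij: "i = int m * i'" "j = n * j'" by (auto elim!: dvdE)
    have "?a [^]\<^bsub>presented_group R\<^esub> i = (?a [^]\<^bsub>presented_group R\<^esub> m) [^]\<^bsub>presented_group R\<^esub> i'"
      by (simp add: ij P.int_pow_pow flip: int_pow_int)
    moreover have "?b [^]\<^bsub>presented_group R\<^esub> j = (?b [^]\<^bsub>presented_group R\<^esub> n) [^]\<^bsub>presented_group R\<^esub> j'"
      by (simp add: ij P.nat_pow_pow)
    ultimately show ?thesis using nf(1,2) by (simp add: g)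
  qed
  then have "inj_on h (carrier (presented_group R))"
    by (auto simp: h.inj_iff_trivial_ker kernel_def)
  with surj h have "h \<in> iso (presented_group R) K" by (simp add: iso_def bij_betw_def)
  then show ?thesis using hf fab by (intro bexI[of _ h]) simp_all
qed

lemma (in group) generate_mult_right:
  assumes "x \<in> carrier G" and "y \<in> carrier G"
  shows "generate G {x, y} \<subseteq> generate G {x, x \<otimes> y}"
proof (rule generate_subgroup_incl)
  have cl: "{x, x \<otimes> y} \<subseteq> carrier G" using assms by simp
  show "subgroup (generate G {x, x \<otimes> y}) G" by (rule generate_is_subgroup[OF cl])
  have "inv x \<otimes> (x \<otimes> y) \<in> generate G {x, x \<otimes> y}"
    by (intro generate.eng generate.inv generate.incl) auto
  then show "{x, y} \<subseteq> generate G {x, x \<otimes> y}"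
    using assms by (simp add: inv_cancel generate.incl)
qed

lemma (in group) generate_inv_pair:
  assumes "x \<in> carrier G" and "y \<in> carrier G"
  shows "generate G {x, y} \<subseteq> generate G {inv x, inv y}"
proof (rule generate_subgroup_incl)
  show "subgroup (generate G {inv x, inv y}) G"
    using assms by (intro generate_is_subgroup) simp
  have "inv (inv x) \<in> generate G {inv x, inv y}" "inv (inv y) \<in> generate G {inv x, inv y}"
    by (auto intro: generate.inv)
  then show "{x, y} \<subseteq> generate G {inv x, inv y}" using assms by simp
qed

section \<open>Recognising the two presentations from a rotated pair\<close>

context eisenstein_pair
begin

lemma cube_inv_pair: "(inv x \<otimes> inv y) [^] (3::nat) = inv ((x \<otimes> y) [^] (3::nat))"
  unfolding cube_xy by (simp add: cube_mult cube_inv cube_x cube_y w_add flip: w_neg)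

lemma inv_pair_pow:
  assumes "t > 0"
  shows "(inv x \<otimes> inv y) [^] (3 ^ t :: nat) = inv ((x \<otimes> y) [^] (3 ^ t :: nat))"
proof -
  obtain r where r: "t = Suc r" using assms by (cases t) auto
  have "g [^] (3 ^ t :: nat) = (g [^] (3::nat)) [^] (3 ^ r :: nat)" if "g \<in> carrier G" for g
    using that by (simp add: r nat_pow_pow)
  then show ?thesis by (simp add: cube_inv_pair nat_pow_inv)
qed

text \<open>The element \<open>inv x \<otimes> inv y\<close> is not the inverse of
  \<open>x \<otimes> y\<close>, but it has the inverse cube, and \<open>independent_mod_3\<close>
  makes the exponents multiples of 3.\<close>

lemma inv_pair_relation:
  fixes i j :: int
  assumes rel: "inv x [^] i \<otimes> (inv x \<otimes> inv y) [^] j = \<one>"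
  shows "x [^] (- i) \<otimes> (x \<otimes> y) [^] (- j) = \<one>"
proof -
  have "inv x \<otimes> (inv x \<otimes> inv y) \<noteq> (inv x \<otimes> inv y) \<otimes> inv x"
  proof
    assume "inv x \<otimes> (inv x \<otimes> inv y) = (inv x \<otimes> inv y) \<otimes> inv x"
    then have "inv x \<otimes> inv y = inv y \<otimes> inv x" by (simp add: m_assoc)
    then have "inv (y \<otimes> x) = inv (x \<otimes> y)" by (simp add: inv_mult_group)
    then show False using xy_noncomm inv_inj by (metis inv_inv m_closed x y)
  qed
  from independent_mod_3[OF _ _ this rel] obtain k l where kl: "i = 3 * k" "j = 3 * l"
    by (auto elim!: dvdE)
  have "inv x [^] i = x [^] (- i)"
    by (simp add: int_pow_neg int_pow_inv)
  moreover have "(inv x \<otimes> inv y) [^] j = (x \<otimes> y) [^] (- j)"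
    by (simp add: kl int_pow_3_mult cube_inv_pair int_pow_inv int_pow_neg)
  ultimately show ?thesis using rel by simp
qed

text \<open>The pairs \<open>(x, y)\<close> and \<open>(inv x, inv y)\<close> have the same
  commutator, while passing to inverses inverts the powers by 3^t; so one of the pairs matches the
  exponent 1 + 3^t exactly. The first two formulas serve the presentation with \<open>a = u\<close>,
  \<open>b = u \<otimes> v\<close>, the last two the one with the roles exchanged.\<close>

lemma conj_formulas:
  "inv (x \<otimes> y) \<otimes> x \<otimes> (x \<otimes> y) = x \<otimes> c"
  "inv (inv x \<otimes> inv y) \<otimes> inv x \<otimes> (inv x \<otimes> inv y) = inv x \<otimes> c"
  "inv x \<otimes> (x \<otimes> y) \<otimes> x = (x \<otimes> y) \<otimes> inv c"
  "inv (inv x) \<otimes> (inv x \<otimes> inv y) \<otimes> inv x = (inv x \<otimes> inv y) \<otimes> inv c"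
proof -
  have "inv (x \<otimes> y) \<otimes> x \<otimes> (x \<otimes> y) = inv y \<otimes> (x \<otimes> y)"
    by (simp add: inv_mult_group m_assoc inv_cancel)
  also have "\<dots> = x \<otimes> c" unfolding xy by (simp add: m_assoc inv_cancel)
  finally show "inv (x \<otimes> y) \<otimes> x \<otimes> (x \<otimes> y) = x \<otimes> c" .
  have "x \<otimes> (y \<otimes> (inv x \<otimes> inv y)) = (x \<otimes> y) \<otimes> inv (y \<otimes> x)" by (simp add: inv_mult_group m_assoc)
  also have "x \<otimes> y = c \<otimes> (y \<otimes> x)" using c_central[of "y \<otimes> x"] xy by simp
  finally have c: "x \<otimes> (y \<otimes> (inv x \<otimes> inv y)) = c" by (simp add: m_assoc)
  have "inv (inv x \<otimes> inv y) \<otimes> inv x \<otimes> (inv x \<otimes> inv y) = inv x \<otimes> (x \<otimes> (y \<otimes> (inv x \<otimes> inv y)))"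
    by (simp add: inv_mult_group m_assoc inv_cancel)
  then show "inv (inv x \<otimes> inv y) \<otimes> inv x \<otimes> (inv x \<otimes> inv y) = inv x \<otimes> c" unfolding c .
  have "inv x \<otimes> (x \<otimes> y) \<otimes> x = y \<otimes> x" by (simp add: inv_cancel)
  also have "\<dots> = (x \<otimes> y) \<otimes> inv c" unfolding xy by (simp add: m_assoc)
  finally show "inv x \<otimes> (x \<otimes> y) \<otimes> x = (x \<otimes> y) \<otimes> inv c" .
  have "inv (inv x) \<otimes> (inv x \<otimes> inv y) \<otimes> inv x = inv (x \<otimes> y)"
    by (simp add: inv_mult_group inv_cancel)
  also have "\<dots> = inv c \<otimes> (inv x \<otimes> inv y)"
    unfolding xy by (simp add: inv_mult_group)
  also have "\<dots> = (inv x \<otimes> inv y) \<otimes> inv c"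
    by (rule inv_intertwine) (simp_all add: c_central)
  finally show "inv (inv x) \<otimes> (inv x \<otimes> inv y) \<otimes> inv x = (inv x \<otimes> inv y) \<otimes> inv c" .
qed

text \<open>With \<open>u\<close> and \<open>u \<otimes> v\<close> as the two generators, the third
  element of either connection set becomes \<open>v\<close>. The roles of \<open>a\<close> and
  \<open>b\<close> differ because the commutator has to be a power of the image of
  \<open>a\<close>.\<close>

lemma presentation:
  "\<exists>t>0. \<exists>(u, v)\<in>{(x, y), (inv x, inv y)}.
     (\<exists>h\<in>iso (presented_group (rels_G t)) G.
        h (pres_gen (rels_G t) gen_a) = u \<and> h (pres_gen (rels_G t) gen_b) = u \<otimes> v)
   \<or> (\<exists>h\<in>iso (presented_group (rels_H t)) G.
        h (pres_gen (rels_H t) gen_b) = u \<and> h (pres_gen (rels_H t) gen_a) = u \<otimes> v)"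
proof -
  have iso_G: "\<exists>h\<in>iso (presented_group (rels_G t)) G.
      h (pres_gen (rels_G t) gen_a) = u \<and> h (pres_gen (rels_G t) gen_b) = u \<otimes> v"
    if "u \<in> carrier G" "v \<in> carrier G" "generate G {x, y} \<subseteq> generate G {u, v}"
      "u [^] (3 ^ (t + 1) :: nat) = \<one>" "(u \<otimes> v) [^] (3 ^ t :: nat) = \<one>"
      "inv (u \<otimes> v) \<otimes> u \<otimes> (u \<otimes> v) = u \<otimes> u [^] (3 ^ t :: nat)"
      "\<And>(i::int) (j::int). u [^] i \<otimes> (u \<otimes> v) [^] j = \<one> \<Longrightarrow> 3 ^ (t + 1) dvd i \<and> 3 ^ t dvd j"
    for u v t
  proof -
    have "generate G {u, u \<otimes> v} \<subseteq> carrier G" using that(1,2) by (intro generate_incl) simp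
    then have "generate G {u, u \<otimes> v} = carrier G"
      using generate_mult_right[OF that(1,2)] that(3) unfolding generated by blast
    then show ?thesis
      unfolding rels_G_def using that
      by (intro metacyclic_presentation is_group) (simp_all add: nat_pow_Suc2 flip: nat_pow_Suc2)
  qed
  have iso_H: "\<exists>h\<in>iso (presented_group (rels_H t)) G.
      h (pres_gen (rels_H t) gen_b) = u \<and> h (pres_gen (rels_H t) gen_a) = u \<otimes> v"
    if "u \<in> carrier G" "v \<in> carrier G" "generate G {x, y} \<subseteq> generate G {u, v}"
      "u [^] (3 ^ (t + 1) :: nat) = \<one>" "(u \<otimes> v) [^] (3 ^ (t + 1) :: nat) = \<one>"
      "inv u \<otimes> (u \<otimes> v) \<otimes> u = (u \<otimes> v) \<otimes> (u \<otimes> v) [^] (3 ^ t :: nat)"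
      "\<And>(i::int) (j::int). u [^] i \<otimes> (u \<otimes> v) [^] j = \<one> \<Longrightarrow> 3 ^ (t + 1) dvd i \<and> 3 ^ (t + 1) dvd j"
    for u v t
  proof -
    have "generate G {u, u \<otimes> v} \<subseteq> carrier G" using that(1,2) by (intro generate_incl) simp
    then have gen: "generate G {u \<otimes> v, u} = carrier G"
      using generate_mult_right[OF that(1,2)] that(3) unfolding generated insert_commute[of u] by blast
    have indep: "int (3 ^ (t + 1)) dvd i \<and> int (3 ^ (t + 1)) dvd j"
      if "(u \<otimes> v) [^] i \<otimes> u [^] j = \<one>" for i j :: int
    proof -
      have "u [^] j \<otimes> (u \<otimes> v) [^] i = \<one>"
        by (rule inv_comm[OF that]) (use \<open>u \<in> carrier G\<close> \<open>v \<in> carrier G\<close> in simp_all)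
      from \<open>\<And>(i::int) (j::int). u [^] i \<otimes> (u \<otimes> v) [^] j = \<one> \<Longrightarrow> 3 ^ (t + 1) dvd i \<and> 3 ^ (t + 1) dvd j\<close>[OF this]
      show ?thesis by simp
    qed
    have "\<exists>h\<in>iso (presented_group (rels_H t)) G.
      h (pres_gen (rels_H t) gen_a) = u \<otimes> v \<and> h (pres_gen (rels_H t) gen_b) = u"
      unfolding rels_H_def
      by (rule metacyclic_presentation[OF is_group _ _ _ gen that(5,4) _ indep])
        (use that in \<open>simp_all flip: nat_pow_Suc2\<close>)
    then show ?thesis by blast
  qed
  obtain t where t: "t > 0" and cases:
    "x [^] (3 ^ (t + 1) :: nat) = \<one> \<and> (x \<otimes> y) [^] (3 ^ t :: nat) = \<one> \<and>
        (x [^] (3 ^ t :: nat) = c \<or> x [^] (3 ^ t :: nat) = inv c) \<and>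
        (\<forall>(i::int) (j::int). x [^] i \<otimes> (x \<otimes> y) [^] j = \<one> \<longrightarrow> 3 ^ (t + 1) dvd i \<and> 3 ^ t dvd j)
      \<or> x [^] (3 ^ (t + 1) :: nat) = \<one> \<and> (x \<otimes> y) [^] (3 ^ (t + 1) :: nat) = \<one> \<and>
        ((x \<otimes> y) [^] (3 ^ t :: nat) = c \<or> (x \<otimes> y) [^] (3 ^ t :: nat) = inv c) \<and>
        (\<forall>(i::int) (j::int). x [^] i \<otimes> (x \<otimes> y) [^] j = \<one> \<longrightarrow> 3 ^ (t + 1) dvd i \<and> 3 ^ (t + 1) dvd j)"
    (is "?A \<or> ?B")
    using relations by blast
  show ?thesis
  proof (intro exI[of _ t] conjI t)
    \<comment> \<open>The first presentation asks for u^(3^t) = c, the second for (u v)^(3^t) =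
      c^-1, by \<open>conj_formulas\<close>. Cases 1 and 3 therefore use \<open>(x, y)\<close>, the
      other two the inverse pair.\<close>
    from cases consider "?A" "x [^] (3 ^ t :: nat) = c" | "?A" "x [^] (3 ^ t :: nat) = inv c"
      | "?B" "(x \<otimes> y) [^] (3 ^ t :: nat) = inv c" | "?B" "(x \<otimes> y) [^] (3 ^ t :: nat) = c" by blast
    then show "\<exists>(u, v)\<in>{(x, y), (inv x, inv y)}.
     (\<exists>h\<in>iso (presented_group (rels_G t)) G.
        h (pres_gen (rels_G t) gen_a) = u \<and> h (pres_gen (rels_G t) gen_b) = u \<otimes> v)
   \<or> (\<exists>h\<in>iso (presented_group (rels_H t)) G.
        h (pres_gen (rels_H t) gen_b) = u \<and> h (pres_gen (rels_H t) gen_a) = u \<otimes> v)"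
    proof cases
      case 1
      then show ?thesis using iso_G[of x y t] by (simp add: conj_formulas)
    next
      case 2
      have "3 ^ (t + 1) dvd i \<and> 3 ^ t dvd j"
        if "inv x [^] i \<otimes> (inv x \<otimes> inv y) [^] j = \<one>" for i j :: int
        using 2(1) inv_pair_relation[OF that] by (metis dvd_minus_iff)
      then show ?thesis using 2 iso_G[of "inv x" "inv y" t] generate_inv_pair[OF x y]
        by (simp add: conj_formulas inv_pair_pow[OF t] nat_pow_inv)
    next
      case 3
      then show ?thesis using iso_H[of x y t] by (simp add: conj_formulas)
    next
      case 4
      have indep: "3 ^ (t + 1) dvd i \<and> 3 ^ (t + 1) dvd j"
        if "inv x [^] i \<otimes> (inv x \<otimes> inv y) [^] j = \<one>" for i j :: int
        using 4(1) inv_pair_relation[OF that] by (metis dvd_minus_iff)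
      have "\<exists>h\<in>iso (presented_group (rels_H t)) G.
          h (pres_gen (rels_H t) gen_b) = inv x \<and> h (pres_gen (rels_H t) gen_a) = inv x \<otimes> inv y"
      proof (rule iso_H[OF _ _ generate_inv_pair[OF x y] _ _ _ indep])
        show "inv x [^] (3 ^ (t + 1) :: nat) = \<one>" using 4(1) by (simp add: nat_pow_inv)
        show "(inv x \<otimes> inv y) [^] (3 ^ (t + 1) :: nat) = \<one>"
          using 4(1) inv_pair_pow[of "t + 1"] by simp
        show "inv (inv x) \<otimes> (inv x \<otimes> inv y) \<otimes> inv x
            = (inv x \<otimes> inv y) \<otimes> (inv x \<otimes> inv y) [^] (3 ^ t :: nat)"
          unfolding conj_formulas inv_pair_pow[OF t] 4(2) ..
      qed simp_all
      then show ?thesis by blast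
    qed
  qed
qed

end

section \<open>Inner-abelian metacyclic 3-groups\<close>

lemma (in group) power_root:
  fixes s :: int
  assumes g: "g \<in> carrier G" and "ord g = 3 ^ e" and s: "\<not> 3 dvd s"
  shows "\<exists>k::int. (g [^] s) [^] k = g"
proof -
  have "(\<exists>m. 1 * s = 3 * m + 1) \<or> (\<exists>m. - 1 * s = 3 * m + 1)" using s by presburger
  then obtain a m where "a * s = 3 * m + 1" by blast
  then have "1 = a * s - 3 * m" by simp
  then have "coprime s 3" by (intro coprimeI) (metis dvd_diff dvd_mult dvd_mult2)
  then have "gcd s (3 ^ e) = 1" by (simp add: coprime_iff_gcd_eq_1[symmetric])
  then obtain k l where kl: "k * s + l * 3 ^ e = 1" using bezout_int[of s "3 ^ e"] by auto
  have "g [^] (l * 3 ^ e) = \<one>" using g assms(2) by (simp add: int_pow_eq_id)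
  then have "g = g [^] (k * s)"
    using g kl int_pow_mult[of g "k * s" "l * 3 ^ e"] by simp
  then show ?thesis using g by (auto simp: int_pow_pow mult.commute intro!: exI[of _ k])
qed

lemma (in group) powers_comm_group:
  assumes "a \<in> carrier G" and "\<And>g. g \<in> carrier G \<Longrightarrow> \<exists>i::int. g = a [^] i"
  shows "comm_group G"
proof (rule group_comm_groupI)
  fix g h assume "g \<in> carrier G" "h \<in> carrier G"
  then obtain i j :: int where "g = a [^] i" "h = a [^] j" using assms(2) by metis
  then show "g \<otimes> h = h \<otimes> g" using assms(1) by (simp add: add.commute flip: int_pow_mult)
qed

lemma (in group) product_subgroup:
  assumes a: "a \<in> carrier G" and b: "b \<in> carrier G"
    and ex: "\<And>(i::int) (j::int). \<exists>k::int. b [^] j \<otimes> a [^] i = a [^] k \<otimes> b [^] j"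
  shows "subgroup {a [^] i \<otimes> b [^] j | (i::int) (j::int). True} G" (is "subgroup ?S G")
proof
  show "?S \<subseteq> carrier G" using a b by auto
  have "\<one> = a [^] (0::int) \<otimes> b [^] (0::int)" by simp
  then show "\<one> \<in> ?S" by blast
next
  fix g h assume "g \<in> ?S" "h \<in> ?S"
  then obtain i j k l :: int where gh: "g = a [^] i \<otimes> b [^] j" "h = a [^] k \<otimes> b [^] l" by blast
  obtain k' :: int where k': "b [^] j \<otimes> a [^] k = a [^] k' \<otimes> b [^] j" using ex by blast
  have "g \<otimes> h = a [^] i \<otimes> (b [^] j \<otimes> a [^] k) \<otimes> b [^] l" using a b by (simp add: gh m_assoc)
  also have "\<dots> = a [^] (i + k') \<otimes> b [^] (j + l)" using a b by (simp add: k' m_assoc int_pow_mult)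
  finally show "g \<otimes> h \<in> ?S" by blast
next
  fix g assume "g \<in> ?S"
  then obtain i j :: int where g: "g = a [^] i \<otimes> b [^] j" by blast
  obtain k :: int where k: "b [^] (- j) \<otimes> a [^] (- i) = a [^] k \<otimes> b [^] (- j)" using ex by blast
  have "inv g = b [^] (- j) \<otimes> a [^] (- i)" using a b by (simp add: g inv_mult_group int_pow_neg)
  then show "inv g \<in> ?S" using k by auto
qed

text \<open>Here \<open>n\<close> generates the cyclic normal subgroup and \<open>m\<close>
  represents a generator of the cyclic quotient.\<close>

lemma (in group) metacyclic_generators:
  assumes "metacyclic G"
  obtains n m where "n \<in> carrier G" "m \<in> carrier G"
    and "\<And>g. g \<in> carrier G \<Longrightarrow> \<exists>(i::int) (j::int). g = n [^] i \<otimes> m [^] j"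
    and "\<And>g i. g \<in> carrier G \<Longrightarrow> \<exists>k::int. g \<otimes> n [^] (i::int) = n [^] k \<otimes> g"
proof -
  obtain N where N: "N \<lhd> G" and cycN: "cyclic_group (G\<lparr>carrier := N\<rparr>)" and cycQ: "cyclic_group (G Mod N)"
    using assms unfolding metacyclic_def by blast
  interpret N: normal N G by (rule N)
  interpret Q: group "G Mod N" by (rule N.factorgroup_is_group)
  have sub: "subgroup N G" by (rule N.subgroup_axioms)
  interpret NG: group "G\<lparr>carrier := N\<rparr>" by (rule subgroup.subgroup_is_group[OF sub is_group])
  obtain n where n: "n \<in> N" and "N = range (\<lambda>i::int. n [^]\<^bsub>G\<lparr>carrier := N\<rparr>\<^esub> i)"
    using cycN unfolding NG.cyclic_group by auto
  then have Nn: "N = range (\<lambda>i::int. n [^] i)"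
    by (simp only: int_pow_consistent[OF sub n])
  obtain M where M: "M \<in> carrier (G Mod N)" and QM: "carrier (G Mod N) = range (\<lambda>i::int. M [^]\<^bsub>G Mod N\<^esub> i)"
    using cycQ unfolding Q.cyclic_group by blast
  obtain m where m: "m \<in> carrier G" and Mm: "M = N #> m"
    using M by (auto simp: FactGroup_def RCOSETS_def)
  interpret q: group_hom G "G Mod N" "\<lambda>g. N #> g"
    by unfold_locales (rule N.r_coset_hom_Mod)
  have nc: "n \<in> carrier G" using n N.subset by blast
  have "\<exists>(i::int) (j::int). g = n [^] i \<otimes> m [^] j" if g: "g \<in> carrier G" for g
  proof -
    have "N #> g \<in> carrier (G Mod N)" using g by (auto simp: FactGroup_def RCOSETS_def)
    then obtain j :: int where "N #> g = M [^]\<^bsub>G Mod N\<^esub> j" unfolding QM by blast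
    then have "N #> g = N #> m [^] j" using q.hom_int_pow[OF m, of j] by (simp add: Mm)
    then have "g \<in> N #> m [^] j" using g rcos_self[OF g sub] by simp
    then show ?thesis unfolding r_coset_def by (auto simp: Nn)
  qed
  moreover have "\<exists>k::int. g \<otimes> n [^] (i::int) = n [^] k \<otimes> g" if g: "g \<in> carrier G" for g i
  proof -
    have "n [^] i \<in> N" unfolding Nn by blast
    then have "g \<otimes> n [^] i \<otimes> inv g \<in> N" using g by (rule N.inv_op_closed2[rotated])
    then obtain k :: int where "g \<otimes> n [^] i \<otimes> inv g = n [^] k" unfolding Nn by blast
    then have "g \<otimes> n [^] i \<otimes> inv g \<otimes> g = n [^] k \<otimes> g" by simp
    then have "g \<otimes> n [^] i = n [^] k \<otimes> g" using g nc by (simp add: m_assoc)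
    then show ?thesis ..
  qed
  ultimately show thesis using that nc m by blast
qed

text \<open>The subgroups generated by n, m^3 and by n^3, m are proper, hence abelian; so m^3
  commutes with n and n^3 with m. Writing m^-1 n m = n^r, the first fact gives r^3 = 1 modulo the
  order of n and thus r = 1 modulo 3, which makes the commutator n^(r-1) a cube. The second makes it
  central and gives n^(3(r-1)) = 1.\<close>

lemma inner_abelian_metacyclic_cubic_commutators:
  assumes inner: "inner_abelian G" and meta: "metacyclic G" and three: "p_group 3 G"
  shows "cubic_commutators G"
proof -
  interpret group G using inner by (simp add: inner_abelian_def)
  have nonab: "\<not> comm_group G"
    and proper: "\<And>K. subgroup K G \<Longrightarrow> K \<noteq> carrier G \<Longrightarrow> comm_group (G\<lparr>carrier := K\<rparr>)"
    using inner by (auto simp: inner_abelian_def)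
  have ord3: "\<exists>e. ord g = 3 ^ e" if "g \<in> carrier G" for g using three that by (simp add: p_group_def)
  obtain n m where n: "n \<in> carrier G" and m: "m \<in> carrier G"
    and nm: "\<And>g. g \<in> carrier G \<Longrightarrow> \<exists>(i::int) (j::int). g = n [^]\<^bsub>G\<^esub> i \<otimes>\<^bsub>G\<^esub> m [^]\<^bsub>G\<^esub> j"
    and norm: "\<And>g i. g \<in> carrier G \<Longrightarrow> \<exists>k::int. g \<otimes>\<^bsub>G\<^esub> n [^]\<^bsub>G\<^esub> (i::int) = n [^]\<^bsub>G\<^esub> k \<otimes>\<^bsub>G\<^esub> g"
    by (rule metacyclic_generators[OF meta]) blast
  have unit3: "\<not> 3 dvd 1 - 3 * (j::int)" for j by presburger
  define c3 where "c3 = (\<lambda>g. g [^]\<^bsub>G\<^esub> (3::int))"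
  have c3: "c3 g \<in> carrier G" "c3 g [^]\<^bsub>G\<^esub> i = g [^]\<^bsub>G\<^esub> (3 * i)" if "g \<in> carrier G" for g and i :: int
    using that by (simp_all add: c3_def int_pow_pow)
  have m3: "c3 m \<otimes>\<^bsub>G\<^esub> n = n \<otimes>\<^bsub>G\<^esub> c3 m"
  proof -
    define K where "K = {n [^]\<^bsub>G\<^esub> i \<otimes>\<^bsub>G\<^esub> c3 m [^]\<^bsub>G\<^esub> j | (i::int) (j::int). True}"
    have K: "subgroup K G" unfolding K_def
      by (rule product_subgroup) (use n m norm c3 in auto)
    \<comment> \<open>Otherwise some power of \<open>m\<close> with exponent 1 - 3j would be a power
      of \<open>n\<close>. That exponent is invertible modulo the 3-power order of \<open>m\<close>,
      so \<open>m\<close> itself would be a power of \<open>n\<close> and the group cyclic.\<close>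
    have "m \<notin> K"
    proof
      assume "m \<in> K"
      then obtain i j :: int where ij: "m = n [^]\<^bsub>G\<^esub> i \<otimes>\<^bsub>G\<^esub> m [^]\<^bsub>G\<^esub> (3 * j)" using m by (auto simp: K_def c3)
      have "m [^]\<^bsub>G\<^esub> (1 - 3 * j) = m \<otimes>\<^bsub>G\<^esub> inv\<^bsub>G\<^esub> (m [^]\<^bsub>G\<^esub> (3 * j))"
        using m by (simp add: int_pow_diff)
      also have "\<dots> = n [^]\<^bsub>G\<^esub> i" using n m by (subst (1) ij) (simp add: m_assoc)
      finally have "m [^]\<^bsub>G\<^esub> (1 - 3 * j) = n [^]\<^bsub>G\<^esub> i" .
      moreover obtain k :: int where "(m [^]\<^bsub>G\<^esub> (1 - 3 * j)) [^]\<^bsub>G\<^esub> k = m"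
        using power_root[OF m, of _ "1 - 3 * j"] ord3[OF m] unit3[of j] by blast
      ultimately have mk: "m = n [^]\<^bsub>G\<^esub> (i * k)" using n by (simp add: int_pow_pow)
      have "comm_group G"
      proof (rule powers_comm_group[OF n])
        fix g assume "g \<in> carrier G"
        then obtain a b :: int where "g = n [^]\<^bsub>G\<^esub> a \<otimes>\<^bsub>G\<^esub> m [^]\<^bsub>G\<^esub> b" using nm by blast
        then have "g = n [^]\<^bsub>G\<^esub> (a + i * k * b)" using n by (simp add: mk int_pow_pow int_pow_mult)
        then show "\<exists>i::int. g = n [^]\<^bsub>G\<^esub> i" ..
      qed
      with nonab show False ..
    qed
    then interpret K: comm_group "G\<lparr>carrier := K\<rparr>" using proper[OF K] m by blast
    have "n = n [^]\<^bsub>G\<^esub> (1::int) \<otimes>\<^bsub>G\<^esub> c3 m [^]\<^bsub>G\<^esub> (0::int)"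
      "c3 m = n [^]\<^bsub>G\<^esub> (0::int) \<otimes>\<^bsub>G\<^esub> c3 m [^]\<^bsub>G\<^esub> (1::int)" using n m c3(1) by auto
    then have "n \<in> K" "c3 m \<in> K" unfolding K_def by blast+
    then show ?thesis using K.m_comm[of n "c3 m"] by simp
  qed
  have n3: "c3 n \<otimes>\<^bsub>G\<^esub> m = m \<otimes>\<^bsub>G\<^esub> c3 n"
  proof -
    define K where "K = {c3 n [^]\<^bsub>G\<^esub> i \<otimes>\<^bsub>G\<^esub> m [^]\<^bsub>G\<^esub> j | (i::int) (j::int). True}"
    have "\<exists>k::int. m [^]\<^bsub>G\<^esub> j \<otimes>\<^bsub>G\<^esub> c3 n [^]\<^bsub>G\<^esub> i = c3 n [^]\<^bsub>G\<^esub> k \<otimes>\<^bsub>G\<^esub> m [^]\<^bsub>G\<^esub> j" for i j :: int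
    proof -
      obtain k :: int where "n [^]\<^bsub>G\<^esub> k \<otimes>\<^bsub>G\<^esub> m [^]\<^bsub>G\<^esub> j = m [^]\<^bsub>G\<^esub> j \<otimes>\<^bsub>G\<^esub> n [^]\<^bsub>G\<^esub> i"
        using norm[of "m [^]\<^bsub>G\<^esub> j" i] m by auto
      from int_pow_intertwine[OF this, of 3] n m
      show ?thesis by (auto simp: int_pow_pow c3 mult.commute intro!: exI[of _ k])
    qed
    then have K: "subgroup K G" unfolding K_def
      by (intro product_subgroup) (use n m c3 in auto)
    have "n \<notin> K"
    proof
      assume "n \<in> K"
      then obtain i j :: int where ij: "n = n [^]\<^bsub>G\<^esub> (3 * i) \<otimes>\<^bsub>G\<^esub> m [^]\<^bsub>G\<^esub> j" using n by (auto simp: K_def c3)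
      have "n [^]\<^bsub>G\<^esub> (1 - 3 * i) = n [^]\<^bsub>G\<^esub> (- (3 * i)) \<otimes>\<^bsub>G\<^esub> n"
        using n int_pow_mult[OF n, of "- (3 * i)" 1] by simp
      also have "\<dots> = m [^]\<^bsub>G\<^esub> j"
        using n m by (subst (2) ij) (simp add: int_pow_neg inv_cancel)
      finally have "n [^]\<^bsub>G\<^esub> (1 - 3 * i) = m [^]\<^bsub>G\<^esub> j" .
      moreover obtain k :: int where "(n [^]\<^bsub>G\<^esub> (1 - 3 * i)) [^]\<^bsub>G\<^esub> k = n"
        using power_root[OF n, of _ "1 - 3 * i"] ord3[OF n] unit3[of i] by blast
      ultimately have nk: "n = m [^]\<^bsub>G\<^esub> (j * k)" using m by (simp add: int_pow_pow)
      have "comm_group G"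
      proof (rule powers_comm_group[OF m])
        fix g assume "g \<in> carrier G"
        then obtain a b :: int where "g = n [^]\<^bsub>G\<^esub> a \<otimes>\<^bsub>G\<^esub> m [^]\<^bsub>G\<^esub> b" using nm by blast
        then have "g = m [^]\<^bsub>G\<^esub> (j * k * a + b)" using m by (simp add: nk int_pow_pow int_pow_mult)
        then show "\<exists>i::int. g = m [^]\<^bsub>G\<^esub> i" ..
      qed
      with nonab show False ..
    qed
    then interpret K: comm_group "G\<lparr>carrier := K\<rparr>" using proper[OF K] n by blast
    have "m = c3 n [^]\<^bsub>G\<^esub> (0::int) \<otimes>\<^bsub>G\<^esub> m [^]\<^bsub>G\<^esub> (1::int)"
      "c3 n = c3 n [^]\<^bsub>G\<^esub> (1::int) \<otimes>\<^bsub>G\<^esub> m [^]\<^bsub>G\<^esub> (0::int)" using n m c3(1) by auto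
    then have "m \<in> K" "c3 n \<in> K" unfolding K_def by blast+
    then show ?thesis using K.m_comm[of m "c3 n"] by simp
  qed
  obtain r :: int where r: "n \<otimes>\<^bsub>G\<^esub> m = m \<otimes>\<^bsub>G\<^esub> n [^]\<^bsub>G\<^esub> r"
  proof -
    obtain k :: int where "inv\<^bsub>G\<^esub> m \<otimes>\<^bsub>G\<^esub> n [^]\<^bsub>G\<^esub> (1::int) = n [^]\<^bsub>G\<^esub> k \<otimes>\<^bsub>G\<^esub> inv\<^bsub>G\<^esub> m"
      using norm[of "inv\<^bsub>G\<^esub> m" 1] m by auto
    then have "m \<otimes>\<^bsub>G\<^esub> (inv\<^bsub>G\<^esub> m \<otimes>\<^bsub>G\<^esub> n) \<otimes>\<^bsub>G\<^esub> m = m \<otimes>\<^bsub>G\<^esub> (n [^]\<^bsub>G\<^esub> k \<otimes>\<^bsub>G\<^esub> inv\<^bsub>G\<^esub> m) \<otimes>\<^bsub>G\<^esub> m"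
      using n by simp
    then show thesis using n m by (intro that[of k]) (simp add: m_assoc inv_cancel)
  qed
  have r_pow: "n [^]\<^bsub>G\<^esub> i \<otimes>\<^bsub>G\<^esub> m = m \<otimes>\<^bsub>G\<^esub> n [^]\<^bsub>G\<^esub> (r * i)" for i :: int
    using int_pow_intertwine[OF r] n m by (simp add: int_pow_pow)
  have "n [^]\<^bsub>G\<^esub> (3::int) = n [^]\<^bsub>G\<^esub> (r * 3)"
    using r_pow[of 3] n3 n m by (simp add: c3_def)
  then have n1: "n [^]\<^bsub>G\<^esub> (r * 3 - 3) = \<one>\<^bsub>G\<^esub>" using n by (simp add: int_pow_diff)
  have "n [^]\<^bsub>G\<^esub> (1::int) \<otimes>\<^bsub>G\<^esub> m \<otimes>\<^bsub>G\<^esub> m \<otimes>\<^bsub>G\<^esub> m = m \<otimes>\<^bsub>G\<^esub> (m \<otimes>\<^bsub>G\<^esub> (m \<otimes>\<^bsub>G\<^esub> n [^]\<^bsub>G\<^esub> (r * (r * r))))"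
    using n m by (simp only: r_pow m_assoc m_closed int_pow_closed mult_1_right)
  moreover have "c3 m = m \<otimes>\<^bsub>G\<^esub> (m \<otimes>\<^bsub>G\<^esub> m)"
    using m int_pow_mult[of m 1 2] int_pow_mult[of m 1 1] by (simp add: c3_def)
  ultimately have "c3 m \<otimes>\<^bsub>G\<^esub> n = c3 m \<otimes>\<^bsub>G\<^esub> n [^]\<^bsub>G\<^esub> (r * (r * r))"
    using n m m3 by (simp add: m_assoc)
  then have "n [^]\<^bsub>G\<^esub> (1::int) = n [^]\<^bsub>G\<^esub> (r * (r * r))" using n m c3(1)[OF m] by simp
  then have "n [^]\<^bsub>G\<^esub> (r * (r * r) - 1) = \<one>\<^bsub>G\<^esub>" using n by (simp add: int_pow_diff)
  moreover obtain e where e: "ord n = 3 ^ e" using ord3[OF n] by blast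
  ultimately have "3 ^ e dvd r * (r * r) - 1" using int_pow_eq_id[OF n] by simp
  moreover have "e \<noteq> 0"
  proof
    assume "e = 0"
    then have "n = \<one>\<^bsub>G\<^esub>" using e n ord_eq_1 by simp
    then have "comm_group G" using nm m by (intro powers_comm_group[OF m]) (metis int_pow_closed int_pow_one l_one)
    with nonab show False ..
  qed
  \<comment> \<open>The order of \<open>n\<close> is a nontrivial power of 3, so the congruence
    descends to modulus 3, where r^3 and r agree by Fermat.\<close>
  ultimately have "3 dvd r * (r * r) - 1" 
    by (meson dvd_power dvd_trans neq0_conv)
  moreover have "3 dvd r * (r * r) - r"
  proof -
    have "3 dvd r \<or> 3 dvd r - 1 \<or> 3 dvd r + 1" by presburger
    then have "3 dvd r * ((r - 1) * (r + 1))" by auto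
    then show ?thesis by (simp add: algebra_simps)
  qed
  ultimately have "3 dvd (r * (r * r) - 1) - (r * (r * r) - r)" by (rule dvd_diff)
  then have "3 dvd r - 1" by simp
  then obtain q where q: "r = 3 * q + 1" by (metis add.commute diff_add_cancel dvdE)
  \<comment> \<open>This is n^(r-1), the commutator n^-1 m^-1 n m.\<close>
  define D where "D = n [^]\<^bsub>G\<^esub> (3 * q)"
  have D: "D \<in> carrier G" using n by (simp add: D_def)
  have D_pow: "D [^]\<^bsub>G\<^esub> s = c3 n [^]\<^bsub>G\<^esub> (q * s)" "D [^]\<^bsub>G\<^esub> s = (n [^]\<^bsub>G\<^esub> (q * s)) [^]\<^bsub>G\<^esub> (3::nat)"
    "(D [^]\<^bsub>G\<^esub> s) [^]\<^bsub>G\<^esub> (3::nat) = \<one>\<^bsub>G\<^esub>" for s :: int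
  proof -
    show "D [^]\<^bsub>G\<^esub> s = c3 n [^]\<^bsub>G\<^esub> (q * s)" using n by (simp add: D_def c3 int_pow_pow mult.assoc)
    show "D [^]\<^bsub>G\<^esub> s = (n [^]\<^bsub>G\<^esub> (q * s)) [^]\<^bsub>G\<^esub> (3::nat)"
      using n by (simp add: D_def int_pow_pow ac_simps flip: int_pow_int)
    have "(D [^]\<^bsub>G\<^esub> s) [^]\<^bsub>G\<^esub> (3::nat) = (n [^]\<^bsub>G\<^esub> (r * 3 - 3)) [^]\<^bsub>G\<^esub> s"
      using n by (simp add: D_def q int_pow_pow algebra_simps flip: int_pow_int)
    then show "(D [^]\<^bsub>G\<^esub> s) [^]\<^bsub>G\<^esub> (3::nat) = \<one>\<^bsub>G\<^esub>" by (simp add: n1)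
  qed
  have central: "D [^]\<^bsub>G\<^esub> s \<otimes>\<^bsub>G\<^esub> g = g \<otimes>\<^bsub>G\<^esub> D [^]\<^bsub>G\<^esub> s" if g: "g \<in> carrier G" for g and s :: int
  proof -
    obtain i j :: int where ij: "g = n [^]\<^bsub>G\<^esub> i \<otimes>\<^bsub>G\<^esub> m [^]\<^bsub>G\<^esub> j" using nm g by blast
    have "n [^]\<^bsub>G\<^esub> i \<otimes>\<^bsub>G\<^esub> c3 n = c3 n \<otimes>\<^bsub>G\<^esub> n [^]\<^bsub>G\<^esub> i"
      using n by (simp add: c3_def add.commute flip: int_pow_mult)
    moreover have "m [^]\<^bsub>G\<^esub> j \<otimes>\<^bsub>G\<^esub> c3 n = c3 n \<otimes>\<^bsub>G\<^esub> m [^]\<^bsub>G\<^esub> j"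
      by (rule int_pow_commutes) (use n m n3 c3 in simp_all)
    ultimately have "c3 n \<otimes>\<^bsub>G\<^esub> g = g \<otimes>\<^bsub>G\<^esub> c3 n"
      unfolding ij using n m c3(1)[OF n] by (metis int_pow_closed m_assoc)
    then show ?thesis unfolding D_pow(1) by (rule int_pow_commutes) (use n g c3 in simp_all)
  qed
  have mn: "m [^]\<^bsub>G\<^esub> j \<otimes>\<^bsub>G\<^esub> n [^]\<^bsub>G\<^esub> i = n [^]\<^bsub>G\<^esub> i \<otimes>\<^bsub>G\<^esub> m [^]\<^bsub>G\<^esub> j \<otimes>\<^bsub>G\<^esub> D [^]\<^bsub>G\<^esub> (- (i * j))" for i j :: int
  proof -
    have "n [^]\<^bsub>G\<^esub> i \<otimes>\<^bsub>G\<^esub> m = m \<otimes>\<^bsub>G\<^esub> (n [^]\<^bsub>G\<^esub> i \<otimes>\<^bsub>G\<^esub> D [^]\<^bsub>G\<^esub> i)"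
      using r_pow[of i] n by (simp add: q D_def int_pow_pow distrib_right add.commute flip: int_pow_mult)
    then have "n [^]\<^bsub>G\<^esub> i \<otimes>\<^bsub>G\<^esub> m \<otimes>\<^bsub>G\<^esub> D [^]\<^bsub>G\<^esub> (- i) = m \<otimes>\<^bsub>G\<^esub> n [^]\<^bsub>G\<^esub> i"
      using n m D by (simp add: m_assoc int_pow_neg)
    then have "m \<otimes>\<^bsub>G\<^esub> n [^]\<^bsub>G\<^esub> i = n [^]\<^bsub>G\<^esub> i \<otimes>\<^bsub>G\<^esub> (m \<otimes>\<^bsub>G\<^esub> D [^]\<^bsub>G\<^esub> (- i))"
      using n m D by (simp add: m_assoc)
    then have "m [^]\<^bsub>G\<^esub> j \<otimes>\<^bsub>G\<^esub> n [^]\<^bsub>G\<^esub> i = n [^]\<^bsub>G\<^esub> i \<otimes>\<^bsub>G\<^esub> (m \<otimes>\<^bsub>G\<^esub> D [^]\<^bsub>G\<^esub> (- i)) [^]\<^bsub>G\<^esub> j"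
      by (rule int_pow_intertwine) (use n m D in simp_all)
    also have "(m \<otimes>\<^bsub>G\<^esub> D [^]\<^bsub>G\<^esub> (- i)) [^]\<^bsub>G\<^esub> j = m [^]\<^bsub>G\<^esub> j \<otimes>\<^bsub>G\<^esub> (D [^]\<^bsub>G\<^esub> (- i)) [^]\<^bsub>G\<^esub> j"
      by (rule int_pow_mult_distrib) (use n m D central[OF m] in simp_all)
    finally show ?thesis using n m D by (simp add: int_pow_pow m_assoc)
  qed
  show ?thesis
  proof
    fix g h assume "g \<in> carrier G" "h \<in> carrier G"
    then obtain i j k l :: int where gh: "g = n [^]\<^bsub>G\<^esub> i \<otimes>\<^bsub>G\<^esub> m [^]\<^bsub>G\<^esub> j" "h = n [^]\<^bsub>G\<^esub> k \<otimes>\<^bsub>G\<^esub> m [^]\<^bsub>G\<^esub> l"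
      using nm by blast
    have prod: "n [^]\<^bsub>G\<^esub> i \<otimes>\<^bsub>G\<^esub> m [^]\<^bsub>G\<^esub> j \<otimes>\<^bsub>G\<^esub> (n [^]\<^bsub>G\<^esub> k \<otimes>\<^bsub>G\<^esub> m [^]\<^bsub>G\<^esub> l)
        = n [^]\<^bsub>G\<^esub> (i + k) \<otimes>\<^bsub>G\<^esub> m [^]\<^bsub>G\<^esub> (j + l) \<otimes>\<^bsub>G\<^esub> D [^]\<^bsub>G\<^esub> (- (k * j))" for i j k l :: int
    proof -
      have "n [^]\<^bsub>G\<^esub> i \<otimes>\<^bsub>G\<^esub> m [^]\<^bsub>G\<^esub> j \<otimes>\<^bsub>G\<^esub> (n [^]\<^bsub>G\<^esub> k \<otimes>\<^bsub>G\<^esub> m [^]\<^bsub>G\<^esub> l)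
        = n [^]\<^bsub>G\<^esub> i \<otimes>\<^bsub>G\<^esub> (m [^]\<^bsub>G\<^esub> j \<otimes>\<^bsub>G\<^esub> n [^]\<^bsub>G\<^esub> k) \<otimes>\<^bsub>G\<^esub> m [^]\<^bsub>G\<^esub> l" using n m by (simp add: m_assoc)
      also have "\<dots> = n [^]\<^bsub>G\<^esub> (i + k) \<otimes>\<^bsub>G\<^esub> m [^]\<^bsub>G\<^esub> j \<otimes>\<^bsub>G\<^esub> (D [^]\<^bsub>G\<^esub> (- (k * j)) \<otimes>\<^bsub>G\<^esub> m [^]\<^bsub>G\<^esub> l)"
        unfolding mn using n m D by (simp add: m_assoc int_pow_mult)
      also have "\<dots> = n [^]\<^bsub>G\<^esub> (i + k) \<otimes>\<^bsub>G\<^esub> m [^]\<^bsub>G\<^esub> (j + l) \<otimes>\<^bsub>G\<^esub> D [^]\<^bsub>G\<^esub> (- (k * j))"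
        using n m D central[of "m [^]\<^bsub>G\<^esub> l"] by (simp add: m_assoc int_pow_mult)
      finally show ?thesis .
    qed
    \<comment> \<open>Up to sign the determinant of the exponents of \<open>g\<close> and
      \<open>h\<close>. The witness below is n^(q s), whose cube is D^s.\<close>
    define s where "s = k * j - i * l"
    have "h \<otimes>\<^bsub>G\<^esub> g = g \<otimes>\<^bsub>G\<^esub> h \<otimes>\<^bsub>G\<^esub> D [^]\<^bsub>G\<^esub> s"
      unfolding gh prod using n m D
      by (simp add: m_assoc s_def add.commute[of k] add.commute[of l] flip: int_pow_mult)
    then show "\<exists>u\<in>carrier G. h \<otimes>\<^bsub>G\<^esub> g = g \<otimes>\<^bsub>G\<^esub> h \<otimes>\<^bsub>G\<^esub> u [^]\<^bsub>G\<^esub> (3::nat) \<and>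
        (u [^]\<^bsub>G\<^esub> (3::nat)) [^]\<^bsub>G\<^esub> (3::nat) = \<one>\<^bsub>G\<^esub> \<and>
        (\<forall>k\<in>carrier G. u [^]\<^bsub>G\<^esub> (3::nat) \<otimes>\<^bsub>G\<^esub> k = k \<otimes>\<^bsub>G\<^esub> u [^]\<^bsub>G\<^esub> (3::nat))"
      using n D_pow(3)[of s] central[of _ s]
      by (intro bexI[of _ "n [^]\<^bsub>G\<^esub> (q * s)"]) (simp_all flip: D_pow(2))
  qed
qed

section \<open>Normalizers of p-subgroups\<close>

text \<open>The class equation: the indicator function \<open>f\<close> of the moved points sums to
  0 over an orbit of length 1 and otherwise to the orbit length, a nontrivial power of
  \<open>p\<close>. So \<open>p\<close> divides the number of moved points.\<close>

lemma (in group_action) prime_dvd_fixed_points: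
  assumes p: "prime p" and ord: "order G = p ^ n" and fin: "finite E" and dvd: "p dvd card E"
  shows "p dvd card {x \<in> E. \<forall>g\<in>carrier G. \<phi> g x = x}" (is "p dvd card ?F")
proof -
  interpret group G using group_hom group_hom.axioms(1) by blast
  define f :: "_ \<Rightarrow> nat" where "f x = (if x \<in> ?F then 0 else 1)" for x
  have "p dvd (\<Sum>x\<in>orb. f x)" if orb_mem: "orb \<in> orbits G E \<phi>" for orb
  proof -
    obtain x where x: "x \<in> E" and orb: "orb = Group_Action.orbit G \<phi> x" using orb_mem unfolding Group_Action.orbits_def by blast
    show ?thesis
    proof (cases "x \<in> ?F")
      case True
      then have "orb = {x}" unfolding orb Group_Action.orbit_def
        using one_closed by (auto intro!: exI[of _ \<one>])
      then show ?thesis using True by (simp add: f_def)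
    next
      case False
      have "f y = 1" if y_mem: "y \<in> orb" for y
      proof -
        obtain g where g: "g \<in> carrier G" "y = \<phi> g x" 
          using y_mem unfolding orb Group_Action.orbit_def by blast
        have "y \<notin> ?F"
        proof
          assume y: "y \<in> ?F"
          have "\<phi> (inv g) y = x" using orbit_sym_aux[OF g(1) x] g(2) by simp
          then have "y = x" using y g(1) by force
          with y False show False by simp
        qed
        then show ?thesis by (simp only: f_def if_False)
      qed
      then have sum: "(\<Sum>y\<in>orb. f y) = card orb" by simp
      have "card orb dvd p ^ n"
        using orbit_stabilizer_theorem[OF x] ord unfolding orb by (metis dvd_triv_left)
      then obtain k where k: "card orb = p ^ k" using divides_primepow_nat[OF p] by blast
      obtain g where g: "g \<in> carrier G" "\<phi> g x \<noteq> x" using False x by blast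
      have "card orb \<noteq> 1"
      proof
        assume "card orb = 1"
        then obtain z where "orb = {z}" by (rule card_1_singletonE)
        moreover have "x \<in> orb" "\<phi> g x \<in> orb" using orbit_refl[OF x] g(1) by (auto simp: orb Group_Action.orbit_def)
        ultimately show False using g(2) by simp
      qed
      then have "k \<noteq> 0" using k by (metis power_0)
      then show ?thesis unfolding sum k by (simp add: dvd_power)
    qed
  qed
  then have "p dvd (\<Sum>orb\<in>orbits G E \<phi>. \<Sum>x\<in>orb. f x)" by (rule dvd_sum)
  then have "p dvd (\<Sum>x\<in>E. f x)" using disjoint_sum[OF fin, of f] by (simp only:)
  moreover have "(\<Sum>x\<in>E. f x) = card (E - ?F)"
  proof -
    have "(\<Sum>x\<in>E. f x) = (\<Sum>x\<in>E - ?F. 1)"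
      by (rule sum.mono_neutral_cong_right) (use fin in \<open>auto simp: f_def\<close>)
    then show ?thesis by simp
  qed
  moreover have "card E = card ?F + card (E - ?F)"
    using fin card_Diff_subset[of ?F E] card_mono[of E ?F] by simp
  ultimately show ?thesis using dvd dvd_add_left_iff[of p "card (E - ?F)" "card ?F"] by (simp only:)
qed

text \<open>The inverse turns right multiplication into a left action, the convention of
  \<open>group_action\<close>.\<close>

lemma (in group) r_coset_right_action:
  assumes K: "subgroup K G" and A: "subgroup A G"
  shows "group_action (G\<lparr>carrier := A\<rparr>) (rcosets K) (\<lambda>k. \<lambda>C\<in>rcosets K. C #> inv k)"
proof -
  interpret A: group "G\<lparr>carrier := A\<rparr>" by (rule subgroup.subgroup_is_group[OF A is_group])
  have Ac: "a \<in> carrier G" if "a \<in> A" for a using that subgroup.subset[OF A] by blast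
  have Ksub: "K \<subseteq> carrier G" by (rule subgroup.subset[OF K])
  have clos: "C #> g \<in> rcosets K" if "C \<in> rcosets K" "g \<in> carrier G" for C g
    using that Ksub by (auto simp: RCOSETS_def coset_mult_assoc)
  have Csub: "C \<subseteq> carrier G" if "C \<in> rcosets K" for C
    using that r_coset_subset_G[OF Ksub] by (auto simp: RCOSETS_def)
  have bij: "(\<lambda>C\<in>rcosets K. C #> g) \<in> Bij (rcosets K)" if g: "g \<in> carrier G" for g
  proof -
    have "bij_betw (\<lambda>C. C #> g) (rcosets K) (rcosets K)"
      by (rule bij_betwI[where g = "\<lambda>C. C #> inv g"])
        (use g clos Csub in \<open>auto simp: coset_mult_assoc\<close>)
    then show ?thesis by (auto simp: Bij_def cong: bij_betw_cong)
  qed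
  have "group_hom (G\<lparr>carrier := A\<rparr>) (BijGroup (rcosets K)) (\<lambda>k. \<lambda>C\<in>rcosets K. C #> inv k)"
  proof (intro group_hom.intro A.is_group group_BijGroup group_hom_axioms.intro homI)
    fix a b assume ab: "a \<in> carrier (G\<lparr>carrier := A\<rparr>)" "b \<in> carrier (G\<lparr>carrier := A\<rparr>)"
    then have cl: "a \<in> carrier G" "b \<in> carrier G" using Ac by auto
    show "(\<lambda>C\<in>rcosets K. C #> inv (a \<otimes>\<^bsub>G\<lparr>carrier := A\<rparr>\<^esub> b))
        = (\<lambda>C\<in>rcosets K. C #> inv a) \<otimes>\<^bsub>BijGroup (rcosets K)\<^esub> (\<lambda>C\<in>rcosets K. C #> inv b)"
    proof (rule ext)
      fix C
      show "(\<lambda>C\<in>rcosets K. C #> inv (a \<otimes>\<^bsub>G\<lparr>carrier := A\<rparr>\<^esub> b)) C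
        = ((\<lambda>C\<in>rcosets K. C #> inv a) \<otimes>\<^bsub>BijGroup (rcosets K)\<^esub> (\<lambda>C\<in>rcosets K. C #> inv b)) C"
        using cl bij clos[of C "inv b"] Csub[of C]
        by (cases "C \<in> rcosets K") (simp_all add: BijGroup_def compose_def inv_mult_group coset_mult_assoc)
    qed
  qed (use bij Ac in \<open>auto simp: BijGroup_def\<close>)
  then show ?thesis by (rule group_action.intro)
qed

text \<open>The condition asks only for one inclusion between \<open>K\<close> and its conjugate.
  Closure under inverses comes from finiteness, the inverse of \<open>g\<close> being a nonnegative
  power of \<open>g\<close>.\<close>

lemma (in group) normalizing_set_subgroup:
  assumes K: "subgroup K G" and fin: "finite (carrier G)"
  shows "subgroup {g \<in> carrier G. \<forall>k\<in>K. g \<otimes> k \<otimes> inv g \<in> K} G" (is "subgroup ?N G")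
proof -
  have Kc: "k \<in> carrier G" if "k \<in> K" for k using that subgroup.subset[OF K] by blast
  have mult: "g \<otimes> h \<in> ?N" if "g \<in> ?N" "h \<in> ?N" for g h
  proof -
    have "g \<otimes> h \<otimes> k \<otimes> inv (g \<otimes> h) = g \<otimes> (h \<otimes> k \<otimes> inv h) \<otimes> inv g" if "k \<in> K" for k
      using \<open>g \<in> ?N\<close> \<open>h \<in> ?N\<close> Kc[OF that] by (simp add: inv_mult_group m_assoc)
    then show ?thesis using that by auto
  qed
  have one: "\<one> \<in> ?N" using Kc by simp
  show ?thesis
  proof (rule subgroup.intro)
    fix g assume g: "g \<in> ?N"
    then have gc: "g \<in> carrier G" by simp
    have pow: "g [^] i \<in> ?N" for i :: nat
      by (induction i) (use mult[OF _ g] one in simp_all)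
    have "inv g = g [^] (ord g - 1)"
      using gc fin ord_ge_1[OF fin gc] nat_pow_Suc[of g "ord g - 1"] by (intro inv_equality) simp_all
    with pow show "inv g \<in> ?N" by simp
  qed (use mult one in auto)
qed

lemma (in group) r_coset_eq_iff:
  assumes K: "subgroup K G" and a: "a \<in> carrier G" and b: "b \<in> carrier G"
  shows "K #> a = K #> b \<longleftrightarrow> a \<otimes> inv b \<in> K"
proof
  assume "K #> a = K #> b"
  then have "a \<in> K #> b" using rcos_self[OF a K] by simp
  then obtain h where "h \<in> K" "a = h \<otimes> b" unfolding r_coset_def by blast
  then show "a \<otimes> inv b \<in> K" using b subgroup.mem_carrier[OF K] by (simp add: m_assoc)
next
  assume "a \<otimes> inv b \<in> K"
  moreover have "a = a \<otimes> inv b \<otimes> b" using a b by (simp add: m_assoc)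
  ultimately have "a \<in> K #> b" unfolding r_coset_def by blast
  then show "K #> a = K #> b" using repr_independence[OF _ b K] by simp
qed

text \<open>The fixed points of the \<open>p\<close>-group \<open>K\<close> on its own right cosets are the cosets in the normalizer.\<close>

lemma (in group) exists_normalizing_element:
  assumes p: "prime p" and K: "subgroup K G" and fin: "finite (carrier G)"
    and cardK: "card K = p ^ n" and dvd: "p ^ Suc n dvd order G"
  shows "\<exists>g\<in>carrier G. g \<notin> K \<and> g [^] p \<in> K \<and> (\<forall>k\<in>K. g \<otimes> k \<otimes> inv g \<in> K)"
proof -
  define N where "N = {g \<in> carrier G. \<forall>k\<in>K. g \<otimes> k \<otimes> inv g \<in> K}"
  have N: "subgroup N G" unfolding N_def by (rule normalizing_set_subgroup[OF K fin])
  interpret NG: group "G\<lparr>carrier := N\<rparr>" by (rule subgroup.subgroup_is_group[OF N is_group])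
  have Kc: "k \<in> carrier G" if "k \<in> K" for k using that subgroup.subset[OF K] by blast
  have "K \<subseteq> N" using Kc K by (auto simp: N_def subgroup.m_closed subgroup.m_inv_closed)
  then have KN: "subgroup K (G\<lparr>carrier := N\<rparr>)" by (intro subgroup_incl K N)
  interpret act: group_action "G\<lparr>carrier := K\<rparr>" "rcosets K" "\<lambda>k. \<lambda>C\<in>rcosets K. C #> inv k"
    by (rule r_coset_right_action[OF K K])
  have "card (rcosets K) * p ^ n = order G" using lagrange[OF K] cardK by simp
  then have "p * p ^ n dvd card (rcosets K) * p ^ n" using dvd by simp
  then have "p dvd card (rcosets K)" using p by (simp add: prime_gt_0_nat)
  moreover have "finite (rcosets K)" using fin by (simp add: RCOSETS_def)
  ultimately have "p dvd card {C \<in> rcosets K. \<forall>k\<in>carrier (G\<lparr>carrier := K\<rparr>). (\<lambda>C\<in>rcosets K. C #> inv k) C = C}"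
    using act.prime_dvd_fixed_points[OF p, of n] cardK by (simp add: order_def)
  moreover have "{C \<in> rcosets K. \<forall>k\<in>carrier (G\<lparr>carrier := K\<rparr>). (\<lambda>C\<in>rcosets K. C #> inv k) C = C}
      = rcosets\<^bsub>G\<lparr>carrier := N\<rparr>\<^esub> K" (is "?F = _")
  proof -
    have fix_iff: "K #> g #> inv k = K #> g \<longleftrightarrow> g \<otimes> inv k \<otimes> inv g \<in> K"
      if g: "g \<in> carrier G" and k: "k \<in> K" for g k
      using g Kc[OF k] subgroup.subset[OF K] by (simp add: coset_mult_assoc r_coset_eq_iff[OF K])
    have *: "(\<forall>k\<in>K. K #> g #> inv k = K #> g) \<longleftrightarrow> g \<in> N" if g: "g \<in> carrier G" for g
    proof -
      have "(\<forall>k\<in>K. K #> g #> inv k = K #> g) \<longleftrightarrow> (\<forall>k\<in>K. g \<otimes> inv k \<otimes> inv g \<in> K)"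
        using fix_iff[OF g] by blast
      also have "\<dots> \<longleftrightarrow> (\<forall>k\<in>(\<lambda>k. inv k) ` K. g \<otimes> k \<otimes> inv g \<in> K)" by blast
      also have "(\<lambda>k. inv k) ` K = K"
        using subgroup.m_inv_closed[OF K] Kc by (force intro: image_eqI[of _ _ "inv _"])
      finally show ?thesis using g by (simp add: N_def)
    qed
    have "?F = {C \<in> rcosets K. \<forall>k\<in>K. C #> inv k = C}" by auto
    also have "\<dots> = (\<Union>g\<in>N. {K #> g})"
    proof -
      have "\<And>g. g \<in> N \<Longrightarrow> g \<in> carrier G" by (simp add: N_def)
      then show ?thesis unfolding RCOSETS_def using * by blast
    qed
    also have "\<dots> = rcosets\<^bsub>G\<lparr>carrier := N\<rparr>\<^esub> K" by (simp add: RCOSETS_def r_coset_def)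
    finally show ?thesis .
  qed
  ultimately have "p dvd card (rcosets\<^bsub>G\<lparr>carrier := N\<rparr>\<^esub> K)" by simp
  then have "p * p ^ n dvd card (rcosets\<^bsub>G\<lparr>carrier := N\<rparr>\<^esub> K) * card K"
    unfolding cardK by (rule mult_dvd_mono) simp
  then have "p ^ Suc n dvd order (G\<lparr>carrier := N\<rparr>)" using NG.lagrange[OF KN] by simp
  then obtain l where "order (G\<lparr>carrier := N\<rparr>) = p ^ Suc n * l" by blast
  moreover have "finite (carrier (G\<lparr>carrier := N\<rparr>))" using fin by (simp add: N_def)
  \<comment> \<open>Since \<open>p\<close> divides the index of \<open>K\<close> in
    \<open>N\<close>, Sylow's theorem yields a \<open>p\<close>-subgroup of \<open>N\<close> larger
    than \<open>K\<close>, and with it an element of \<open>p\<close>-power order outside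
    \<open>K\<close>.\<close>
  ultimately obtain P where P: "subgroup P (G\<lparr>carrier := N\<rparr>)" "card P = p ^ Suc n"
    using sylow_thm[OF p NG.is_group] by blast
  have PN: "P \<subseteq> N" using subgroup.subset[OF P(1)] by simp
  interpret PG: group "G\<lparr>carrier := P\<rparr>"
    using subgroup.subgroup_is_group[OF P(1) NG.is_group] by simp
  have "\<not> P \<subseteq> K"
    using P(2) cardK card_mono[of K P] finite_subset[OF subgroup.subset[OF K] fin] prime_gt_1_nat[OF p]
    by auto
  then obtain g where g: "g \<in> P" "g \<notin> K" by blast
  have gN: "g \<in> N" and gc: "g \<in> carrier G" using g PN by (auto simp: N_def)
  have gp: "g [^] (p ^ Suc n) = \<one>"
    using PG.pow_order_eq_1[of g] g(1) nat_pow_consistent[of g] P(2) by (simp add: order_def)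
  \<comment> \<open>The exponent just before the iterated \<open>p\<close>-th powers of
    \<open>g\<close> enter \<open>K\<close> gives the element sought: it lies outside
    \<open>K\<close>, its \<open>p\<close>-th power inside.\<close>
  define j where "j = (LEAST i. g [^] (p ^ i) \<in> K)"
  have "g [^] (p ^ j) \<in> K"
    unfolding j_def by (rule LeastI[of _ "Suc n"]) (use gp subgroup.one_closed[OF K] in simp)
  moreover have "j \<noteq> 0" using calculation g(2) gc by (intro notI) simp
  then obtain i where i: "j = Suc i" by (cases j) auto
  moreover have "g [^] (p ^ i) \<notin> K" using not_less_Least[of i "\<lambda>i. g [^] (p ^ i) \<in> K"] i by (simp add: j_def)
  moreover have "g [^] (p ^ i) \<in> N"
  proof -
    have "g [^] k \<in> N" for k :: nat
      by (induction k) (use gN subgroup.one_closed[OF N] subgroup.m_closed[OF N] in auto)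
    then show ?thesis .
  qed
  ultimately show ?thesis
    using gc by (intro bexI[of _ "g [^] (p ^ i)"]) (auto simp: N_def nat_pow_pow mult.commute)
qed

section \<open>Automorphisms of cubic graphs\<close>

locale automorphism_action =
  fixes G :: "'v pair_pre_digraph"
  assumes pg: "pair_graph G"
begin

abbreviation A where "A \<equiv> graph_AutoGroup G"

sublocale A: group A
  by (rule group_graph_AutoGroup)

lemma finite_verts: "finite (pverts G)"
  and finite_arcs: "finite (parcs G)"
  and arc_verts: "(u, v) \<in> parcs G \<Longrightarrow> u \<in> pverts G" "(u, v) \<in> parcs G \<Longrightarrow> v \<in> pverts G"
  and arc_irrefl: "(u, v) \<in> parcs G \<Longrightarrow> u \<noteq> v"
  and arc_sym: "(u, v) \<in> parcs G \<Longrightarrow> (v, u) \<in> parcs G"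
proof -
  interpret pair_graph G by (rule pg)
  show "finite (pverts G)" "finite (parcs G)" by (rule pair_finite_verts pair_finite_arcs)+
  show "(u, v) \<in> parcs G \<Longrightarrow> u \<in> pverts G" "(u, v) \<in> parcs G \<Longrightarrow> v \<in> pverts G"
    by (rule in_arcsD1 in_arcsD2; assumption)+
  show "(u, v) \<in> parcs G \<Longrightarrow> u \<noteq> v" by (rule no_loops')
  show "(u, v) \<in> parcs G \<Longrightarrow> (v, u) \<in> parcs G"
    using pair_sym_arcs by (auto simp: symmetric_def dest: symD)
qed

lemma carrier_A: "carrier A = graph_auto G"
  by (simp add: graph_AutoGroup_def)

lemma auto_Bij: "f \<in> carrier A \<Longrightarrow> f \<in> Bij (pverts G)"
  by (simp add: carrier_A graph_auto_def)

lemma auto_closed: "f \<in> carrier A \<Longrightarrow> v \<in> pverts G \<Longrightarrow> f v \<in> pverts G"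
  using auto_Bij Bij_imp_funcset by fast

lemma auto_mult: "f \<in> carrier A \<Longrightarrow> g \<in> carrier A \<Longrightarrow> v \<in> pverts G \<Longrightarrow> (f \<otimes>\<^bsub>A\<^esub> g) v = f (g v)"
  by (simp add: graph_AutoGroup_def BijGroup_def graph_auto_def compose_eq)

lemma auto_one: "v \<in> pverts G \<Longrightarrow> \<one>\<^bsub>A\<^esub> v = v"
  by (simp add: graph_AutoGroup_def BijGroup_def)

lemma auto_inv:
  assumes "f \<in> carrier A" and "v \<in> pverts G"
  shows "(inv\<^bsub>A\<^esub> f) (f v) = v" and "f ((inv\<^bsub>A\<^esub> f) v) = v"
  using assms auto_mult[of "inv\<^bsub>A\<^esub> f" f v] auto_mult[of f "inv\<^bsub>A\<^esub> f" v] by (simp_all add: auto_one)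

lemma auto_eqI:
  assumes "f \<in> carrier A" "g \<in> carrier A" "\<And>v. v \<in> pverts G \<Longrightarrow> f v = g v"
  shows "f = g"
  using assms auto_Bij by (intro extensionalityI[of f "pverts G" g]) (auto intro: Bij_imp_extensional)

lemma auto_adj:
  "f \<in> carrier A \<Longrightarrow> u \<in> pverts G \<Longrightarrow> v \<in> pverts G \<Longrightarrow> (f u, f v) \<in> parcs G \<longleftrightarrow> (u, v) \<in> parcs G"
  by (simp add: carrier_A graph_auto_def)

lemma finite_A: "finite (carrier A)"
proof (rule finite_subset)
  show "carrier A \<subseteq> (\<Pi>\<^sub>E v\<in>pverts G. pverts G)"
    using auto_Bij by (auto simp: PiE_def dest: Bij_imp_extensional Bij_imp_funcset)
  show "finite (\<Pi>\<^sub>E v\<in>pverts G. pverts G)" using finite_verts by (intro finite_PiE) auto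
qed

text \<open>Arcs occur in both directions, so connectedness gives directed reachability, along which
  membership in \<open>W\<close> propagates.\<close>

lemma connected_closed:
  assumes "Digraph_Component.connected (with_proj G)"
    and "w \<in> W" "w \<in> pverts G"
    and "\<And>u v. u \<in> W \<Longrightarrow> (u, v) \<in> parcs G \<Longrightarrow> v \<in> W"
  shows "pverts G \<subseteq> W"
proof
  fix v assume "v \<in> pverts G"
  interpret pair_graph G by (rule pg)
  have "strongly_connected (with_proj G)"
    by (rule symmetric_connected_imp_strongly_connected[OF pair_sym_arcs assms(1)])
  then have "w \<rightarrow>\<^sup>*\<^bsub>with_proj G\<^esub> v" using assms(3) \<open>v \<in> pverts G\<close> by (auto elim: strongly_connectedE)
  then have "(w, v) \<in> (parcs G)\<^sup>*" using reachable_rtranclI by fastforce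
  then show "v \<in> W" by (induction rule: rtrancl_induct) (use assms in auto)
qed

end

section \<open>Automorphisms of order 3 fixing a vertex\<close>

locale cubic_graph = automorphism_action +
  assumes conn: "Digraph_Component.connected (with_proj G)" and cubic: "cubic G"
begin

definition nbs where "nbs v = {w. (v, w) \<in> parcs G}"

lemma nbs_sub: "nbs v \<subseteq> pverts G"
  by (auto simp: nbs_def dest: arc_verts)

lemma card_nbs: "v \<in> pverts G \<Longrightarrow> card (nbs v) = 3"
proof -
  assume "v \<in> pverts G"
  then have "card (out_arcs (with_proj G) v) = 3" using cubic by (simp add: cubic_def out_degree_def)
  moreover have "out_arcs (with_proj G) v = Pair v ` nbs v" by (auto simp: out_arcs_def nbs_def)
  ultimately show ?thesis by (simp add: card_image inj_on_def)
qed

lemma auto_nbs: "f \<in> carrier A \<Longrightarrow> v \<in> pverts G \<Longrightarrow> w \<in> nbs v \<Longrightarrow> f w \<in> nbs (f v)"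
  using auto_adj arc_verts by (auto simp: nbs_def)

text \<open>On the three neighbours of a fixed vertex \<open>f\<close> acts as the identity or as a
  3-cycle, and one fixed neighbour excludes the latter. Pointwise fixed stars then spread over the
  connected graph.\<close>

lemma fixes_edge_imp_trivial:
  assumes f: "f \<in> carrier A" and f3: "\<And>v. v \<in> pverts G \<Longrightarrow> f (f (f v)) = v"
    and uv: "(u, v) \<in> parcs G" "f u = u" "f v = v"
  shows "f = \<one>\<^bsub>A\<^esub>"
proof -
  have inj: "f a = f b \<Longrightarrow> a = b" if "a \<in> pverts G" "b \<in> pverts G" for a b
    using f3 that by metis
  \<comment> \<open>A moved neighbour \<open>b\<close> would give \<open>u\<close> the four distinct
    neighbours \<open>v\<close>, \<open>b\<close>, \<open>f b\<close>,
    \<open>f (f b)\<close>.\<close>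
  have star: "f b = b" if u: "u \<in> pverts G" "f u = u" and v: "v \<in> nbs u" "f v = v" and b: "b \<in> nbs u" for u v b
  proof (rule ccontr)
    assume nb: "f b \<noteq> b"
    have bV: "b \<in> pverts G" and vV: "v \<in> pverts G" using b v nbs_sub by auto
    have fb: "f b \<in> nbs u" "f (f b) \<in> nbs u" using auto_nbs[OF f u(1)] b u(2) by auto
    then have fbV: "f b \<in> pverts G" "f (f b) \<in> pverts G" using nbs_sub by auto
    have "f b \<noteq> v" using inj[OF bV vV] v(2) nb by auto
    moreover have "f (f b) \<noteq> v" using inj[OF fbV(1) vV] v(2) \<open>f b \<noteq> v\<close> by auto
    moreover have "f (f b) \<noteq> f b" using inj[OF fbV(1) bV] nb by auto
    moreover have "f (f b) \<noteq> b" using f3[OF bV] nb by auto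
    moreover have "b \<noteq> v" using nb v(2) by auto
    ultimately have "card {v, b, f b, f (f b)} = 4" using nb by auto
    moreover have "{v, b, f b, f (f b)} \<subseteq> nbs u" using v b fb by auto
    moreover have "finite (nbs u)" using card_nbs[OF u(1)] card.infinite by fastforce
    ultimately show False using card_mono[of "nbs u" "{v, b, f b, f (f b)}"] card_nbs[OF u(1)] by simp
  qed
  define W where "W = {u \<in> pverts G. f u = u \<and> (\<forall>v\<in>nbs u. f v = v)}"
  have "pverts G \<subseteq> W"
  proof (rule connected_closed[OF conn])
    show uV: "u \<in> pverts G" using uv(1) by (rule arc_verts)
    show "u \<in> W" using star[OF uV uv(2) _ uv(3)] uv uV by (auto simp: W_def nbs_def)
  next
    fix u v assume u: "u \<in> W" and a: "(u, v) \<in> parcs G"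
    have "v \<in> pverts G" using a by (rule arc_verts)
    moreover have "f v = v" using u a by (auto simp: W_def nbs_def)
    moreover have "u \<in> nbs v" using a arc_sym by (simp add: nbs_def)
    ultimately show "v \<in> W" using star[of v u] u by (auto simp: W_def)
  qed
  then show ?thesis by (intro auto_eqI f A.one_closed) (auto simp: W_def auto_one)
qed

text \<open>By \<open>fixes_edge_imp_trivial\<close> the neighbour \<open>v\<close> is moved, so its
  orbit under \<open>f\<close> has three elements and exhausts the neighbourhood.\<close>

lemma three_cycle_nbs:
  assumes f: "f \<in> carrier A" "f \<noteq> \<one>\<^bsub>A\<^esub>" and f3: "\<And>v. v \<in> pverts G \<Longrightarrow> f (f (f v)) = v"
    and u: "u \<in> pverts G" "f u = u" and v: "v \<in> nbs u"
  shows "nbs u = {v, f v, f (f v)}"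
proof -
  have vV: "v \<in> pverts G" using v nbs_sub by auto
  have n1: "f v \<noteq> v" using fixes_edge_imp_trivial[OF f(1) f3, of u v] f(2) u v by (auto simp: nbs_def)
  then have n2: "f (f v) \<noteq> v" using f3[OF vV] by auto
  have n3: "f (f v) \<noteq> f v" using f3[OF vV] n2 n1 by metis
  have "{v, f v, f (f v)} \<subseteq> nbs u" using v auto_nbs[OF f(1) u(1)] u(2) by auto
  moreover have "card {v, f v, f (f v)} = 3" using n1 n2 n3 by auto
  moreover have "finite (nbs u)" using card_nbs[OF u(1)] card.infinite by fastforce
  ultimately show ?thesis
    using card_subset_eq[of "nbs u" "{v, f v, f (f v)}"] card_nbs[OF u(1)] by simp
qed

end

section \<open>The number of edges and the order of the automorphism group\<close>

context cubic_graph
begin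

text \<open>\<open>e\<close> is the number of edges, obtained by counting arcs in two ways; it is
  the length of an orbit and so divides the group order. The action is on unordered pairs because
  edge-transitivity need not provide an automorphism reversing an edge.\<close>

lemma edge_transitive_order:
  assumes "edge_transitive G"
  shows "\<exists>e. 2 * e = 3 * card (pverts G) \<and> e dvd order A"
proof -
  define Ed where "Ed = (\<lambda>(u, v). {u, v}) ` parcs G"
  have "parcs G = (SIGMA v:pverts G. nbs v)" by (auto simp: nbs_def dest: arc_verts)
  then have "card (parcs G) = 3 * card (pverts G)"
    using finite_verts finite_subset[OF nbs_sub finite_verts] card_nbs by simp
  moreover have "card (parcs G) = 2 * card Ed"
  proof -
    have fib: "card {a \<in> parcs G. (\<lambda>(u, v). {u, v}) a = e} = 2" if e: "e \<in> Ed" for e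
    proof -
      obtain u v where uv: "(u, v) \<in> parcs G" "e = {u, v}" using e by (auto simp: Ed_def)
      then have "{a \<in> parcs G. (\<lambda>(u, v). {u, v}) a = e} = {(u, v), (v, u)}"
        using arc_sym by (auto simp: doubleton_eq_iff)
      moreover have "u \<noteq> v" using uv(1) by (rule arc_irrefl)
      ultimately show ?thesis by simp
    qed
    have "card (parcs G) = (\<Sum>e\<in>Ed. card {a \<in> parcs G. (\<lambda>(u, v). {u, v}) a = e})"
      using finite_arcs sum.group[of "parcs G" Ed "\<lambda>(u, v). {u, v}" "\<lambda>_. 1::nat"]
      by (simp add: Ed_def)
    then show ?thesis using fib by simp
  qed
  ultimately have "2 * card Ed = 3 * card (pverts G)" by simp
  moreover have "card Ed dvd order A"
  proof (cases "Ed = {}")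
    case True
    then have "card (pverts G) = 0" using \<open>2 * card Ed = 3 * card (pverts G)\<close> by simp
    then have "pverts G = {}" using finite_verts by simp
    moreover have "pverts G \<noteq> {}" using conn by (simp add: connected_conv)
    ultimately show ?thesis by simp
  next
    case False
    then obtain e0 where e0: "e0 \<in> Ed" by blast
    have Ed_sub: "e \<subseteq> pverts G" if "e \<in> Ed" for e
      using that by (auto simp: Ed_def dest: arc_verts)
    have act: "f ` e \<in> Ed" if f: "f \<in> carrier A" and e: "e \<in> Ed" for f e
    proof -
      obtain u v where uv: "(u, v) \<in> parcs G" "e = {u, v}" using e by (auto simp: Ed_def)
      then have "(f u, f v) \<in> parcs G" using auto_adj[OF f] by (auto dest: arc_verts)
      then have "{f u, f v} \<in> Ed" unfolding Ed_def by (rule rev_image_eqI) simp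
      then show ?thesis using uv(2) by simp
    qed
    have comp: "(f \<otimes>\<^bsub>A\<^esub> g) ` e = f ` (g ` e)" if "f \<in> carrier A" "g \<in> carrier A" "e \<in> Ed" for f g e
      unfolding image_image
      by (rule image_cong) (use auto_mult[OF that(1,2)] Ed_sub[OF that(3)] in auto)
    have one: "\<one>\<^bsub>A\<^esub> ` e = e" if "e \<in> Ed" for e
    proof -
      have "\<one>\<^bsub>A\<^esub> ` e = (\<lambda>x. x) ` e" by (rule image_cong) (use Ed_sub[OF that] auto_one in auto)
      then show ?thesis by simp
    qed
    have bij: "(\<lambda>e\<in>Ed. f ` e) \<in> Bij Ed" if f: "f \<in> carrier A" for f
    proof -
      have "bij_betw (\<lambda>e. f ` e) Ed Ed"
      proof (rule bij_betwI[where g = "\<lambda>e. (inv\<^bsub>A\<^esub> f) ` e"])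
        show "(`) f \<in> Ed \<rightarrow> Ed" "(`) (inv\<^bsub>A\<^esub> f) \<in> Ed \<rightarrow> Ed" using act f by auto
        show "(inv\<^bsub>A\<^esub> f) ` f ` e = e" "f ` (inv\<^bsub>A\<^esub> f) ` e = e" if "e \<in> Ed" for e
          using comp[of "inv\<^bsub>A\<^esub> f" f e] comp[of f "inv\<^bsub>A\<^esub> f" e] f one that by simp_all
      qed
      then show ?thesis by (auto simp: Bij_def cong: bij_betw_cong)
    qed
    have "group_hom A (BijGroup Ed) (\<lambda>f. \<lambda>e\<in>Ed. f ` e)"
    proof (intro group_hom.intro A.is_group group_BijGroup group_hom_axioms.intro homI)
      fix f g assume fg: "f \<in> carrier A" "g \<in> carrier A"
      show "(\<lambda>e\<in>Ed. (f \<otimes>\<^bsub>A\<^esub> g) ` e) = (\<lambda>e\<in>Ed. f ` e) \<otimes>\<^bsub>BijGroup Ed\<^esub> (\<lambda>e\<in>Ed. g ` e)"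
      proof (rule ext)
        fix e
        show "(\<lambda>e\<in>Ed. (f \<otimes>\<^bsub>A\<^esub> g) ` e) e = ((\<lambda>e\<in>Ed. f ` e) \<otimes>\<^bsub>BijGroup Ed\<^esub> (\<lambda>e\<in>Ed. g ` e)) e"
          using fg bij act comp by (cases "e \<in> Ed") (simp_all add: BijGroup_def compose_def)
      qed
    qed (use bij in \<open>auto simp: BijGroup_def\<close>)
    then interpret act: group_action A Ed "\<lambda>f. \<lambda>e\<in>Ed. f ` e" by (rule group_action.intro)
    have "Group_Action.orbit A (\<lambda>f. \<lambda>e\<in>Ed. f ` e) e0 = Ed"
    proof
      show "Group_Action.orbit A (\<lambda>f. \<lambda>e\<in>Ed. f ` e) e0 \<subseteq> Ed"
        using act e0 by (auto simp: Group_Action.orbit_def)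
      show "Ed \<subseteq> Group_Action.orbit A (\<lambda>f. \<lambda>e\<in>Ed. f ` e) e0"
      proof
        fix e assume "e \<in> Ed"
        then obtain u v x y where "(u, v) \<in> parcs G" "e0 = {u, v}" "(x, y) \<in> parcs G" "e = {x, y}"
          using e0 by (auto simp: Ed_def)
        then obtain f where "f \<in> graph_auto G" "f ` e0 = e"
          using assms unfolding edge_transitive_def by blast
        then show "e \<in> Group_Action.orbit A (\<lambda>f. \<lambda>e\<in>Ed. f ` e) e0"
          using e0 by (auto simp: Group_Action.orbit_def carrier_A)
      qed
    qed
    then show ?thesis using act.orbit_stabilizer_theorem[OF e0] by (metis dvd_triv_left)
  qed
  ultimately show ?thesis by blast
qed

end

section \<open>Semiregular groups with two orbits\<close>

locale semiregular_cubic = cubic_graph +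
  fixes K n
  assumes K: "subgroup K A"
    and semireg: "\<And>k v. k \<in> K \<Longrightarrow> v \<in> pverts G \<Longrightarrow> k v = v \<Longrightarrow> k = \<one>\<^bsub>A\<^esub>"
    and two_orbits: "card ((\<lambda>v. (\<lambda>k. k v) ` K) ` pverts G) = 2"
    and edge_trans: "edge_transitive G"
    and cardK: "card K = 3 ^ n"
begin

abbreviation orb where "orb v \<equiv> (\<lambda>k. k v) ` K"

lemma K_carrier: "k \<in> K \<Longrightarrow> k \<in> carrier A"
  using subgroup.mem_carrier[OF K] .

lemma K_closed: "k \<in> K \<Longrightarrow> v \<in> pverts G \<Longrightarrow> k v \<in> pverts G"
  using K_carrier auto_closed by blast

lemma K_inj:
  assumes "k \<in> K" "l \<in> K" "v \<in> pverts G" "k v = l v"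
  shows "k = l"
proof -
  have cl: "k \<in> carrier A" "l \<in> carrier A" using assms K_carrier by auto
  have "(inv\<^bsub>A\<^esub> l \<otimes>\<^bsub>A\<^esub> k) v = v"
    using cl assms auto_inv(1)[OF cl(2) assms(3)] by (simp add: auto_mult)
  moreover have "inv\<^bsub>A\<^esub> l \<otimes>\<^bsub>A\<^esub> k \<in> K"
    using assms K by (simp add: subgroup.m_closed subgroup.m_inv_closed)
  ultimately have "inv\<^bsub>A\<^esub> l \<otimes>\<^bsub>A\<^esub> k = \<one>\<^bsub>A\<^esub>" using semireg assms(3) by blast
  then have "inv\<^bsub>A\<^esub> k = inv\<^bsub>A\<^esub> l" using cl by (intro A.inv_equality) simp_all
  then have "inv\<^bsub>A\<^esub> (inv\<^bsub>A\<^esub> k) = inv\<^bsub>A\<^esub> (inv\<^bsub>A\<^esub> l)" by simp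
  then show ?thesis using cl by simp
qed

lemma orb_self: "v \<in> pverts G \<Longrightarrow> v \<in> orb v"
  using imageI[OF subgroup.one_closed[OF K], of "\<lambda>k. k v"] by (simp add: auto_one)

lemma orb_verts: "v \<in> pverts G \<Longrightarrow> orb v \<subseteq> pverts G"
  using K_closed by auto

lemma orb_step: "k \<in> K \<Longrightarrow> v \<in> pverts G \<Longrightarrow> w \<in> orb v \<Longrightarrow> k w \<in> orb v"
proof -
  assume k: "k \<in> K" and v: "v \<in> pverts G" and "w \<in> orb v"
  then obtain l where l: "l \<in> K" "w = l v" by blast
  have "k w = (k \<otimes>\<^bsub>A\<^esub> l) v" using k l v K_carrier by (simp add: auto_mult)
  then show ?thesis using subgroup.m_closed[OF K k l(1)] by blast
qed

lemma orb_eq: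
  assumes v: "v \<in> pverts G" and w: "w \<in> orb v"
  shows "orb w = orb v"
proof
  show "orb w \<subseteq> orb v" using orb_step[OF _ v w] by blast
  obtain k where k: "k \<in> K" "w = k v" using w by blast
  have "v = (inv\<^bsub>A\<^esub> k) w" using auto_inv(1)[OF K_carrier[OF k(1)] v] k(2) by simp
  then have vw: "v \<in> orb w" using subgroup.m_inv_closed[OF K k(1)] by blast
  have "w \<in> pverts G" using w orb_verts[OF v] by blast
  then show "orb v \<subseteq> orb w" using orb_step[OF _ _ vw] by blast
qed

lemma orb_cover:
  assumes v: "v \<in> pverts G" and w: "w \<in> pverts G" "w \<notin> orb v"
  shows "pverts G = orb v \<union> orb w" and "orb v \<inter> orb w = {}"
proof -
  have ne: "orb v \<noteq> orb w" using orb_self[OF w(1)] w(2) by auto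
  obtain P Q where PQ: "orb ` pverts G = {P, Q}" using two_orbits by (auto simp: card_2_iff)
  have vw: "orb v \<in> {P, Q}" "orb w \<in> {P, Q}" using v w(1) unfolding PQ[symmetric] by blast+
  have "X \<in> {P, Q} \<Longrightarrow> Y \<in> {P, Q} \<Longrightarrow> X \<noteq> Y \<Longrightarrow> {P, Q} = {X, Y}" for X Y by auto
  from this[OF vw ne] have PQ': "orb ` pverts G = {orb v, orb w}" unfolding PQ .
  show "pverts G = orb v \<union> orb w"
  proof
    show "pverts G \<subseteq> orb v \<union> orb w"
    proof
      fix u assume u: "u \<in> pverts G"
      then have "orb u \<in> {orb v, orb w}" unfolding PQ'[symmetric] by blast
      then show "u \<in> orb v \<union> orb w" using orb_self[OF u] by blast
    qed
  qed (use orb_verts v w(1) in blast)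
  show "orb v \<inter> orb w = {}"
  proof (rule ccontr)
    assume "orb v \<inter> orb w \<noteq> {}"
    then obtain u where "u \<in> orb v" "u \<in> orb w" by blast
    then have "orb u = orb v" "orb u = orb w" using orb_eq[OF v] orb_eq[OF w(1)] by blast+
    with ne show False by simp
  qed
qed

lemma exists_other_orb:
  assumes "v \<in> pverts G"
  shows "\<exists>w\<in>pverts G. w \<notin> orb v"
proof (rule ccontr)
  assume "\<not> ?thesis"
  then have "orb ` pverts G = {orb v}" using orb_eq[OF assms] assms by blast
  then show False using two_orbits by simp
qed

lemma card_orb: "v \<in> pverts G \<Longrightarrow> card (orb v) = card K"
  by (rule card_image) (auto simp: inj_on_def dest: K_inj)

lemma verts_nonempty: "pverts G \<noteq> {}"
  using two_orbits by auto

lemma card_verts: "card (pverts G) = 2 * card K"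
proof -
  obtain v where v: "v \<in> pverts G" using verts_nonempty by blast
  obtain w where w: "w \<in> pverts G" "w \<notin> orb v" using exists_other_orb[OF v] by blast
  have "finite (orb v)" "finite (orb w)" using orb_verts v w(1) finite_verts finite_subset by blast+
  then show ?thesis
    using orb_cover[OF v w] card_Un_disjoint[of "orb v" "orb w"] card_orb v w(1) by simp
qed

text \<open>Two regular orbits of a cubic graph carry 3|K| edges, so the order of the automorphism
  group is divisible by a higher power of 3 than |K|.\<close>

lemma normalizing_element:
  "\<exists>g\<in>carrier A. g \<notin> K \<and> g [^]\<^bsub>A\<^esub> (3::nat) \<in> K \<and> (\<forall>k\<in>K. g \<otimes>\<^bsub>A\<^esub> k \<otimes>\<^bsub>A\<^esub> inv\<^bsub>A\<^esub> g \<in> K)"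
proof -
  obtain e where e: "2 * e = 3 * card (pverts G)" "e dvd order A"
    using edge_transitive_order[OF edge_trans] by blast
  then have "3 ^ Suc n dvd order A" by (simp add: card_verts cardK)
  then show ?thesis using A.exists_normalizing_element[OF _ K finite_A cardK] by simp
qed

lemma conj_action:
  assumes g: "g \<in> carrier A" and k: "k \<in> K" and v: "v \<in> pverts G"
  shows "g (k v) = (g \<otimes>\<^bsub>A\<^esub> k \<otimes>\<^bsub>A\<^esub> inv\<^bsub>A\<^esub> g) (g v)"
  using assms K_carrier[OF k] by (simp add: auto_mult auto_closed auto_inv)

lemma normalizing_orb:
  assumes g: "g \<in> carrier A" and norm: "\<forall>k\<in>K. g \<otimes>\<^bsub>A\<^esub> k \<otimes>\<^bsub>A\<^esub> inv\<^bsub>A\<^esub> g \<in> K"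
    and v: "v \<in> pverts G" and w: "w \<in> orb v"
  shows "g w \<in> orb (g v)"
proof -
  obtain k where k: "k \<in> K" "w = k v" using w by blast
  then show ?thesis using conj_action[OF g k(1) v] norm by auto
qed

text \<open>The normalizing element \<open>g\<close> permutes the two \<open>K\<close>-orbits, and
  its cube lies in \<open>K\<close> and preserves them; as 3 is odd, so does \<open>g\<close>. Hence
  \<open>g v = k v\<close> for some \<open>k\<close> in \<open>K\<close>, and k^-1 g fixes
  \<open>v\<close>.\<close>

lemma exists_vertex_rotation:
  assumes v: "v \<in> pverts G"
  shows "\<exists>\<sigma>\<in>carrier A. \<sigma> \<noteq> \<one>\<^bsub>A\<^esub> \<and> \<sigma> v = v \<and> (\<forall>k\<in>K. \<sigma> \<otimes>\<^bsub>A\<^esub> k \<otimes>\<^bsub>A\<^esub> inv\<^bsub>A\<^esub> \<sigma> \<in> K)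
     \<and> (\<forall>w\<in>pverts G. \<sigma> (\<sigma> (\<sigma> w)) = w)"
proof -
  obtain g where g: "g \<in> carrier A" "g \<notin> K" "g [^]\<^bsub>A\<^esub> (3::nat) \<in> K"
    and norm: "\<And>k. k \<in> K \<Longrightarrow> g \<otimes>\<^bsub>A\<^esub> k \<otimes>\<^bsub>A\<^esub> inv\<^bsub>A\<^esub> g \<in> K" using normalizing_element by blast
  have gV: "g w \<in> pverts G" if "w \<in> pverts G" for w using auto_closed[OF g(1) that] .
  have orb_g: "g w \<in> orb (g u)" if "u \<in> pverts G" "w \<in> orb u" for u w
    using normalizing_orb[OF g(1) _ that] norm by blast
  have cube: "g [^]\<^bsub>A\<^esub> (3::nat) = g \<otimes>\<^bsub>A\<^esub> (g \<otimes>\<^bsub>A\<^esub> g)"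
    using g(1) by (simp add: numeral_3_eq_3 A.m_assoc)
  have ggg: "g (g (g v)) \<in> orb v"
  proof -
    have "(g [^]\<^bsub>A\<^esub> (3::nat)) v = g (g (g v))" unfolding cube using g(1) v gV by (simp add: auto_mult)
    then show ?thesis using imageI[OF g(3), of "\<lambda>k. k v"] by simp
  qed
  have "g v \<in> orb v"
  proof (rule ccontr)
    assume not: "g v \<notin> orb v"
    have cover: "pverts G = orb v \<union> orb (g v)" "orb v \<inter> orb (g v) = {}"
      using orb_cover[OF v gV[OF v] not] by auto
    have "g (g v) \<in> orb v \<or> g (g v) \<in> orb (g v)" using cover(1) gV[OF gV[OF v]] by blast
    then have "g (g (g v)) \<in> orb (g v)"
    proof
      assume "g (g v) \<in> orb v"
      then show ?thesis by (rule orb_g[OF v])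
    next
      assume a: "g (g v) \<in> orb (g v)"
      have "g (g (g v)) \<in> orb (g (g v))" by (rule orb_g[OF gV[OF v] a])
      then show ?thesis using orb_eq[OF gV[OF v] a] by simp
    qed
    with ggg cover(2) show False by blast
  qed
  then obtain k where k: "k \<in> K" "g v = k v" by blast
  define l where "l = inv\<^bsub>A\<^esub> k"
  have l: "l \<in> K" "l \<in> carrier A" using subgroup.m_inv_closed[OF K k(1)] K_carrier by (auto simp: l_def)
  define \<sigma> where "\<sigma> = l \<otimes>\<^bsub>A\<^esub> g"
  have \<sigma>: "\<sigma> \<in> carrier A" using l g(1) by (simp add: \<sigma>_def)
  have \<sigma>v: "\<sigma> v = v"
    unfolding \<sigma>_def l_def using auto_inv(1)[OF K_carrier[OF k(1)] v] k(2) K_carrier[OF k(1)] g(1) v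
    by (simp add: auto_mult)
  have "\<sigma> \<noteq> \<one>\<^bsub>A\<^esub>"
  proof
    assume "\<sigma> = \<one>\<^bsub>A\<^esub>"
    then have "inv\<^bsub>A\<^esub> g = l" using l g(1) by (intro A.inv_equality) (simp_all add: \<sigma>_def)
    then have "g = inv\<^bsub>A\<^esub> l" using A.inv_inv[OF g(1)] by simp
    then show False using subgroup.m_inv_closed[OF K l(1)] g(2) by simp
  qed
  moreover have "\<sigma> \<otimes>\<^bsub>A\<^esub> h \<otimes>\<^bsub>A\<^esub> inv\<^bsub>A\<^esub> \<sigma> \<in> K" if h: "h \<in> K" for h
  proof -
    have "\<sigma> \<otimes>\<^bsub>A\<^esub> h \<otimes>\<^bsub>A\<^esub> inv\<^bsub>A\<^esub> \<sigma> = l \<otimes>\<^bsub>A\<^esub> (g \<otimes>\<^bsub>A\<^esub> h \<otimes>\<^bsub>A\<^esub> inv\<^bsub>A\<^esub> g) \<otimes>\<^bsub>A\<^esub> inv\<^bsub>A\<^esub> l"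
      using l g(1) K_carrier[OF h] by (simp add: \<sigma>_def A.inv_mult_group A.m_assoc)
    then show ?thesis using norm[OF h] l(1) K by (simp add: subgroup.m_closed subgroup.m_inv_closed)
  qed
  moreover have "\<sigma> (\<sigma> (\<sigma> w)) = w" if w: "w \<in> pverts G" for w
  proof -
    \<comment> \<open>The cube of l g is l times the conjugates of l by g and g^2 times g^3, an
      element of \<open>K\<close>. It fixes \<open>v\<close>, so it is trivial by
      semiregularity.\<close>
    have "\<sigma> \<otimes>\<^bsub>A\<^esub> (\<sigma> \<otimes>\<^bsub>A\<^esub> \<sigma>) = l \<otimes>\<^bsub>A\<^esub> (g \<otimes>\<^bsub>A\<^esub> l \<otimes>\<^bsub>A\<^esub> inv\<^bsub>A\<^esub> g)
        \<otimes>\<^bsub>A\<^esub> (g \<otimes>\<^bsub>A\<^esub> (g \<otimes>\<^bsub>A\<^esub> l \<otimes>\<^bsub>A\<^esub> inv\<^bsub>A\<^esub> g) \<otimes>\<^bsub>A\<^esub> inv\<^bsub>A\<^esub> g) \<otimes>\<^bsub>A\<^esub> (g \<otimes>\<^bsub>A\<^esub> (g \<otimes>\<^bsub>A\<^esub> g))"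
      using l(2) g(1) by (simp add: \<sigma>_def A.m_assoc A.inv_cancel)
    also have "\<dots> \<in> K"
      using l(1) norm g(3) K unfolding cube by (simp add: subgroup.m_closed)
    finally have inK: "\<sigma> \<otimes>\<^bsub>A\<^esub> (\<sigma> \<otimes>\<^bsub>A\<^esub> \<sigma>) \<in> K" .
    have app: "(\<sigma> \<otimes>\<^bsub>A\<^esub> (\<sigma> \<otimes>\<^bsub>A\<^esub> \<sigma>)) u = \<sigma> (\<sigma> (\<sigma> u))" if "u \<in> pverts G" for u
      using \<sigma> that by (simp add: auto_mult auto_closed)
    have "\<sigma> \<otimes>\<^bsub>A\<^esub> (\<sigma> \<otimes>\<^bsub>A\<^esub> \<sigma>) = \<one>\<^bsub>A\<^esub>" using semireg[OF inK v] app[OF v] \<sigma>v by simp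
    then show ?thesis using app[OF w] auto_one[OF w] by simp
  qed
  ultimately show ?thesis using \<sigma> \<sigma>v by blast
qed

text \<open>The rotation at \<open>v\<close> preserves the orbit of \<open>v\<close>, so a single
  neighbour inside the orbit brings in all three. Translation by \<open>K\<close> then makes the
  orbit closed under adjacency, against connectedness and the existence of a second orbit.\<close>

lemma adjacent_orbs:
  assumes a: "(v, w) \<in> parcs G"
  shows "w \<notin> orb v"
proof
  assume w: "w \<in> orb v"
  have v: "v \<in> pverts G" using a arc_verts by auto
  obtain \<sigma> where \<sigma>: "\<sigma> \<in> carrier A" "\<sigma> \<noteq> \<one>\<^bsub>A\<^esub>" "\<sigma> v = v"
    and norm: "\<forall>k\<in>K. \<sigma> \<otimes>\<^bsub>A\<^esub> k \<otimes>\<^bsub>A\<^esub> inv\<^bsub>A\<^esub> \<sigma> \<in> K" and \<sigma>3: "\<And>w. w \<in> pverts G \<Longrightarrow> \<sigma> (\<sigma> (\<sigma> w)) = w"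
    using exists_vertex_rotation[OF v] by blast
  have "nbs v = {w, \<sigma> w, \<sigma> (\<sigma> w)}"
    by (rule three_cycle_nbs[OF \<sigma>(1,2) \<sigma>3 v \<sigma>(3)]) (use a in \<open>simp_all add: nbs_def\<close>)
  moreover have "\<sigma> u \<in> orb v" if "u \<in> orb v" for u
    using normalizing_orb[OF \<sigma>(1) norm v that] \<sigma>(3) by simp
  ultimately have nv: "nbs v \<subseteq> orb v" using w by auto
  have "pverts G \<subseteq> orb v"
  proof (rule connected_closed[OF conn orb_self[OF v] v])
    fix u u' assume "u \<in> orb v" and a: "(u, u') \<in> parcs G"
    then obtain k where k: "k \<in> K" "u = k v" by blast
    have kA: "k \<in> carrier A" by (rule K_carrier[OF k(1)])
    have u': "u' \<in> pverts G" "u \<in> pverts G" using a arc_verts by auto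
    have "((inv\<^bsub>A\<^esub> k) u, (inv\<^bsub>A\<^esub> k) u') \<in> parcs G" using auto_adj[of "inv\<^bsub>A\<^esub> k"] kA u' a by simp
    then have "(inv\<^bsub>A\<^esub> k) u' \<in> nbs v" using auto_inv(1)[OF kA v] k(2) by (simp add: nbs_def)
    then have "k ((inv\<^bsub>A\<^esub> k) u') \<in> orb v" using nv orb_step[OF k(1) v] by blast
    then show "u' \<in> orb v" using auto_inv(2)[OF kA u'(1)] by simp
  qed
  then show False using exists_other_orb[OF v] by blast
qed

end

section \<open>The rotated generating pair\<close>

context semiregular_cubic
begin

abbreviation B where "B \<equiv> A\<lparr>carrier := K\<rparr>"

text \<open>The rotation \<sigma> at \<open>v1\<close> carries \<open>v0\<close> to
  \<open>x v0\<close> to \<open>y v0\<close> and back to \<open>v0\<close>. Since \<sigma> maps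
  \<open>k v0\<close> to \<alpha>(k) x applied to \<open>v0\<close>, semiregularity gives
  \<alpha>(x) x = y and \<alpha>(y) x = 1.\<close>

lemma rotation_pair:
  obtains v\<^sub>0 v\<^sub>1 x y \<alpha> where "(v\<^sub>0, v\<^sub>1) \<in> parcs G" "x \<in> K" "y \<in> K" "\<alpha> \<in> hom B B"
    "\<alpha> x = y \<otimes>\<^bsub>A\<^esub> inv\<^bsub>A\<^esub> x" "\<alpha> y = inv\<^bsub>A\<^esub> x" "generate A {x, y} = K"
    "\<And>s. s \<in> K \<Longrightarrow> (s v\<^sub>0, v\<^sub>1) \<in> parcs G \<longleftrightarrow> s \<in> {\<one>\<^bsub>A\<^esub>, x, y}"
proof -
  obtain v1 where v1: "v1 \<in> pverts G" using verts_nonempty by blast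
  have "nbs v1 \<noteq> {}" using card_nbs[OF v1] by auto
  then obtain v0 where v0: "v0 \<in> nbs v1" by blast
  then have adj: "(v0, v1) \<in> parcs G" using arc_sym by (simp add: nbs_def)
  then have v0V: "v0 \<in> pverts G" by (rule arc_verts)
  have v1_orb: "v1 \<notin> orb v0" by (rule adjacent_orbs[OF adj])
  note cover = orb_cover[OF v0V v1 v1_orb]
  obtain \<sigma> where \<sigma>: "\<sigma> \<in> carrier A" "\<sigma> \<noteq> \<one>\<^bsub>A\<^esub>" "\<sigma> v1 = v1"
    and norm: "\<forall>k\<in>K. \<sigma> \<otimes>\<^bsub>A\<^esub> k \<otimes>\<^bsub>A\<^esub> inv\<^bsub>A\<^esub> \<sigma> \<in> K" and \<sigma>3: "\<And>w. w \<in> pverts G \<Longrightarrow> \<sigma> (\<sigma> (\<sigma> w)) = w"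
    using exists_vertex_rotation[OF v1] by blast
  have nbs1: "nbs v1 = {v0, \<sigma> v0, \<sigma> (\<sigma> v0)}"
    using three_cycle_nbs[OF \<sigma>(1,2) \<sigma>3 v1 \<sigma>(3) v0] .
  have nbs_orb: "nbs v1 \<subseteq> orb v0"
  proof
    fix u assume u: "u \<in> nbs v1"
    then have "u \<notin> orb v1" using adjacent_orbs by (simp add: nbs_def)
    then show "u \<in> orb v0" using cover(1) nbs_sub u by blast
  qed
  obtain x where x: "x \<in> K" "\<sigma> v0 = x v0" using nbs_orb nbs1 by blast
  obtain y where y: "y \<in> K" "\<sigma> (\<sigma> v0) = y v0" using nbs_orb nbs1 by blast
  have S: "(s v0, v1) \<in> parcs G \<longleftrightarrow> s \<in> {\<one>\<^bsub>A\<^esub>, x, y}" if s: "s \<in> K" for s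
  proof -
    have "(s v0, v1) \<in> parcs G \<longleftrightarrow> s v0 \<in> nbs v1" using arc_sym by (auto simp: nbs_def)
    also have "\<dots> \<longleftrightarrow> s v0 = \<one>\<^bsub>A\<^esub> v0 \<or> s v0 = x v0 \<or> s v0 = y v0"
      unfolding nbs1 by (simp add: x(2) y(2)[unfolded x(2)] auto_one[OF v0V])
    also have "\<dots> \<longleftrightarrow> s \<in> {\<one>\<^bsub>A\<^esub>, x, y}"
      using K_inj[OF s _ v0V] subgroup.one_closed[OF K] x(1) y(1) by auto
    finally show ?thesis .
  qed
  define \<alpha> where "\<alpha> k = \<sigma> \<otimes>\<^bsub>A\<^esub> k \<otimes>\<^bsub>A\<^esub> inv\<^bsub>A\<^esub> \<sigma>" for k
  have \<alpha>K: "\<alpha> k \<in> K" if "k \<in> K" for k using norm that by (simp add: \<alpha>_def)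
  have \<alpha>_act: "\<sigma> (k v0) = (\<alpha> k \<otimes>\<^bsub>A\<^esub> x) v0" if k: "k \<in> K" for k
    using conj_action[OF \<sigma>(1) k v0V] \<alpha>K[OF k] K_carrier x v0V by (simp add: \<alpha>_def auto_mult)
  have hom: "\<alpha> \<in> hom B B"
  proof (rule homI)
    show "\<alpha> (k \<otimes>\<^bsub>B\<^esub> l) = \<alpha> k \<otimes>\<^bsub>B\<^esub> \<alpha> l" if "k \<in> carrier B" "l \<in> carrier B" for k l
      using that K_carrier \<sigma>(1) by (simp add: \<alpha>_def A.m_assoc A.inv_cancel)
  qed (use \<alpha>K in simp)
  have "\<alpha> x \<otimes>\<^bsub>A\<^esub> x = y"
  proof (rule K_inj[OF _ y(1) v0V])
    show "\<alpha> x \<otimes>\<^bsub>A\<^esub> x \<in> K" using subgroup.m_closed[OF K \<alpha>K[OF x(1)] x(1)] .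
    show "(\<alpha> x \<otimes>\<^bsub>A\<^esub> x) v0 = y v0" using \<alpha>_act[OF x(1)] x(2) y(2) by simp
  qed
  then have \<alpha>x: "\<alpha> x = y \<otimes>\<^bsub>A\<^esub> inv\<^bsub>A\<^esub> x"
    using K_carrier[OF \<alpha>K[OF x(1)]] K_carrier[OF x(1)] by (auto simp: A.m_assoc)
  have "\<alpha> y \<otimes>\<^bsub>A\<^esub> x = \<one>\<^bsub>A\<^esub>"
  proof (rule semireg[OF _ v0V])
    show "\<alpha> y \<otimes>\<^bsub>A\<^esub> x \<in> K" using subgroup.m_closed[OF K \<alpha>K[OF y(1)] x(1)] .
    show "(\<alpha> y \<otimes>\<^bsub>A\<^esub> x) v0 = v0" using \<alpha>_act[OF y(1)] y(2) \<sigma>3[OF v0V] by simp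
  qed
  then have \<alpha>y: "\<alpha> y = inv\<^bsub>A\<^esub> x"
    using K_carrier[OF \<alpha>K[OF y(1)]] K_carrier[OF x(1)] by (intro A.inv_equality[symmetric])
  define L where "L = generate A {x, y}"
  have L: "subgroup L A" unfolding L_def using K_carrier x(1) y(1) by (intro A.generate_is_subgroup) auto
  have LK: "L \<subseteq> K" unfolding L_def by (rule A.generate_subgroup_incl[OF _ K]) (use x y in auto)
  have SL: "s \<in> L" if "s \<in> {\<one>\<^bsub>A\<^esub>, x, y}" for s
    using that subgroup.one_closed[OF L] by (auto simp: L_def intro: generate.incl)
  \<comment> \<open>The translates of \<open>v0\<close> and \<open>v1\<close> by the subgroup
    \<open>L\<close> are closed under adjacency, hence they are all the vertices; semiregularity
    then leaves no room for elements of \<open>K\<close> outside \<open>L\<close>.\<close>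
  define W where "W = (\<lambda>k. k v0) ` L \<union> (\<lambda>k. k v1) ` L"
  have "pverts G \<subseteq> W"
  proof (rule connected_closed[OF conn _ v0V])
    show "v0 \<in> W" using imageI[OF subgroup.one_closed[OF L], of "\<lambda>k. k v0"] by (simp add: W_def auto_one[OF v0V])
  next
    fix u u' assume "u \<in> W" and a: "(u, u') \<in> parcs G"
    have u': "u' \<in> pverts G" and uV: "u \<in> pverts G" using a arc_verts by auto
    have back_adj: "(v, (inv\<^bsub>A\<^esub> k) u') \<in> parcs G" if "k \<in> L" "u = k v" "v \<in> pverts G" for k v
      using auto_adj[of "inv\<^bsub>A\<^esub> k" u u'] that K_carrier LK a u' uV auto_inv(1)[of k v] by auto
    from \<open>u \<in> W\<close> consider k where "k \<in> L" "u = k v0" | k where "k \<in> L" "u = k v1" by (auto simp: W_def)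
    then show "u' \<in> W"
    proof cases
      case 1
      have kA: "k \<in> carrier A" using 1 LK K_carrier by blast
      have b: "(v0, (inv\<^bsub>A\<^esub> k) u') \<in> parcs G" by (rule back_adj[OF 1 v0V])
      then have "(inv\<^bsub>A\<^esub> k) u' \<notin> orb v0" "(inv\<^bsub>A\<^esub> k) u' \<in> pverts G" using adjacent_orbs arc_verts by auto
      then obtain l where l: "l \<in> K" "(inv\<^bsub>A\<^esub> k) u' = l v1" using cover(1) by blast
      have lA: "l \<in> carrier A" by (rule K_carrier[OF l(1)])
      have "((inv\<^bsub>A\<^esub> l) v0, (inv\<^bsub>A\<^esub> l) (l v1)) \<in> parcs G"
        using auto_adj[of "inv\<^bsub>A\<^esub> l" v0 "l v1"] lA b v0V auto_closed[OF lA v1] by (simp add: l(2))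
      then have "(inv\<^bsub>A\<^esub> l) \<in> L" using S[OF subgroup.m_inv_closed[OF K l(1)]] SL auto_inv(1)[OF lA v1] by simp
      then have "l \<in> L" using subgroup.m_inv_closed[OF L, of "inv\<^bsub>A\<^esub> l"] A.inv_inv[OF lA] by simp
      have "u' = k (l v1)" using auto_inv(2)[OF kA u'] l(2) by simp
      also have "\<dots> = (k \<otimes>\<^bsub>A\<^esub> l) v1" using kA lA v1 by (simp add: auto_mult)
      finally show ?thesis using subgroup.m_closed[OF L 1(1) \<open>l \<in> L\<close>] by (auto simp: W_def)
    next
      case 2
      have kA: "k \<in> carrier A" using 2 LK K_carrier by blast
      have b: "(v1, (inv\<^bsub>A\<^esub> k) u') \<in> parcs G" by (rule back_adj[OF 2 v1])
      then have "(inv\<^bsub>A\<^esub> k) u' \<in> nbs v1" by (simp add: nbs_def)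
      then obtain s where s: "s \<in> K" "(inv\<^bsub>A\<^esub> k) u' = s v0" using nbs_orb by blast
      then have "s \<in> L" using S[OF s(1)] SL arc_sym[OF b] by simp
      have "u' = k (s v0)" using auto_inv(2)[OF kA u'] s(2) by simp
      also have "\<dots> = (k \<otimes>\<^bsub>A\<^esub> s) v0" using kA K_carrier[OF s(1)] v0V by (simp add: auto_mult)
      finally show ?thesis using subgroup.m_closed[OF L 2(1) \<open>s \<in> L\<close>] by (auto simp: W_def)
    qed
  qed
  have "K \<subseteq> L"
  proof
    fix k assume k: "k \<in> K"
    then have "k v0 \<in> W" using \<open>pverts G \<subseteq> W\<close> K_closed[OF k v0V] by blast
    moreover have "k v0 \<notin> (\<lambda>k. k v1) ` L"
    proof
      assume "k v0 \<in> (\<lambda>k. k v1) ` L"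
      then have "k v0 \<in> orb v1" using LK by blast
      then show False using cover(2) k by blast
    qed
    ultimately obtain l where "l \<in> L" "k v0 = l v0" by (auto simp: W_def)
    then show "k \<in> L" using K_inj[OF k _ v0V] LK by blast
  qed
  with LK have "generate A {x, y} = K" by (simp add: L_def)
  from that[OF adj x(1) y(1) hom \<alpha>x \<alpha>y this S] show thesis .
qed

end

section \<open>Identification with bi-Cayley graphs\<close>

text \<open>The bi-Cayley side parametrises the vertices, so \<theta> naturally runs from \<Delta>
  to \<Gamma>, whereas \<open>digraph_iso\<close> applies a map to \<Gamma>; hence the inverse
  \<open>f\<close>, acting on arcs as pairs.\<close>

lemma digraph_iso_with_proj:
  assumes wf: "wf_digraph (with_proj \<Gamma>)" and \<theta>: "bij_betw \<theta> (pverts \<Delta>) (pverts \<Gamma>)"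
    and sub: "parcs \<Delta> \<subseteq> pverts \<Delta> \<times> pverts \<Delta>"
    and adj: "\<And>u v. u \<in> pverts \<Delta> \<Longrightarrow> v \<in> pverts \<Delta> \<Longrightarrow> (u, v) \<in> parcs \<Delta> \<longleftrightarrow> (\<theta> u, \<theta> v) \<in> parcs \<Gamma>"
  shows "digraph_iso (with_proj \<Gamma>) (with_proj \<Delta>)"
proof -
  define f where "f = inv_into (pverts \<Delta>) \<theta>"
  have f: "bij_betw f (pverts \<Gamma>) (pverts \<Delta>)" unfolding f_def by (rule bij_betw_inv_into[OF \<theta>])
  have f\<theta>: "f (\<theta> u) = u" if "u \<in> pverts \<Delta>" for u
    unfolding f_def by (rule bij_betw_inv_into_left[OF \<theta> that])
  have \<theta>f: "\<theta> (f v) = v" if "v \<in> pverts \<Gamma>" for v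
    unfolding f_def by (rule bij_betw_inv_into_right[OF \<theta> that])
  have arcs: "u \<in> pverts \<Gamma>" "v \<in> pverts \<Gamma>" if "(u, v) \<in> parcs \<Gamma>" for u v
    using wf_digraph.tail_in_verts[OF wf, of "(u, v)"] wf_digraph.head_in_verts[OF wf, of "(u, v)"] that by auto
  have inj: "inj_on f (pverts \<Gamma>)" using f by (rule bij_betw_imp_inj_on)
  have fV: "f v \<in> pverts \<Delta>" if "v \<in> pverts \<Gamma>" for v using f that by (auto simp: bij_betw_def)
  have \<theta>V: "\<theta> v \<in> pverts \<Gamma>" if "v \<in> pverts \<Delta>" for v using \<theta> that by (auto simp: bij_betw_def)
  have "map_prod f f ` parcs \<Gamma> = parcs \<Delta>"
  proof
    show "map_prod f f ` parcs \<Gamma> \<subseteq> parcs \<Delta>"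
    proof
      fix a assume "a \<in> map_prod f f ` parcs \<Gamma>"
      then obtain u v where "(u, v) \<in> parcs \<Gamma>" "a = (f u, f v)" by auto
      then show "a \<in> parcs \<Delta>" using adj[of "f u" "f v"] arcs[of u v] fV \<theta>f by simp
    qed
    show "parcs \<Delta> \<subseteq> map_prod f f ` parcs \<Gamma>"
    proof (rule subrelI)
      fix u v assume a: "(u, v) \<in> parcs \<Delta>"
      then have uv: "u \<in> pverts \<Delta>" "v \<in> pverts \<Delta>" using sub by auto
      then have "(\<theta> u, \<theta> v) \<in> parcs \<Gamma>" using adj a by simp
      then have "map_prod f f (\<theta> u, \<theta> v) \<in> map_prod f f ` parcs \<Gamma>" by (rule imageI)
      then show "(u, v) \<in> map_prod f f ` parcs \<Gamma>" using f\<theta> uv by simp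
    qed
  qed
  moreover have "f ` pverts \<Gamma> = pverts \<Delta>" using f by (rule bij_betw_imp_surj_on)
  moreover have "inj_on (map_prod f f) (parcs \<Gamma>)"
    by (rule inj_on_subset[OF map_prod_inj_on[OF inj inj]]) (use arcs in auto)
  ultimately show ?thesis
    unfolding digraph_iso_def pre_digraph.digraph_isomorphism_def
    by (intro exI[of _ "\<lparr>iso_verts = f, iso_arcs = map_prod f f, iso_head = snd, iso_tail = fst\<rparr>"])
      (use wf inj in \<open>simp add: app_iso_def with_proj_def\<close>)
qed

lemma cubic_commutators_iso:
  assumes "group B" and \<phi>: "\<phi> \<in> iso B H" and "cubic_commutators H"
  shows "cubic_commutators B"
proof -
  interpret B: group B by fact
  interpret H: cubic_commutators H by fact
  interpret \<phi>: group_hom B H \<phi> by unfold_locales (use \<phi> in \<open>simp add: iso_def\<close>)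
  have bij: "bij_betw \<phi> (carrier B) (carrier H)" using \<phi> by (simp add: iso_def)
  have eqI: "g = h" if "g \<in> carrier B" "h \<in> carrier B" "\<phi> g = \<phi> h" for g h
    using bij that by (auto simp: bij_betw_def dest: inj_onD)
  show ?thesis
  proof
    fix g h assume g: "g \<in> carrier B" and h: "h \<in> carrier B"
    obtain u' where u': "u' \<in> carrier H" "\<phi> h \<otimes>\<^bsub>H\<^esub> \<phi> g = \<phi> g \<otimes>\<^bsub>H\<^esub> \<phi> h \<otimes>\<^bsub>H\<^esub> u' [^]\<^bsub>H\<^esub> (3::nat)"
      "(u' [^]\<^bsub>H\<^esub> (3::nat)) [^]\<^bsub>H\<^esub> (3::nat) = \<one>\<^bsub>H\<^esub>"
      "\<And>k. k \<in> carrier H \<Longrightarrow> u' [^]\<^bsub>H\<^esub> (3::nat) \<otimes>\<^bsub>H\<^esub> k = k \<otimes>\<^bsub>H\<^esub> u' [^]\<^bsub>H\<^esub> (3::nat)"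
      using H.commutator[of "\<phi> g" "\<phi> h"] g h by auto
    obtain u where u: "u \<in> carrier B" "\<phi> u = u'" 
      using u'(1) unfolding bij_betw_imp_surj_on[OF bij, symmetric] by blast
    show "\<exists>u\<in>carrier B. h \<otimes>\<^bsub>B\<^esub> g = g \<otimes>\<^bsub>B\<^esub> h \<otimes>\<^bsub>B\<^esub> u [^]\<^bsub>B\<^esub> (3::nat) \<and>
        (u [^]\<^bsub>B\<^esub> (3::nat)) [^]\<^bsub>B\<^esub> (3::nat) = \<one>\<^bsub>B\<^esub> \<and>
        (\<forall>k\<in>carrier B. u [^]\<^bsub>B\<^esub> (3::nat) \<otimes>\<^bsub>B\<^esub> k = k \<otimes>\<^bsub>B\<^esub> u [^]\<^bsub>B\<^esub> (3::nat))"
    proof (intro bexI[of _ u] conjI ballI)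
      show "h \<otimes>\<^bsub>B\<^esub> g = g \<otimes>\<^bsub>B\<^esub> h \<otimes>\<^bsub>B\<^esub> u [^]\<^bsub>B\<^esub> (3::nat)"
        by (rule eqI) (use g h u u'(2) in \<open>simp_all add: \<phi>.hom_nat_pow\<close>)
      show "(u [^]\<^bsub>B\<^esub> (3::nat)) [^]\<^bsub>B\<^esub> (3::nat) = \<one>\<^bsub>B\<^esub>"
        by (rule eqI) (use u u'(3) in \<open>simp_all add: \<phi>.hom_nat_pow\<close>)
      show "u [^]\<^bsub>B\<^esub> (3::nat) \<otimes>\<^bsub>B\<^esub> k = k \<otimes>\<^bsub>B\<^esub> u [^]\<^bsub>B\<^esub> (3::nat)" if "k \<in> carrier B" for k
        by (rule eqI) (use that u u'(4)[of "\<phi> k"] in \<open>simp_all add: \<phi>.hom_nat_pow\<close>)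
    qed (rule u(1))
  qed
qed

text \<open>A prime \<open>q\<close> dividing the part of the order prime to \<open>p\<close> would
  yield, by Sylow's theorem for exponent 1, an element of order \<open>q\<close>.\<close>

lemma (in group) p_group_order:
  assumes p: "prime p" and "p_group p G" and fin: "finite (carrier G)"
  shows "\<exists>n. order G = p ^ n"
proof -
  have "order G > 0" using fin by (simp add: order_gt_0_iff_finite)
  then obtain m where m: "order G = p ^ multiplicity p (order G) * m" "\<not> p dvd m"
    using multiplicity_decompose'[of "order G" p] p by (metis not_prime_unit neq0_conv)
  have "m = 1"
  proof (rule ccontr)
    assume "m \<noteq> 1"
    then obtain q where q: "prime q" "q dvd m" using prime_factor_nat by blast
    then obtain k where "order G = q ^ 1 * k" using m(1) by (metis dvd_mult dvdE power_one_right)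
    then obtain Q where Q: "subgroup Q G" "card Q = q" using sylow_thm[OF q(1) is_group _ fin] by fastforce
    interpret Q: group "G\<lparr>carrier := Q\<rparr>" by (rule subgroup.subgroup_is_group[OF Q(1) is_group])
    have "\<not> Q \<subseteq> {\<one>}"
    proof
      assume "Q \<subseteq> {\<one>}"
      then have "card Q \<le> 1" using card_mono[of "{\<one>}" Q] by simp
      then show False using Q(2) prime_gt_1_nat[OF q(1)] by simp
    qed
    then obtain g where g: "g \<in> Q" "g \<noteq> \<one>" by blast
    have gc: "g \<in> carrier G" using g subgroup.mem_carrier[OF Q(1)] by blast
    have "g [^] q = \<one>"
      using Q.pow_order_eq_1[of g] g(1) Q(2) by (simp add: order_def flip: nat_pow_consistent)
    then have "ord g dvd q" using pow_eq_id[OF gc] by simp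
    moreover have "ord g \<noteq> 1" using g(2) ord_eq_1[OF gc] by simp
    ultimately have "ord g = q" using q(1) by (auto simp: prime_nat_iff)
    moreover obtain e where "ord g = p ^ e" using assms(2) gc by (auto simp: p_group_def)
    ultimately have "q = p ^ e" by simp
    then have "q dvd p" using q(1) prime_dvd_power[OF q(1), of p e] by simp
    then have "q = p" using p q(1) by (simp add: primes_dvd_imp_eq)
    with q(2) m(2) show False by simp
  qed
  then show ?thesis using m(1) by auto
qed

context semiregular_cubic
begin

text \<open>The vertex p_i goes to (h p)^-1 w_i. The inverse is forced: adjacency in
  \<open>BiCay\<close> depends on q p^-1 and is invariant under right multiplication, while
  \<open>K\<close> acts on vertices from the left. Applying \<open>h q\<close> to both ends turns
  adjacency of the images into \<open>h (q p^-1) w_0\<close> being adjacent to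
  \<open>w_1\<close>.\<close>

lemma digraph_iso_BiCay:
  assumes adj: "(w\<^sub>0, w\<^sub>1) \<in> parcs G" and "group P" and h: "h \<in> iso P B"
    and T: "\<And>p. p \<in> carrier P \<Longrightarrow> p \<in> T \<longleftrightarrow> (h p w\<^sub>0, w\<^sub>1) \<in> parcs G"
  shows "digraph_iso (with_proj G) (with_proj (BiCay P {} {} T))"
proof -
  interpret P: group P by fact
  interpret BG: group B by (rule subgroup.subgroup_is_group[OF K A.is_group])
  interpret h: group_hom P B h by unfold_locales (use h in \<open>simp add: iso_def\<close>)
  have bij: "bij_betw h (carrier P) K" using h by (simp add: iso_def)
  have hK: "h p \<in> K" and hA: "h p \<in> carrier A" if "p \<in> carrier P" for p
    using bij that K_carrier by (auto simp: bij_betw_def)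
  have hinvK: "inv\<^bsub>A\<^esub> (h p) \<in> K" if "p \<in> carrier P" for p
    using subgroup.m_inv_closed[OF K hK[OF that]] .
  have w: "w\<^sub>0 \<in> pverts G" "w\<^sub>1 \<in> pverts G" using adj arc_verts by auto
  have w_orb: "w\<^sub>1 \<notin> orb w\<^sub>0" by (rule adjacent_orbs[OF adj])
  note cover = orb_cover[OF w w_orb]
  define \<theta> where "\<theta> = case_sum (\<lambda>p. (inv\<^bsub>A\<^esub> (h p)) w\<^sub>0) (\<lambda>p. (inv\<^bsub>A\<^esub> (h p)) w\<^sub>1)"
  have \<theta>_simps: "\<theta> (Inl p) = (inv\<^bsub>A\<^esub> (h p)) w\<^sub>0" "\<theta> (Inr p) = (inv\<^bsub>A\<^esub> (h p)) w\<^sub>1" for p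
    by (simp_all add: \<theta>_def)
  have orbs: "\<theta> (Inl p) \<in> orb w\<^sub>0" "\<theta> (Inr p) \<in> orb w\<^sub>1" if "p \<in> carrier P" for p
    using hinvK[OF that] by (auto simp: \<theta>_simps)
  have \<theta>V: "\<theta> (Inl p) \<in> pverts G" "\<theta> (Inr p) \<in> pverts G" if "p \<in> carrier P" for p
    using orbs[OF that] orb_verts w by blast+
  have inj1: "p = q" if pq: "p \<in> carrier P" "q \<in> carrier P" and u: "u \<in> pverts G"
      and eq: "(inv\<^bsub>A\<^esub> (h p)) u = (inv\<^bsub>A\<^esub> (h q)) u" for p q u
  proof -
    have "inv\<^bsub>A\<^esub> (h p) = inv\<^bsub>A\<^esub> (h q)" by (rule K_inj[OF hinvK hinvK u eq]) (use pq in simp_all)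
    then have "inv\<^bsub>A\<^esub> (inv\<^bsub>A\<^esub> (h p)) = inv\<^bsub>A\<^esub> (inv\<^bsub>A\<^esub> (h q))" by simp
    then have "h p = h q" using hA pq by simp
    then show ?thesis using bij pq by (auto simp: bij_betw_def dest: inj_onD)
  qed
  have surj1: "orb u \<subseteq> (\<lambda>p. (inv\<^bsub>A\<^esub> (h p)) u) ` carrier P" for u
  proof clarify
    fix k assume k: "k \<in> K"
    obtain p where p: "p \<in> carrier P" "h p = inv\<^bsub>A\<^esub> k"
      using subgroup.m_inv_closed[OF K k] unfolding bij_betw_imp_surj_on[OF bij, symmetric] by force
    then have "k u = (inv\<^bsub>A\<^esub> (h p)) u" using K_carrier[OF k] by simp
    with p(1) show "k u \<in> (\<lambda>p. (inv\<^bsub>A\<^esub> (h p)) u) ` carrier P" by blast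
  qed
  have "bij_betw \<theta> (pverts (BiCay P {} {} T)) (pverts G)"
  proof (rule bij_betw_imageI)
    show "inj_on \<theta> (pverts (BiCay P {} {} T))"
    proof (rule inj_onI)
      fix a b assume ab: "a \<in> pverts (BiCay P {} {} T)" "b \<in> pverts (BiCay P {} {} T)" and eq: "\<theta> a = \<theta> b"
      have disj: "\<theta> (Inl p) \<noteq> \<theta> (Inr q)" if "p \<in> carrier P" "q \<in> carrier P" for p q
        using disjoint_iff[THEN iffD1, OF cover(2)] orbs(1)[OF that(1)] orbs(2)[OF that(2)] by force
      show "a = b"
        using ab eq disj disj[symmetric] inj1[OF _ _ w(1)] inj1[OF _ _ w(2)]
        by (auto simp: BiCay_def \<theta>_simps dest: sym)
    qed
    show "\<theta> ` pverts (BiCay P {} {} T) = pverts G"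
    proof
      show "\<theta> ` pverts (BiCay P {} {} T) \<subseteq> pverts G" using \<theta>V by (auto simp: BiCay_def)
      have "\<theta> ` pverts (BiCay P {} {} T)
          = (\<lambda>p. (inv\<^bsub>A\<^esub> (h p)) w\<^sub>0) ` carrier P \<union> (\<lambda>p. (inv\<^bsub>A\<^esub> (h p)) w\<^sub>1) ` carrier P"
        by (auto simp: BiCay_def Plus_def image_Un image_image \<theta>_simps)
      then show "pverts G \<subseteq> \<theta> ` pverts (BiCay P {} {} T)"
        unfolding cover(1) using surj1[of w\<^sub>0] surj1[of w\<^sub>1] by blast
    qed
  qed
  moreover have LR: "q \<otimes>\<^bsub>P\<^esub> inv\<^bsub>P\<^esub> p \<in> T \<longleftrightarrow> (\<theta> (Inl p), \<theta> (Inr q)) \<in> parcs G"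
    if p: "p \<in> carrier P" and q: "q \<in> carrier P" for p q
  proof -
    have hqp: "h (q \<otimes>\<^bsub>P\<^esub> inv\<^bsub>P\<^esub> p) = h q \<otimes>\<^bsub>A\<^esub> inv\<^bsub>A\<^esub> (h p)"
      using p q h.hom_mult[of q "inv\<^bsub>P\<^esub> p"] h.hom_inv[OF p] A.m_inv_consistent[OF K hK[OF p]] by simp
    have "q \<otimes>\<^bsub>P\<^esub> inv\<^bsub>P\<^esub> p \<in> T \<longleftrightarrow> (h q (\<theta> (Inl p)), w\<^sub>1) \<in> parcs G"
      using T[of "q \<otimes>\<^bsub>P\<^esub> inv\<^bsub>P\<^esub> p"] p q hA w by (simp add: hqp auto_mult \<theta>_simps)
    also have "\<dots> \<longleftrightarrow> (h q (\<theta> (Inl p)), h q (\<theta> (Inr q))) \<in> parcs G"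
      using auto_inv(2)[OF hA[OF q] w(2)] by (simp add: \<theta>_simps)
    also have "\<dots> \<longleftrightarrow> (\<theta> (Inl p), \<theta> (Inr q)) \<in> parcs G"
      by (rule auto_adj[OF hA[OF q] \<theta>V(1)[OF p] \<theta>V(2)[OF q]])
    finally show ?thesis .
  qed
  have same: "(a, b) \<notin> parcs G" if "a \<in> orb u" "b \<in> orb u" "u \<in> pverts G" for a b u
    using adjacent_orbs[of a b] orb_eq[OF that(3,1)] that(2) by auto
  have adj_iff: "(a, b) \<in> parcs (BiCay P {} {} T) \<longleftrightarrow> (\<theta> a, \<theta> b) \<in> parcs G"
    if "a \<in> pverts (BiCay P {} {} T)" "b \<in> pverts (BiCay P {} {} T)" for a b
  proof -
    have ab: "a \<in> carrier P <+> carrier P" "b \<in> carrier P <+> carrier P" using that by (simp_all add: BiCay_def)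
    show ?thesis
    proof (cases a; cases b)
      fix p q assume pq: "a = Inl p" "b = Inl q"
      then show ?thesis using ab same[OF orbs(1) orbs(1) w(1), of p q] by (auto simp: BiCay_def)
    next
      fix p q assume pq: "a = Inr p" "b = Inr q"
      then show ?thesis using ab same[OF orbs(2) orbs(2) w(2), of p q] by (auto simp: BiCay_def)
    next
      fix p q assume pq: "a = Inl p" "b = Inr q"
      then show ?thesis using ab LR[of p q] by (auto simp: BiCay_def)
    next
      fix p q assume pq: "a = Inr p" "b = Inl q"
      then show ?thesis using ab LR[of q p] arc_sym by (auto simp: BiCay_def)
    qed
  qed
  moreover have "wf_digraph (with_proj G)"
    using arc_verts by unfold_locales auto
  moreover have "parcs (BiCay P {} {} T) \<subseteq> pverts (BiCay P {} {} T) \<times> pverts (BiCay P {} {} T)"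
    by (auto simp: BiCay_def)
  ultimately show ?thesis by (intro digraph_iso_with_proj[of G \<theta>]) blast+
qed

end

theorem theorem1p2:
  fixes H :: "('h, 'b) monoid_scheme" and \<Gamma> :: "'v pair_pre_digraph"
  assumes "inner_abelian H" and "metacyclic H" and "p_group 3 H"
    and "pair_graph \<Gamma>" and "Digraph_Component.connected (with_proj \<Gamma>)"
    and "cubic \<Gamma>" and "edge_transitive \<Gamma>" and "bi_Cayley_over \<Gamma> H"
  shows "\<exists>t>0. digraph_iso (with_proj \<Gamma>) (with_proj (Gamma_graph t))
             \<or> digraph_iso (with_proj \<Gamma>) (with_proj (Sigma_graph t))"
proof -
  interpret H: cubic_commutators H
    using assms(1-3) by (rule inner_abelian_metacyclic_cubic_commutators)
  interpret automorphism_action \<Gamma> by (rule automorphism_action.intro) fact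
  obtain K where K: "subgroup K A" and iso: "A\<lparr>carrier := K\<rparr> \<cong> H"
    and semireg: "semiregular (A\<lparr>carrier := K\<rparr>) (pverts \<Gamma>) (\<lambda>f. f)"
    and two: "card (orbits (A\<lparr>carrier := K\<rparr>) (pverts \<Gamma>) (\<lambda>f. f)) = 2"
    using assms(8) unfolding bi_Cayley_over_def Let_def by blast
  obtain \<phi> where \<phi>: "\<phi> \<in> iso (A\<lparr>carrier := K\<rparr>) H" using iso by (auto simp: is_iso_def)
  have bij: "bij_betw \<phi> K (carrier H)" using \<phi> by (simp add: iso_def)
  interpret B: group "A\<lparr>carrier := K\<rparr>" by (rule subgroup.subgroup_is_group[OF K A.is_group])
  \<comment> \<open>Finiteness of \<open>H\<close> is inherited from the automorphism group of the
    finite graph; only then do the element orders make |H| a power of 3.\<close>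
  have finK: "finite K" using finite_subset[OF subgroup.subset[OF K] finite_A] .
  then have "finite (carrier H)" using bij_betw_finite[OF bij] by simp
  then obtain n where "order H = 3 ^ n" using H.p_group_order[OF _ assms(3)] by auto
  then have cardK: "card K = 3 ^ n" using bij_betw_same_card[OF bij] by (simp add: order_def)
  interpret semiregular_cubic \<Gamma> K n
  proof (intro semiregular_cubic.intro cubic_graph.intro cubic_graph_axioms.intro
      semiregular_cubic_axioms.intro automorphism_action_axioms)
    show "k = \<one>\<^bsub>A\<^esub>" if "k \<in> K" "v \<in> pverts \<Gamma>" "k v = v" for k v
      using semireg that by (auto simp: semiregular_def stabilizer_def)
    have "orbits (A\<lparr>carrier := K\<rparr>) (pverts \<Gamma>) (\<lambda>f. f) = (\<lambda>v. (\<lambda>k. k v) ` K) ` pverts \<Gamma>"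
      by (auto simp: orbits_def Group_Action.orbit_def)
    with two show "card ((\<lambda>v. (\<lambda>k. k v) ` K) ` pverts \<Gamma>) = 2" by simp
  qed (fact assms K cardK)+
  obtain v\<^sub>0 v\<^sub>1 x y \<alpha> where adj: "(v\<^sub>0, v\<^sub>1) \<in> parcs \<Gamma>" and xyK: "x \<in> K" "y \<in> K" and hom: "\<alpha> \<in> hom B B"
    and \<alpha>: "\<alpha> x = y \<otimes>\<^bsub>A\<^esub> inv\<^bsub>A\<^esub> x" "\<alpha> y = inv\<^bsub>A\<^esub> x" and gen: "generate A {x, y} = K"
    and S: "\<And>s. s \<in> K \<Longrightarrow> (s v\<^sub>0, v\<^sub>1) \<in> parcs \<Gamma> \<longleftrightarrow> s \<in> {\<one>\<^bsub>A\<^esub>, x, y}"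
    by (rule rotation_pair) (rule that)
  have inv_B: "inv\<^bsub>B\<^esub> k = inv\<^bsub>A\<^esub> k" if "k \<in> K" for k
    using A.m_inv_consistent[OF K that] by simp
  have noncomm: "\<not> comm_group B"
    using comm_group.iso_imp_comm_group[OF _ iso H.is_monoid] assms(1) by (auto simp: inner_abelian_def)
  interpret cubic_commutators B
    by (rule cubic_commutators_iso[OF B.is_group \<phi> H.cubic_commutators_axioms])
  interpret eisenstein_pair B x y \<alpha>
  proof unfold_locales
    show "\<exists>N. x [^]\<^bsub>B\<^esub> (3 ^ N :: nat) = \<one>\<^bsub>B\<^esub>"
      using B.pow_order_eq_1[of x] xyK cardK by (auto simp: order_def)
    show "generate B {x, y} = carrier B" using A.generate_consistent[OF _ K, of "{x, y}"] gen xyK by simp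
  qed (use xyK hom \<alpha> noncomm in \<open>simp_all add: inv_B\<close>)
  obtain t u v where t: "t > 0" and uv: "(u, v) \<in> {(x, y), (inv\<^bsub>B\<^esub> x, inv\<^bsub>B\<^esub> y)}"
    and pres: "(\<exists>h\<in>iso (presented_group (rels_G t)) B.
        h (pres_gen (rels_G t) gen_a) = u \<and> h (pres_gen (rels_G t) gen_b) = u \<otimes>\<^bsub>B\<^esub> v)
     \<or> (\<exists>h\<in>iso (presented_group (rels_H t)) B.
        h (pres_gen (rels_H t) gen_b) = u \<and> h (pres_gen (rels_H t) gen_a) = u \<otimes>\<^bsub>B\<^esub> v)"
    using presentation by blast
  have uvK: "u \<in> K" "v \<in> K" using uv xyK B.inv_closed[of x] B.inv_closed[of y] by auto
  obtain w\<^sub>0 w\<^sub>1 where w: "(w\<^sub>0, w\<^sub>1) \<in> parcs \<Gamma>"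
    and T: "\<And>s. s \<in> K \<Longrightarrow> (s w\<^sub>0, w\<^sub>1) \<in> parcs \<Gamma> \<longleftrightarrow> s \<in> {\<one>\<^bsub>A\<^esub>, u, v}"
  proof (cases "u = x \<and> v = y")
    case True
    then show thesis using that[OF adj] S by blast
  next
    case False
    then have uv': "u = inv\<^bsub>A\<^esub> x" "v = inv\<^bsub>A\<^esub> y" using uv inv_B[OF xyK(1)] inv_B[OF xyK(2)] by auto
    \<comment> \<open>Exchanging the two orbits replaces the connection set by its inverse.\<close>
    have "(s v\<^sub>1, v\<^sub>0) \<in> parcs \<Gamma> \<longleftrightarrow> s \<in> {\<one>\<^bsub>A\<^esub>, u, v}" if s: "s \<in> K" for s
    proof -
      have sA: "s \<in> carrier A" and V: "v\<^sub>0 \<in> pverts \<Gamma>" "v\<^sub>1 \<in> pverts \<Gamma>"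
        using K_carrier[OF s] arc_verts[OF adj] by auto
      have "(s v\<^sub>1, v\<^sub>0) \<in> parcs \<Gamma> \<longleftrightarrow> (v\<^sub>0, s v\<^sub>1) \<in> parcs \<Gamma>" using arc_sym by blast
      also have "\<dots> \<longleftrightarrow> ((inv\<^bsub>A\<^esub> s) v\<^sub>0, v\<^sub>1) \<in> parcs \<Gamma>"
        using auto_adj[of "inv\<^bsub>A\<^esub> s" "v\<^sub>0" "s v\<^sub>1"] sA V auto_closed[OF sA V(2)] auto_inv(1)[OF sA V(2)] by simp
      also have "\<dots> \<longleftrightarrow> inv\<^bsub>A\<^esub> s \<in> {\<one>\<^bsub>A\<^esub>, x, y}" by (rule S[OF subgroup.m_inv_closed[OF K s]])
      also have "\<dots> \<longleftrightarrow> s \<in> {\<one>\<^bsub>A\<^esub>, u, v}"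
      proof -
        have "inv\<^bsub>A\<^esub> s = k \<longleftrightarrow> s = inv\<^bsub>A\<^esub> k" if "k \<in> carrier A" for k
          using that sA by auto
        from this[of "\<one>\<^bsub>A\<^esub>"] this[OF K_carrier[OF xyK(1)]] this[OF K_carrier[OF xyK(2)]]
        show ?thesis unfolding uv' by simp
      qed
      finally show ?thesis .
    qed
    then show thesis using that[OF arc_sym[OF adj]] by blast
  qed
  \<comment> \<open>Kept general in \<open>a\<close> and \<open>b\<close>, since the two families
    take the preimages of \<open>u\<close> and \<open>u v\<close> from opposite generators.\<close>
  have conn_set: "p \<in> {\<one>\<^bsub>P\<^esub>, a, inv\<^bsub>P\<^esub> a \<otimes>\<^bsub>P\<^esub> b} \<longleftrightarrow> (h p w\<^sub>0, w\<^sub>1) \<in> parcs \<Gamma>"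
    if P: "group P" and h: "h \<in> iso P B" and ab: "a \<in> carrier P" "b \<in> carrier P" "h a = u" "h b = u \<otimes>\<^bsub>B\<^esub> v"
      and p: "p \<in> carrier P" for P :: "gen word set monoid" and h a b p
  proof -
    interpret P: group P by (rule P)
    interpret h: group_hom P B h by unfold_locales (use h in \<open>simp add: iso_def\<close>)
    have inj: "inj_on h (carrier P)" and hp: "h p \<in> K" using h p by (auto simp: iso_def bij_betw_def)
    have "h (inv\<^bsub>P\<^esub> a \<otimes>\<^bsub>P\<^esub> b) = v" using ab uvK B.inv_cancel(2)[of u v] by simp
    then have "h p \<in> {\<one>\<^bsub>B\<^esub>, u, v} \<longleftrightarrow> h p \<in> h ` {\<one>\<^bsub>P\<^esub>, a, inv\<^bsub>P\<^esub> a \<otimes>\<^bsub>P\<^esub> b}" using ab by simp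
    also have "\<dots> \<longleftrightarrow> p \<in> {\<one>\<^bsub>P\<^esub>, a, inv\<^bsub>P\<^esub> a \<otimes>\<^bsub>P\<^esub> b}"
      by (rule inj_on_image_mem_iff[OF inj p]) (use ab in auto)
    finally show ?thesis using T[OF hp] by simp
  qed
  from pres have "digraph_iso (with_proj \<Gamma>) (with_proj (Gamma_graph t))
      \<or> digraph_iso (with_proj \<Gamma>) (with_proj (Sigma_graph t))"
  proof (elim disjE bexE conjE)
    fix h assume h: "h \<in> iso (presented_group (rels_G t)) B" "h (pres_gen (rels_G t) gen_a) = u"
      "h (pres_gen (rels_G t) gen_b) = u \<otimes>\<^bsub>B\<^esub> v"
    have "digraph_iso (with_proj \<Gamma>) (with_proj (Gamma_graph t))"
      unfolding Gamma_graph_def Let_def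
      using digraph_iso_BiCay[OF w group_presented_group h(1)]
        conn_set[OF group_presented_group h(1) pres_gen_carrier pres_gen_carrier h(2,3)] by blast
    then show ?thesis ..
  next
    fix h assume h: "h \<in> iso (presented_group (rels_H t)) B" "h (pres_gen (rels_H t) gen_b) = u"
      "h (pres_gen (rels_H t) gen_a) = u \<otimes>\<^bsub>B\<^esub> v"
    have "digraph_iso (with_proj \<Gamma>) (with_proj (Sigma_graph t))"
      unfolding Sigma_graph_def Let_def
      using digraph_iso_BiCay[OF w group_presented_group h(1)]
        conn_set[OF group_presented_group h(1) pres_gen_carrier pres_gen_carrier h(2,3)] by blast
    then show ?thesis ..
  qed
  with t show ?thesis by blast
qed

end
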